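(* Let $\lambda<0$, $1<\gamma<3$, $\ell=\frac{2}{\gamma-1}$, $u_+\in\mathbb{R}$, $c_+>0$ and $\mathrm{Ma}=u_+/c_+$. Consider the isentropic Euler system $$u_t+uu_x+\ell cc_x=0,\qquad c_t+uc_x+\ell^{-1}cu_x=0,$$ with initial data $c(0,x)=0$ ($u(0,x)$ undefined; vacuum) for $x<0$, and $u(0,x)=u_+x^{1-\lambda}$, $c(0,x)=c_+x^{1-\lambda}$ for $x>0$. Then: (1) For $\mathrm{Ma}\ge\ell$ there exists a globally defined, self-similar, and shock-free solution. The solution has a stationary vacuum interface along $x=0$ where the sound speed decays to zero at the same super-linear rate $\sim x^{1-\lambda}$ at all times $t\ge0$. (2) For $\mathrm{Ma}<\ell$ the self-similar solution is defined only on a part of the $(x,t)$-plane.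
   Context: The underlying conservation laws are $\rho_t+(\rho u)_x=0$, $(\rho u)_t+(\rho u^2)_x+p_x=0$ with $p=a^2\rho^\gamma$, $a>0$, and sound speed $c=a\sqrt\gamma\,\rho^{(\gamma-1)/2}\ge0$. "Globally defined" means defined for all $t>0$, $x\in\mathbb{R}$ (with vacuum, $c=0$, to the left of the vacuum interface); "shock-free" means that $u,c$ are continuous in the fluid region. The initial data are attained as $u(t,x)\to u_+x^{1-\lambda}$, $c(t,x)\to c_+x^{1-\lambda}$ as $t\downarrow0$, for each fixed $x>0$. Self-similar solutions have the form $u=-\frac1\lambda\frac xtV(\xi)$, $c=-\frac1\lambda\frac xtC(\xi)$, $\xi=t^{-1/\lambda}x$, where in smooth regions $(V,C)$ solves the similarity ODEs $$\frac{dV}{d\xi}=\frac1\xi\frac{G(V,C)}{D(V,C)},\qquad \frac{dC}{d\xi}=\frac1\xi\frac{F(V,C)}{D(V,C)},$$ with $D=(1+V)^2-C^2$, $G=C^2(V-V_* )-V(1+V)(\lambda+V)$, $F=C\{C^2-(1+V)^2+k_1(1+V)-k_0\}$, $V_*=\ell(1-\lambda)$, $k_1=(\ell^{-1}-1)(\lambda-1)$, $k_0=\ell^{-1}(\lambda-1)$. The self-similar solution with the given data (for $\lambda<0$) is the one determined by the solution $(V,C)$ of the similarity ODEs emanating from $(0,0)$ as $\xi$ increases from $0$, with $\lim_{\xi\downarrow0}\xi^\lambda V(\xi)=-\lambda u_+$ and $\lim_{\xi\downarrow0}\xi^\lambda C(\xi)=-\lambda c_+$, possibly continued by jumps at values $\xi=\bar\xi>0$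 corresponding to entropy admissible shocks. Here a jump at $\bar\xi$ from the right state $(V_+,C_+)$ (limit $\xi\downarrow\bar\xi$) and left state $(V_-,C_-)$ (limit $\xi\uparrow\bar\xi$) is admissible if $|C|^\ell(1+V)$ and $|C|^\ell\big((1+V)^2+\frac1\gamma C^2\big)$ take equal values at the two states and either $\frac{\bar\xi}{\lambda}(C_--V_-)>\frac{\bar\xi}{\lambda}>\frac{\bar\xi}{\lambda}(C_+-V_+)$ (1-shock) or $-\frac{\bar\xi}{\lambda}(C_-+V_-)>\frac{\bar\xi}{\lambda}>-\frac{\bar\xi}{\lambda}(C_++V_+)$ (2-shock). That it is "defined only on a part of the $(x,t)$-plane" means that $(V,C)$, even when continued by admissible jumps, cannot be continued to all $\xi\in(0,\infty)$: the flow is only defined in a region of the form $\{(x,t): t^{-1/\lambda}x<\xi_*\}$ for some $0<\xi_*<\infty$. *)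

theory Defs
  imports "HOL-Analysis.Analysis" "HOL-Library.Landau_Symbols"
begin

section \<open>Similarity ODEs\<close>

definition sim_D :: "real \<Rightarrow> real \<Rightarrow> real" where
  "sim_D V C = (1 + V)\<^sup>2 - C\<^sup>2"

definition sim_G :: "real \<Rightarrow> real \<Rightarrow> real \<Rightarrow> real \<Rightarrow> real" where
  "sim_G lam ell V C =
     (let V_star = ell * (1 - lam)
      in C\<^sup>2 * (V - V_star) - V * (1 + V) * (lam + V))"

definition sim_F :: "real \<Rightarrow> real \<Rightarrow> real \<Rightarrow> real \<Rightarrow> real" where
  "sim_F lam ell V C =
     (let k1 = (inverse ell - 1) * (lam - 1); k0 = inverse ell * (lam - 1)
      in C * (C\<^sup>2 - (1 + V)\<^sup>2 + k1 * (1 + V) - k0))"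

text \<open>The condition \<^term>\<open>sim_D V C \<noteq> 0\<close> is explicit because division by zero is total.\<close>

definition solves_similarity_ode ::
    "real \<Rightarrow> real \<Rightarrow> (real \<Rightarrow> real) \<Rightarrow> (real \<Rightarrow> real) \<Rightarrow> real \<Rightarrow> bool" where
  "solves_similarity_ode lam ell V C \<xi> \<longleftrightarrow>
     sim_D (V \<xi>) (C \<xi>) \<noteq> 0 \<and>
     (V has_real_derivative 1 / \<xi> * (sim_G lam ell (V \<xi>) (C \<xi>) / sim_D (V \<xi>) (C \<xi>))) (at \<xi>) \<and>
     (C has_real_derivative 1 / \<xi> * (sim_F lam ell (V \<xi>) (C \<xi>) / sim_D (V \<xi>) (C \<xi>))) (at \<xi>)"

section \<open>Admissible shocks\<close>

definition rankine_hugoniot ::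
    "real \<Rightarrow> real \<Rightarrow> real \<Rightarrow> real \<Rightarrow> real \<Rightarrow> real \<Rightarrow> bool" where
  "rankine_hugoniot ell gam Vm Cm Vp Cp \<longleftrightarrow>
     \<bar>Cm\<bar> powr ell * (1 + Vm) = \<bar>Cp\<bar> powr ell * (1 + Vp) \<and>
     \<bar>Cm\<bar> powr ell * ((1 + Vm)\<^sup>2 + 1 / gam * Cm\<^sup>2) =
       \<bar>Cp\<bar> powr ell * ((1 + Vp)\<^sup>2 + 1 / gam * Cp\<^sup>2)"

definition one_shock :: "real \<Rightarrow> real \<Rightarrow> real \<Rightarrow> real \<Rightarrow> real \<Rightarrow> real \<Rightarrow> bool" where
  "one_shock lam \<xi> Vm Cm Vp Cp \<longleftrightarrow>
     \<xi> / lam * (Cm - Vm) > \<xi> / lam \<and> \<xi> / lam > \<xi> / lam * (Cp - Vp)"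

definition two_shock :: "real \<Rightarrow> real \<Rightarrow> real \<Rightarrow> real \<Rightarrow> real \<Rightarrow> real \<Rightarrow> bool" where
  "two_shock lam \<xi> Vm Cm Vp Cp \<longleftrightarrow>
     - (\<xi> / lam) * (Cm + Vm) > \<xi> / lam \<and> \<xi> / lam > - (\<xi> / lam) * (Cp + Vp)"

definition admissible_jump ::
    "real \<Rightarrow> real \<Rightarrow> real \<Rightarrow> (real \<Rightarrow> real) \<Rightarrow> (real \<Rightarrow> real) \<Rightarrow> real \<Rightarrow> bool" where
  "admissible_jump lam ell gam V C \<xi> \<longleftrightarrow>
     (\<exists>Vm Cm Vp Cp.
        (V \<longlongrightarrow> Vm) (at_left \<xi>) \<and> (C \<longlongrightarrow> Cm) (at_left \<xi>) \<and>
        (V \<longlongrightarrow> Vp) (at_right \<xi>) \<and> (C \<longlongrightarrow> Cp) (at_right \<xi>) \<and>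
        rankine_hugoniot ell gam Vm Cm Vp Cp \<and>
        (one_shock lam \<xi> Vm Cm Vp Cp \<or> two_shock lam \<xi> Vm Cm Vp Cp))"

section \<open>Self-similar solutions\<close>

text \<open>
  A profile on \<open>0 < \<xi> < X\<close>, where \<open>X = \<infinity>\<close> is allowed. The set \<open>E\<close> contains the exceptional
  points: admissible jumps, and points where \<open>(V, C)\<close> is merely continuous (for instance
  crossings of the sonic lines \<open>sim_D = 0\<close>). Exceptional points do not accumulate inside
  \<open>[0, X)\<close>, so that \<open>(V, C)\<close> is smooth near \<open>\<xi> = 0\<close>. Since \<open>x > 0\<close> and \<open>\<lambda> < 0\<close>, the
  requirement \<open>C \<ge> 0\<close> is the sign condition on the sound speed.
\<close>

definition similarity_profile ::
    "real \<Rightarrow> real \<Rightarrow> real \<Rightarrow> real \<Rightarrow> real \<Rightarrow> ereal \<Rightarrow> real set \<Rightarrow>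
     (real \<Rightarrow> real) \<Rightarrow> (real \<Rightarrow> real) \<Rightarrow> bool" where
  "similarity_profile lam ell gam u_plus c_plus X E V C \<longleftrightarrow>
     0 < X \<and>
     (\<forall>b>0. ereal b < X \<longrightarrow> finite (E \<inter> {0<..b})) \<and>
     (V \<longlongrightarrow> 0) (at_right 0) \<and> (C \<longlongrightarrow> 0) (at_right 0) \<and>
     ((\<lambda>\<xi>. \<xi> powr lam * V \<xi>) \<longlongrightarrow> - lam * u_plus) (at_right 0) \<and>
     ((\<lambda>\<xi>. \<xi> powr lam * C \<xi>) \<longlongrightarrow> - lam * c_plus) (at_right 0) \<and>
     (\<forall>\<xi>>0. ereal \<xi> < X \<longrightarrow>
        C \<xi> \<ge> 0 \<and>
        (\<xi> \<notin> E \<longrightarrow> solves_similarity_ode lam ell V C \<xi>) \<and>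
        (\<xi> \<in> E \<longrightarrow> (isCont V \<xi> \<and> isCont C \<xi>) \<or> admissible_jump lam ell gam V C \<xi>))"

definition sim_var :: "real \<Rightarrow> real \<Rightarrow> real \<Rightarrow> real" where
  "sim_var lam t x = t powr (- 1 / lam) * x"

definition sim_region :: "real \<Rightarrow> ereal \<Rightarrow> (real \<times> real) set" where
  "sim_region lam X = {(t, x). 0 < t \<and> 0 < x \<and> ereal (sim_var lam t x) < X}"

text \<open>Flows are functions of time and position, in this order.\<close>

definition self_similar_solution ::
    "real \<Rightarrow> real \<Rightarrow> real \<Rightarrow> real \<Rightarrow> real \<Rightarrow> ereal \<Rightarrow>
     (real \<Rightarrow> real \<Rightarrow> real) \<Rightarrow> (real \<Rightarrow> real \<Rightarrow> real) \<Rightarrow> bool" where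
  "self_similar_solution lam ell gam u_plus c_plus X u c \<longleftrightarrow>
     (\<exists>E V C. similarity_profile lam ell gam u_plus c_plus X E V C \<and>
        (\<forall>(t, x) \<in> sim_region lam X.
           u t x = - (1 / lam) * (x / t) * V (sim_var lam t x) \<and>
           c t x = - (1 / lam) * (x / t) * C (sim_var lam t x)))"

definition maximal_self_similar_solution ::
    "real \<Rightarrow> real \<Rightarrow> real \<Rightarrow> real \<Rightarrow> real \<Rightarrow> ereal \<Rightarrow>
     (real \<Rightarrow> real \<Rightarrow> real) \<Rightarrow> (real \<Rightarrow> real \<Rightarrow> real) \<Rightarrow> bool" where
  "maximal_self_similar_solution lam ell gam u_plus c_plus X u c \<longleftrightarrow>
     self_similar_solution lam ell gam u_plus c_plus X u c \<and>
     \<not> (\<exists>X' u' c'. X < X' \<and>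
          self_similar_solution lam ell gam u_plus c_plus X' u' c' \<and>
          (\<forall>(t, x) \<in> sim_region lam X. u' t x = u t x \<and> c' t x = c t x))"

section \<open>The isentropic Euler system\<close>

definition classical_euler_solution ::
    "real \<Rightarrow> (real \<times> real) set \<Rightarrow> (real \<Rightarrow> real \<Rightarrow> real) \<Rightarrow> (real \<Rightarrow> real \<Rightarrow> real) \<Rightarrow> bool" where
  "classical_euler_solution ell \<Omega> u c \<longleftrightarrow>
     (\<exists>u_t u_x c_t c_x.
        continuous_on \<Omega> (\<lambda>(t, x). u_t t x) \<and> continuous_on \<Omega> (\<lambda>(t, x). u_x t x) \<and>
        continuous_on \<Omega> (\<lambda>(t, x). c_t t x) \<and> continuous_on \<Omega> (\<lambda>(t, x). c_x t x) \<and>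
        (\<forall>(t, x) \<in> \<Omega>.
           ((\<lambda>s. u s x) has_real_derivative u_t t x) (at t) \<and>
           ((\<lambda>y. u t y) has_real_derivative u_x t x) (at x) \<and>
           ((\<lambda>s. c s x) has_real_derivative c_t t x) (at t) \<and>
           ((\<lambda>y. c t y) has_real_derivative c_x t x) (at x) \<and>
           u_t t x + u t x * u_x t x + ell * c t x * c_x t x = 0 \<and>
           c_t t x + u t x * c_x t x + inverse ell * c t x * u_x t x = 0))"

text \<open>
  The values \<open>u 0 x\<close>, \<open>c 0 x\<close> are the initial data. In the vacuum the velocity is left
  unspecified.
\<close>

definition attains_power_data ::
    "real \<Rightarrow> real \<Rightarrow> real \<Rightarrow> (real \<Rightarrow> real \<Rightarrow> real) \<Rightarrow> (real \<Rightarrow> real \<Rightarrow> real) \<Rightarrow> bool" where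
  "attains_power_data lam u_plus c_plus u c \<longleftrightarrow>
     (\<forall>x<0. c 0 x = 0) \<and>
     (\<forall>x>0. u 0 x = u_plus * x powr (1 - lam) \<and> c 0 x = c_plus * x powr (1 - lam) \<and>
        ((\<lambda>t. u t x) \<longlongrightarrow> u 0 x) (at_right 0) \<and> ((\<lambda>t. c t x) \<longlongrightarrow> c 0 x) (at_right 0))"

definition fluid_region :: "(real \<Rightarrow> real \<Rightarrow> real) \<Rightarrow> (real \<times> real) set" where
  "fluid_region c = {(t, x). 0 < t \<and> 0 < c t x}"

definition shock_free :: "(real \<Rightarrow> real \<Rightarrow> real) \<Rightarrow> (real \<Rightarrow> real \<Rightarrow> real) \<Rightarrow> bool" where
  "shock_free u c \<longleftrightarrow>
     continuous_on (fluid_region c) (\<lambda>(t, x). u t x) \<and>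
     continuous_on (fluid_region c) (\<lambda>(t, x). c t x)"

text \<open>
  A vacuum interface moves with the fluid, so a stationary one requires \<open>u t x \<longrightarrow> 0\<close> as \<open>x\<close> decreases to 0.
\<close>

definition stationary_vacuum_interface ::
    "(real \<Rightarrow> real \<Rightarrow> real) \<Rightarrow> (real \<Rightarrow> real \<Rightarrow> real) \<Rightarrow> bool" where
  "stationary_vacuum_interface u c \<longleftrightarrow>
     (\<forall>t\<ge>0. (\<forall>x\<le>0. c t x = 0) \<and> (\<forall>x>0. c t x > 0) \<and> (u t \<longlongrightarrow> 0) (at_right 0))"

end

theory Submission
  imports Defs
begin

text \<open>
  Put \<open>a = - \<lambda> > 0\<close>. Everything rests on the Riemann invariants \<open>V + \<ell> C\<close> and \<open>V - \<ell> C\<close>, written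
  \<open>R\<^sub>e = V + e \<ell> C\<close> with \<open>e = 1\<close> or \<open>e = - 1\<close>, and on the sonic gaps \<open>\<sigma>\<^sub>e = 1 + V + e C\<close>, whose
  product is \<open>D\<close>. In these variables the similarity equations are diagonal,
  \<open>\<xi> R\<^sub>e' = R\<^sub>e (a - V - e C) / \<sigma>\<^sub>e\<close>, which is the statement that \<open>u \<plusminus> \<ell> c\<close> is transported with speed
  \<open>u \<plusminus> c\<close>. The condition on the Mach number is the sign of \<open>R\<^sub>-\<close> near \<open>\<xi> = 0\<close>.

  Existence. Let \<open>z = \<xi>\<^sup>a\<close> and \<open>R\<^sub>+ = a z r(z)\<close>, \<open>R\<^sub>- = a z s(z)\<close>. Then \<open>r\<close> and \<open>s\<close> solve a system that is
  regular at \<open>z = 0\<close>, namely \<open>r' = - (1 + a) p r / (1 + a z p)\<close> with \<open>p\<close> the characteristic speed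
  belonging to \<open>r\<close>, and the same for \<open>s\<close>; the data are the values at \<open>z = 0\<close>. The Picard-Lindeloef
  theorem gives local solutions (\<open>local_flow_exists\<close>). If \<open>r(0) > s(0) \<ge> 0\<close>, both characteristic
  speeds are nonnegative because \<open>\<ell> > 1\<close>; hence the denominators are at least 1, both invariants are
  damped, and the solution is global (\<open>rarefying_flow_exists\<close>). Physically, both families of waves
  rarefy. Undoing the substitution yields the Euler flow (\<open>global_rarefaction\<close>).

  Breakdown. Suppose \<open>R\<^sub>- < 0\<close> near 0 and the profile is defined for all \<open>\<xi>\<close>. The square of \<open>\<sigma>\<^sub>e\<close> has a
  derivative with the sign of \<open>R\<^sub>e\<close> where \<open>\<sigma>\<^sub>e = 0\<close>, so a continuous solution crosses a sonic line only
  where the matching invariant vanishes or both gaps do. The latter happens at the vacuum point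
  \<open>(- 1, 0)\<close>, which no solution leaves; with \<open>C \<ge> 0\<close> the former leaves a single point, the node
  \<open>C = 1 / (\<ell> - 1)\<close>, \<open>V = - \<ell> / (\<ell> - 1)\<close> on the line \<open>\<sigma>\<^sub>+ = 0\<close> (\<open>continuous_cases\<close>). There are two
  possibilities.

  \<^item> \<open>\<sigma>\<^sub>- > 0\<close> throughout. Then there are no shocks and no sonic points, and \<open>- R\<^sub>-\<close> grows without
    bound although \<open>\<sigma>\<^sub>- > 0\<close> and a bound on \<open>R\<^sub>+\<close> confine it (\<open>no_global_supersonic_flow\<close>).
  \<^item> \<open>\<sigma>\<^sub>- < 0\<close> somewhere, and therefore from there on (\<open>subsonic_persists\<close>). Then \<open>R\<^sub>- < - 1\<close>, while on
    shock-free stretches \<open>\<xi> R\<^sub>-\<close> is nondecreasing, which would force \<open>R\<^sub>- \<rightarrow> 0\<close>; so shocks must keep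
    occurring. All of them take \<open>\<sigma>\<^sub>+\<close> from positive to negative values. Between two of them \<open>\<sigma>\<^sub>+\<close> has to
    return, which it can do only through the node. But mass conservation makes
    \<open>\<xi>\<^sup>\<ell>\<^sup>+\<^sup>1 |C|\<^sup>\<ell> (1 + V)\<close> nondecreasing across smooth flow and shocks alike, and this quantity is negative and
    strictly decreasing along repeated visits to the node, so the node is visited at most once
    (\<open>sonic_node_unique\<close>).

  A maximal solution on a bounded interval then exists by Zorn's lemma, starting from a local one.
\<close>

section \<open>One-sided monotonicity on the real line\<close>

text \<open>
  Continuous induction. It is used below for properties that hold only off an exceptional set, for
  which neither connectedness nor the intermediate value theorem applies directly.
\<close>

lemma real_induction:
  fixes a b :: real
  assumes start: "P a"
    and right: "\<And>x. a \<le> x \<Longrightarrow> x < b \<Longrightarrow> (\<And>y. a \<le> y \<Longrightarrow> y \<le> x \<Longrightarrow> P y) \<Longrightarrow> eventually P (at_right x)"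
    and left: "\<And>x. a < x \<Longrightarrow> x \<le> b \<Longrightarrow> (\<And>y. a \<le> y \<Longrightarrow> y < x \<Longrightarrow> P y) \<Longrightarrow> P x"
    and x: "a \<le> x" "x \<le> b"
  shows "P x"
proof (rule ccontr)
  assume nP: "\<not> P x"
  define S where "S = {y. a \<le> y \<and> y \<le> b \<and> \<not> P y}"
  define c where "c = Inf S"
  have xS: "x \<in> S" using nP x by (auto simp: S_def)
  have bdd: "bdd_below S" by (auto simp: S_def bdd_below_def)
  have ac: "a \<le> c" unfolding c_def by (rule cInf_greatest) (use xS in \<open>auto simp: S_def\<close>)
  have cx: "c \<le> x" unfolding c_def by (rule cInf_lower[OF xS bdd])
  have below: "P y" if "a \<le> y" "y < c" for y
  proof (rule ccontr)
    assume "\<not> P y"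
    then have "y \<in> S" using that cx x by (auto simp: S_def)
    then have "c \<le> y" unfolding c_def by (rule cInf_lower[OF _ bdd])
    then show False using that by simp
  qed
  have Pc: "P c"
  proof (cases "c = a")
    case True then show ?thesis using start by simp
  next
    case False
    then show ?thesis using left[of c] below ac cx x by simp
  qed
  then have "c < x" using cx nP by (cases "c = x") auto
  have "eventually P (at_right c)"
    by (rule right) (use ac \<open>c < x\<close> x below Pc in \<open>auto simp: le_less\<close>)
  then obtain d where d: "d > c" "\<And>y. c < y \<Longrightarrow> y < d \<Longrightarrow> P y"
    unfolding eventually_at_right_field by blast
  have "d \<le> y" if "y \<in> S" for y
  proof (rule ccontr)
    assume "\<not> d \<le> y"
    moreover have "c \<le> y" unfolding c_def by (rule cInf_lower[OF that bdd])
    ultimately have "P y" using d Pc by (cases "c = y") auto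
    then show False using that by (simp add: S_def)
  qed
  then have "d \<le> c" unfolding c_def using xS by (intro cInf_greatest) auto
  then show False using d by simp
qed

text \<open>
  Only one-sided information at interior points is needed. This allows minima of two differentiable
  functions, and functions that fail to be differentiable at isolated points.
\<close>

lemma right_monotone_imp_le:
  fixes f :: "real \<Rightarrow> real"
  assumes "a \<le> b" and cont: "continuous_on {a..b} f"
    and right: "\<And>x. a < x \<Longrightarrow> x < b \<Longrightarrow> eventually (\<lambda>y. f x \<le> f y) (at_right x)"
  shows "f a \<le> f b"
proof (cases "a = b")
  case False
  then have ab: "a < b" using assms by simp
  have from_inside: "f x \<le> f b" if x: "a < x" "x < b" for x
  proof (rule real_induction[where a = x and b = b and x = b])
    fix y assume y: "x \<le> y" "y < b" and *: "\<And>z. x \<le> z \<Longrightarrow> z \<le> y \<Longrightarrow> f x \<le> f z"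
    have "eventually (\<lambda>z. f y \<le> f z) (at_right y)" using right x y by simp
    then show "eventually (\<lambda>z. f x \<le> f z) (at_right y)"
      by eventually_elim (use *[of y] y in simp)
  next
    fix y assume y: "x < y" "y \<le> b" and *: "\<And>z. x \<le> z \<Longrightarrow> z < y \<Longrightarrow> f x \<le> f z"
    have "continuous_on {x..y} f" by (rule continuous_on_subset[OF cont]) (use x y in auto)
    then have "(f \<longlongrightarrow> f y) (at_left y)" using y
      by (auto simp: continuous_on_def at_within_Icc_at_left dest!: bspec[of _ _ y])
    moreover have "eventually (\<lambda>z. f x \<le> f z) (at_left y)"
      using eventually_at_left_real[OF y(1)] by eventually_elim (use * in auto)
    ultimately show "f x \<le> f y" by (intro tendsto_lowerbound[of f _ "at_left y"]) auto
  qed (use x in auto)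
  have "(f \<longlongrightarrow> f a) (at_right a)" using cont ab
    by (auto simp: continuous_on_def at_within_Icc_at_right dest!: bspec[of _ _ a])
  moreover have "eventually (\<lambda>x. f x \<le> f b) (at_right a)"
    using eventually_at_right_real[OF ab] by eventually_elim (use from_inside in auto)
  ultimately show ?thesis by (intro tendsto_upperbound[of f _ "at_right a"]) auto
qed simp

lemma continuous_on_le_of_deriv_nonneg:
  fixes f :: "real \<Rightarrow> real"
  assumes "a \<le> b" and cont: "continuous_on {a..b} f"
    and right: "\<And>x. a \<le> x \<Longrightarrow> x < b \<Longrightarrow>
       eventually (\<lambda>y. \<exists>D\<ge>0. (f has_real_derivative D) (at y)) (at_right x)"
  shows "f a \<le> f b"
proof (rule right_monotone_imp_le[OF assms(1,2)])
  fix x assume x: "a < x" "x < b"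
  obtain d where d: "d > x" "\<And>y. x < y \<Longrightarrow> y < d \<Longrightarrow> \<exists>D\<ge>0. (f has_real_derivative D) (at y)"
    using right[of x] x unfolding eventually_at_right_field by auto
  have "f x \<le> f y" if y: "x < y" "y < min d b" for y
  proof (rule DERIV_nonneg_imp_increasing_open[of x y f])
    show "continuous_on {x..y} f" by (rule continuous_on_subset[OF cont]) (use x y in auto)
    show "\<exists>D. (f has_real_derivative D) (at z) \<and> 0 \<le> D" if "x < z" "z < y" for z
      using d(2)[of z] that y by force
  qed (use y in auto)
  then show "eventually (\<lambda>y. f x \<le> f y) (at_right x)"
    unfolding eventually_at_right_field using x d by (intro exI[of _ "min d b"]) auto
qed

text \<open>
  By l'Hospital's rule for the difference quotient.
\<close>

lemma has_real_derivative_at_removable: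
  fixes f g :: "real \<Rightarrow> real"
  assumes cont: "isCont f x"
    and der: "eventually (\<lambda>y. (f has_real_derivative g y) (at y)) (at x)"
    and lim: "(g \<longlongrightarrow> l) (at x)"
  shows "(f has_real_derivative l) (at x)"
proof -
  have "((\<lambda>y. (f y - f x) / (y - x)) \<longlongrightarrow> l) (at x)"
  proof (rule lhopital[where f' = g and g' = "\<lambda>_. 1"])
    show "((\<lambda>y. f y - f x) \<longlongrightarrow> 0) (at x)" "((\<lambda>y. y - x) \<longlongrightarrow> 0) (at x)"
      using cont by (auto simp: isCont_def intro!: tendsto_eq_intros)
    show "eventually (\<lambda>y. ((\<lambda>y. f y - f x) has_real_derivative g y) (at y)) (at x)"
      using der by eventually_elim (auto intro!: derivative_eq_intros)
    show "eventually (\<lambda>y. y - x \<noteq> 0) (at x)"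
      by (auto simp: eventually_at_filter)
  qed (use lim in \<open>auto intro!: derivative_eq_intros always_eventually\<close>)
  then show ?thesis by (simp add: has_field_derivative_iff)
qed

text \<open>
  The exponent exceeds 1, so the derivative exists at the vacuum \<open>c = 0\<close> as well and vanishes there.
\<close>

lemma has_real_derivative_abs_powr:
  fixes c p :: real
  assumes "p > 1"
  shows "((\<lambda>x. \<bar>x\<bar> powr p) has_real_derivative (p * sgn c * \<bar>c\<bar> powr (p - 1))) (at c)"
proof -
  consider "c > 0" | "c < 0" | "c = 0" by linarith
  then show ?thesis
  proof cases
    case 1
    then have "((\<lambda>x. x powr p) has_real_derivative (p * sgn c * \<bar>c\<bar> powr (p - 1))) (at c)"
      by (auto intro!: derivative_eq_intros)
    then show ?thesis
      by (rule DERIV_cong_ev[THEN iffD1, rotated 3])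
        (use 1 in \<open>auto intro!: eventually_mono[OF eventually_nhds_in_open[of "{0<..}" c]]\<close>)
  next
    case 2
    then have "((\<lambda>x. (-x) powr p) has_real_derivative (p * sgn c * \<bar>c\<bar> powr (p - 1))) (at c)"
      by (auto intro!: derivative_eq_intros)
    then show ?thesis
      by (rule DERIV_cong_ev[THEN iffD1, rotated 3])
        (use 2 in \<open>auto intro!: eventually_mono[OF eventually_nhds_in_open[of "{..<0}" c]]\<close>)
  next
    case 3
    have "((\<lambda>x. \<bar>x\<bar> powr (p - 1)) \<longlongrightarrow> 0) (at (0::real))"
      using assms by (auto intro!: tendsto_eq_intros simp: always_eventually)
    then have "((\<lambda>x. \<bar>x\<bar> powr p / x) \<longlongrightarrow> 0) (at (0::real))"
    proof (rule Lim_null_comparison[rotated])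
      show "eventually (\<lambda>x::real. norm (\<bar>x\<bar> powr p / x) \<le> \<bar>x\<bar> powr (p - 1)) (at 0)"
        by (auto simp: eventually_at_filter powr_diff)
    qed
    then show ?thesis using 3 assms by (simp add: has_field_derivative_iff)
  qed
qed

lemma eventually_less_of_deriv_neg:
  fixes f :: "real \<Rightarrow> real"
  assumes "(f has_real_derivative l) (at x)" and "l < 0"
  shows "eventually (\<lambda>y. f y < f x) (at_right x)" and "eventually (\<lambda>y. f x < f y) (at_left x)"
proof -
  obtain d where d: "d > 0" "\<forall>h>0. h < d \<longrightarrow> f (x + h) < f x"
    using DERIV_neg_dec_right[OF assms] by blast
  have "f y < f x" if "x < y" "y < x + d" for y
    using d(2)[rule_format, of "y - x"] that by simp
  then show "eventually (\<lambda>y. f y < f x) (at_right x)"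
    unfolding eventually_at_right_field using d(1) by (intro exI[of _ "x + d"]) simp
  obtain d where d: "d > 0" "\<forall>h>0. h < d \<longrightarrow> f x < f (x - h)"
    using DERIV_neg_dec_left[OF assms] by blast
  have "f x < f y" if "x - d < y" "y < x" for y
    using d(2)[rule_format, of "x - y"] that by simp
  then show "eventually (\<lambda>y. f x < f y) (at_left x)"
    unfolding eventually_at_left_field using d(1) by (intro exI[of _ "x - d"]) simp
qed

section \<open>Riemann invariants and sonic lines\<close>

text \<open>
  The relative speed of the characteristic with sign \<open>e\<close> in the similarity variable; only \<open>e = 1\<close> and
  \<open>e = - 1\<close> matter. Treating both families by one formula exploits the symmetry \<open>C \<mapsto> - C\<close>.
\<close>

definition sonic_gap :: "real \<Rightarrow> real \<Rightarrow> real \<Rightarrow> real" where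
  "sonic_gap e V C = 1 + V + e * C"

definition riemann_inv :: "real \<Rightarrow> real \<Rightarrow> real \<Rightarrow> real \<Rightarrow> real" where
  "riemann_inv ell e V C = V + e * ell * C"

lemma sim_D_eq: "sim_D V C = sonic_gap 1 V C * sonic_gap (- 1) V C"
  by (simp add: sim_D_def sonic_gap_def power2_eq_square algebra_simps)

locale similarity_params =
  fixes lam ell :: real
  assumes lam_neg: "lam < 0" and ell_gt: "ell > 1"
begin

text \<open>
  The numerator in \<open>\<xi> R\<^sub>e' = R\<^sub>e (- \<lambda> - V - e C) / \<sigma>\<^sub>e\<close>, see \<open>deriv_riemann\<close>.
\<close>

definition riemann_rate :: "real \<Rightarrow> real \<Rightarrow> real \<Rightarrow> real" where
  "riemann_rate e V C = riemann_inv ell e V C * (- lam - V - e * C)"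

text \<open>
  The derivative of \<open>\<sigma>\<^sub>e\<^sup>2\<close> up to the positive factor \<open>1 / (\<ell> \<xi>)\<close>. Unlike the derivative of \<open>\<sigma>\<^sub>e\<close> itself it
  stays finite at \<open>\<sigma>\<^sub>e = 0\<close> as long as \<open>\<sigma>\<^sub>-\<^sub>e \<noteq> 0\<close>.
\<close>

definition gap_rate :: "real \<Rightarrow> real \<Rightarrow> real \<Rightarrow> real" where
  "gap_rate e V C = (ell + 1) * riemann_rate e V C
     + (ell - 1) * (sonic_gap e V C / sonic_gap (- e) V C) * riemann_rate (- e) V C"

abbreviation "ode \<equiv> solves_similarity_ode lam ell"

text \<open>
  The combination \<open>G + e \<ell> F\<close> contains the factor \<open>\<sigma>\<^sub>-\<^sub>e\<close> of \<open>D\<close>; this is what diagonalizes the equations.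
\<close>

lemma numerators_riemann:
  assumes "e = 1 \<or> e = - 1"
  shows "sim_G lam ell V C + e * ell * sim_F lam ell V C = riemann_rate e V C * sonic_gap (- e) V C"
proof -
  have "ell * sim_F lam ell V C =
     C * (ell * (C\<^sup>2 - (1 + V)\<^sup>2) + (1 - ell) * (lam - 1) * (1 + V) - (lam - 1))"
    using ell_gt by (simp add: sim_F_def Let_def field_simps)
  then have *: "e * ell * sim_F lam ell V C =
     e * (C * (ell * (C\<^sup>2 - (1 + V)\<^sup>2) + (1 - ell) * (lam - 1) * (1 + V) - (lam - 1)))"
    by simp
  show ?thesis
    unfolding * sim_G_def Let_def riemann_rate_def sonic_gap_def riemann_inv_def
    using assms by (auto simp: algebra_simps power2_eq_square)
qed

lemma ode_gap_nonzero:
  assumes "ode V C x" "e = 1 \<or> e = - 1"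
  shows "sonic_gap e (V x) (C x) \<noteq> 0"
  using assms by (auto simp: solves_similarity_ode_def sim_D_eq)

lemma ode_isCont:
  assumes "ode V C x"
  shows "isCont V x" "isCont C x"
  using assms by (auto simp: solves_similarity_ode_def intro: DERIV_isCont)

lemma isCont_gap:
  assumes "isCont V x" "isCont C x"
  shows "isCont (\<lambda>x. sonic_gap e (V x) (C x)) x"
  using assms unfolding sonic_gap_def by (intro continuous_intros)

lemma isCont_riemann:
  assumes "isCont V x" "isCont C x"
  shows "isCont (\<lambda>x. riemann_inv ell e (V x) (C x)) x"
  using assms unfolding riemann_inv_def by (intro continuous_intros)

lemma deriv_riemann:
  assumes o: "ode V C x" and e: "e = 1 \<or> e = - 1"
  shows "((\<lambda>x. riemann_inv ell e (V x) (C x)) has_real_derivative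
           riemann_rate e (V x) (C x) / sonic_gap e (V x) (C x) / x) (at x)"
proof -
  have nz: "sonic_gap e (V x) (C x) \<noteq> 0" "sonic_gap (- e) (V x) (C x) \<noteq> 0"
    using ode_gap_nonzero[OF o] e by auto
  have D: "sim_D (V x) (C x) = sonic_gap e (V x) (C x) * sonic_gap (- e) (V x) (C x)"
    using e by (auto simp: sim_D_eq)
  have "((\<lambda>x. riemann_inv ell e (V x) (C x)) has_real_derivative
     1 / x * (sim_G lam ell (V x) (C x) / sim_D (V x) (C x))
     + e * ell * (1 / x * (sim_F lam ell (V x) (C x) / sim_D (V x) (C x)))) (at x)"
    unfolding riemann_inv_def
    by (intro DERIV_add DERIV_cmult) (use o in \<open>auto simp: solves_similarity_ode_def\<close>)
  also have "1 / x * (sim_G lam ell (V x) (C x) / sim_D (V x) (C x))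
     + e * ell * (1 / x * (sim_F lam ell (V x) (C x) / sim_D (V x) (C x)))
     = (sim_G lam ell (V x) (C x) + e * ell * sim_F lam ell (V x) (C x)) / sim_D (V x) (C x) / x"
    by (simp add: add_divide_distrib mult_ac)
  also have "\<dots> = riemann_rate e (V x) (C x) / sonic_gap e (V x) (C x) / x"
    unfolding numerators_riemann[OF e] D using nz by simp
  finally show ?thesis .
qed

lemma gap_riemann:
  assumes "e = 1 \<or> e = - 1"
  shows "sonic_gap e V C = 1 + ((ell + 1) * riemann_inv ell e V C + (ell - 1) * riemann_inv ell (- e) V C) / (2 * ell)"
  using assms ell_gt by (auto simp: sonic_gap_def riemann_inv_def field_simps)

lemma deriv_gap:
  assumes o: "ode V C x" and e: "e = 1 \<or> e = - 1"
  shows "((\<lambda>x. sonic_gap e (V x) (C x)) has_real_derivative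
           gap_rate e (V x) (C x) / sonic_gap e (V x) (C x) / (2 * ell * x)) (at x)"
proof -
  have e': "- e = 1 \<or> - e = - 1" using e by auto
  have nz: "sonic_gap e (V x) (C x) \<noteq> 0" using ode_gap_nonzero[OF o] e by auto
  have "((\<lambda>x. sonic_gap e (V x) (C x)) has_real_derivative
     0 + ((ell + 1) * (riemann_rate e (V x) (C x) / sonic_gap e (V x) (C x) / x)
      + (ell - 1) * (riemann_rate (- e) (V x) (C x) / sonic_gap (- e) (V x) (C x) / x)) / (2 * ell)) (at x)"
    by (subst gap_riemann[OF e, abs_def])
      (intro DERIV_add DERIV_cdivide DERIV_cmult DERIV_const deriv_riemann o e e')
  also have "0 + ((ell + 1) * (riemann_rate e (V x) (C x) / sonic_gap e (V x) (C x) / x)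
      + (ell - 1) * (riemann_rate (- e) (V x) (C x) / sonic_gap (- e) (V x) (C x) / x)) / (2 * ell)
      = gap_rate e (V x) (C x) / sonic_gap e (V x) (C x) / (2 * ell * x)"
    unfolding gap_rate_def using nz by (simp add: add_divide_distrib distrib_right mult_ac)
  finally show ?thesis .
qed

lemma deriv_gap_square:
  assumes o: "ode V C x" and e: "e = 1 \<or> e = - 1"
  shows "((\<lambda>x. (sonic_gap e (V x) (C x))\<^sup>2) has_real_derivative
           gap_rate e (V x) (C x) / (ell * x)) (at x)"
proof -
  have nz: "sonic_gap e (V x) (C x) \<noteq> 0" using ode_gap_nonzero[OF o] e by auto
  show ?thesis
    unfolding power2_eq_square
    by (rule DERIV_cong[OF DERIV_mult[OF deriv_gap deriv_gap, OF o e o e]])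
      (use nz in simp)
qed

lemma isCont_riemann_rate:
  assumes "isCont V x" "isCont C x"
  shows "isCont (\<lambda>x. riemann_rate e (V x) (C x)) x"
  using assms unfolding riemann_rate_def riemann_inv_def by (intro continuous_intros)

lemma isCont_gap_rate:
  assumes "isCont V x" "isCont C x" "sonic_gap (- e) (V x) (C x) \<noteq> 0"
  shows "isCont (\<lambda>x. gap_rate e (V x) (C x)) x"
  unfolding gap_rate_def
  by (intro continuous_intros isCont_riemann_rate isCont_gap assms)

text \<open>
  Off the sonic lines the right-hand sides are continuous, so the derivatives have limits at the point,
  and these are the derivatives there.
\<close>

lemma ode_at_removable_point:
  assumes cont: "isCont V x" "isCont C x" and ev: "eventually (ode V C) (at x)"
    and D: "sim_D (V x) (C x) \<noteq> 0" and x: "x > 0"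
  shows "ode V C x"
proof -
  have [simp]: "isCont (\<lambda>x. sim_D (V x) (C x)) x" "isCont (\<lambda>x. sim_G lam ell (V x) (C x)) x"
    "isCont (\<lambda>x. sim_F lam ell (V x) (C x)) x"
    unfolding sim_D_def sim_G_def sim_F_def Let_def by (intro continuous_intros cont)+
  have "isCont (\<lambda>x. 1 / x * (sim_G lam ell (V x) (C x) / sim_D (V x) (C x))) x"
       "isCont (\<lambda>x. 1 / x * (sim_F lam ell (V x) (C x) / sim_D (V x) (C x))) x"
    using D x by (auto intro!: continuous_intros)
  note lims = this[unfolded isCont_def]
  show ?thesis unfolding solves_similarity_ode_def
  proof (intro conjI D)
    show "(V has_real_derivative 1 / x * (sim_G lam ell (V x) (C x) / sim_D (V x) (C x))) (at x)"
      by (rule has_real_derivative_at_removable[OF cont(1) _ lims(1)], rule eventually_mono[OF ev])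
        (simp add: solves_similarity_ode_def)
    show "(C has_real_derivative 1 / x * (sim_F lam ell (V x) (C x) / sim_D (V x) (C x))) (at x)"
      by (rule has_real_derivative_at_removable[OF cont(2) _ lims(2)], rule eventually_mono[OF ev])
        (simp add: solves_similarity_ode_def)
  qed
qed

text \<open>
  At \<open>\<sigma>\<^sub>e = 0\<close> the derivative of \<open>\<sigma>\<^sub>e\<^sup>2\<close> has the sign of \<open>R\<^sub>e\<close>. If \<open>R\<^sub>e < 0\<close>, the square would become negative
  just to the right of \<open>x\<close>, and if \<open>R\<^sub>e > 0\<close> just to the left: solutions end, respectively begin, at
  such a point but do not pass through it.
\<close>

lemma sonic_crossing_riemann_zero:
  assumes cont: "isCont V x" "isCont C x" and ev: "eventually (ode V C) (at x)"
    and x: "x > 0" and e: "e = 1 \<or> e = - 1"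
    and gap: "sonic_gap e (V x) (C x) = 0" and gap': "sonic_gap (- e) (V x) (C x) \<noteq> 0"
  shows "riemann_inv ell e (V x) (C x) = 0"
proof (rule ccontr)
  assume nz: "riemann_inv ell e (V x) (C x) \<noteq> 0"
  define R where "R = riemann_inv ell e (V x) (C x)"
  let ?s = "\<lambda>y. (sonic_gap e (V y) (C y))\<^sup>2"
  have gr: "gap_rate e (V x) (C x) = (ell + 1) * (1 - lam) * R"
  proof -
    have "- lam - V x - e * C x = 1 - lam" using gap by (simp add: sonic_gap_def)
    then have "riemann_rate e (V x) (C x) = R * (1 - lam)"
      unfolding riemann_rate_def R_def by (rule arg_cong)
    then show ?thesis using gap by (simp add: gap_rate_def)
  qed
  have lim: "((\<lambda>y. gap_rate e (V y) (C y)) \<longlongrightarrow> (ell + 1) * (1 - lam) * R) (at x)"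
    using isCont_gap_rate[OF cont gap'] gr by (simp add: isCont_def)
  have contS: "isCont ?s y" if "isCont V y" "isCont C y" for y
    using isCont_gap[OF that] by (intro continuous_intros)
  have pos: "(ell + 1) * (1 - lam) > 0" using ell_gt lam_neg by simp
  show False
  proof (cases "R > 0")
    case True
    then have "(ell + 1) * (1 - lam) * R > 0" using pos by simp
    then have "eventually (\<lambda>y. gap_rate e (V y) (C y) > 0) (at x)" by (rule order_tendstoD(1)[OF lim])
    then have "eventually (\<lambda>y. gap_rate e (V y) (C y) > 0 \<and> ode V C y) (at x)"
      using ev by eventually_elim auto
    then have "eventually (\<lambda>y. gap_rate e (V y) (C y) > 0 \<and> ode V C y) (at_left x)"
      by (simp add: eventually_at_split)
    then obtain b where b: "b < x" "\<And>y. b < y \<Longrightarrow> y < x \<Longrightarrow> gap_rate e (V y) (C y) > 0 \<and> ode V C y"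
      unfolding eventually_at_left_field by blast
    define y where "y = max ((b + x) / 2) (x / 2)"
    have y: "b < y" "0 < y" "y < x" using b x by (auto simp: y_def max_def field_simps)
    have "?s y \<le> ?s x"
    proof (rule DERIV_nonneg_imp_increasing_open[of y x])
      show "\<exists>D. (?s has_real_derivative D) (at z) \<and> 0 \<le> D" if "y < z" "z < x" for z
        using deriv_gap_square[of V C z e] e b(2)[of z] that y ell_gt
        by (intro exI[of _ "gap_rate e (V z) (C z) / (ell * z)"]) auto
      have "isCont ?s z" if "y \<le> z" "z \<le> x" for z
        using contS ode_isCont b(2)[of z] cont that y by (cases "z = x") auto
      then show "continuous_on {y..x} ?s" by (intro continuous_at_imp_continuous_on) auto
    qed (use y in auto)
    moreover have "?s y > 0" using ode_gap_nonzero[of V C y e] b(2)[of y] y e by simp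
    ultimately show False using gap by simp
  next
    case False
    then have "R < 0" using nz R_def by simp
    then have "(ell + 1) * (1 - lam) * R < 0" using pos by (simp add: mult_pos_neg)
    then have "eventually (\<lambda>y. gap_rate e (V y) (C y) < 0) (at x)" by (rule order_tendstoD(2)[OF lim])
    then have "eventually (\<lambda>y. gap_rate e (V y) (C y) < 0 \<and> ode V C y) (at x)"
      using ev by eventually_elim auto
    then have "eventually (\<lambda>y. gap_rate e (V y) (C y) < 0 \<and> ode V C y) (at_right x)"
      by (simp add: eventually_at_split)
    then obtain b where b: "b > x" "\<And>y. x < y \<Longrightarrow> y < b \<Longrightarrow> gap_rate e (V y) (C y) < 0 \<and> ode V C y"
      unfolding eventually_at_right_field by blast
    define y where "y = (b + x) / 2"
    have y: "x < y" "y < b" using b by (auto simp: y_def field_simps)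
    have "?s x \<ge> ?s y"
    proof (rule DERIV_nonpos_imp_decreasing_open[of x y])
      show "\<exists>D. (?s has_real_derivative D) (at z) \<and> D \<le> 0" if "x < z" "z < y" for z
        using deriv_gap_square[of V C z e] e b(2)[of z] that y x ell_gt
        by (intro exI[of _ "gap_rate e (V z) (C z) / (ell * z)"]) (auto simp: divide_nonpos_pos)
      have "isCont ?s z" if "x \<le> z" "z \<le> y" for z
        using contS ode_isCont b(2)[of z] cont that y by (cases "z = x") auto
      then show "continuous_on {x..y} ?s" by (intro continuous_at_imp_continuous_on) auto
    qed (use y in auto)
    moreover have "?s y > 0" using ode_gap_nonzero[of V C y e] b(2)[of y] y e by simp
    ultimately show False using gap by simp
  qed
qed

text \<open>
  Here both sonic gaps vanish. Near the point both invariants are close to \<open>- 1\<close>, and the square of the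
  gap of smaller modulus decreases to the right, because in \<open>gap_rate\<close> the quotient of the two gaps is
  then bounded by 1. The smaller square starts at 0, so it cannot decrease.
\<close>

lemma not_continuous_through_vacuum_point:
  assumes cont: "isCont V x" "isCont C x" and ev: "eventually (ode V C) (at x)"
    and pos: "eventually (\<lambda>y. C y \<ge> 0) (at x)"
    and x: "x > 0" and VC: "V x = - 1" "C x = 0"
  shows False
proof -
  define s where "s e y = (sonic_gap e (V y) (C y))\<^sup>2" for e y
  \<comment> \<open>An upper bound for \<open>gap_rate e\<close> where the gap with sign \<open>e\<close> is the smaller one; its limit is
    \<open>- 2 (1 - \<lambda>)\<close>.\<close>
  define N where "N e y = (ell + 1) * riemann_rate e (V y) (C y)
       + (ell - 1) * \<bar>riemann_rate (- e) (V y) (C y)\<bar>" for e y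
  have N: "eventually (\<lambda>y. N e y < 0) (at x)" for e
  proof -
    have rr: "riemann_rate e' (V x) (C x) = - (1 - lam)" for e'
      by (simp add: riemann_rate_def riemann_inv_def VC)
    have "isCont (N e) x" unfolding N_def
      by (intro continuous_intros isCont_riemann_rate cont)
    moreover have "N e x = - 2 * (1 - lam)" using lam_neg by (simp add: N_def rr algebra_simps)
    then have "N e x < 0" using lam_neg by simp
    ultimately show ?thesis unfolding isCont_def by (rule order_tendstoD)
  qed
  have "eventually (\<lambda>y. N 1 y < 0 \<and> N (- 1) y < 0 \<and> ode V C y \<and> C y \<ge> 0) (at x)"
    using N[of 1] N[of "- 1"] ev pos by eventually_elim auto
  then have "eventually (\<lambda>y. N 1 y < 0 \<and> N (- 1) y < 0 \<and> ode V C y \<and> C y \<ge> 0) (at_right x)"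
    by (simp add: eventually_at_split)
  then obtain b where b: "b > x"
    "\<And>y. x < y \<Longrightarrow> y < b \<Longrightarrow> N 1 y < 0 \<and> N (- 1) y < 0 \<and> ode V C y \<and> C y \<ge> 0"
    unfolding eventually_at_right_field by blast
  define z where "z = (b + x) / 2"
  have z: "x < z" "z < b" using b by (auto simp: z_def field_simps)
  have contS: "isCont (s e) y" if "x \<le> y" "y \<le> z" for e y
  proof -
    have "isCont V y" "isCont C y" using ode_isCont b(2)[of y] cont that z by (cases "y = x", auto)+
    from isCont_gap[OF this] show ?thesis unfolding s_def by (intro continuous_intros)
  qed
  have dec: "eventually (\<lambda>w. s e w < s e y) (at_right y)"
    if y: "x < y" "y < z" and e: "e = 1 \<or> e = - 1"
      and le: "\<bar>sonic_gap e (V y) (C y)\<bar> \<le> \<bar>sonic_gap (- e) (V y) (C y)\<bar>" for e y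
  proof -
    have o: "ode V C y" using b(2)[of y] y z by simp
    have nz: "sonic_gap (- e) (V y) (C y) \<noteq> 0" using ode_gap_nonzero[OF o, of "- e"] e by auto
    let ?q = "sonic_gap e (V y) (C y) / sonic_gap (- e) (V y) (C y)"
    have q: "\<bar>?q\<bar> \<le> 1" using le nz by simp
    have "?q * riemann_rate (- e) (V y) (C y) \<le> \<bar>?q\<bar> * \<bar>riemann_rate (- e) (V y) (C y)\<bar>"
      by (metis abs_ge_self abs_mult)
    also have "\<dots> \<le> 1 * \<bar>riemann_rate (- e) (V y) (C y)\<bar>" using q by (intro mult_right_mono) auto
    finally have "(ell - 1) * (?q * riemann_rate (- e) (V y) (C y)) \<le> (ell - 1) * \<bar>riemann_rate (- e) (V y) (C y)\<bar>"
      using ell_gt by (intro mult_left_mono) auto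
    then have "gap_rate e (V y) (C y) \<le> N e y" by (simp add: gap_rate_def N_def mult.assoc)
    also have "N e y < 0" using b(2)[of y] y z e by auto
    finally have "gap_rate e (V y) (C y) / (ell * y) < 0"
      using y x ell_gt by (intro divide_neg_pos) auto
    from eventually_less_of_deriv_neg(1)[OF deriv_gap_square[OF o e] this]
    show ?thesis unfolding s_def .
  qed
  define f where "f y = - min (s 1 y) (s (- 1) y)" for y
  have "f x \<le> f z"
  proof (rule right_monotone_imp_le[where f = f])
    have "continuous_on {x..z} (s e)" for e using contS by (intro continuous_at_imp_continuous_on) auto
    then show "continuous_on {x..z} f" unfolding f_def by (intro continuous_intros)
    fix y assume y: "x < y" "y < z"
    show "eventually (\<lambda>w. f y \<le> f w) (at_right y)"
    proof (cases "\<bar>sonic_gap 1 (V y) (C y)\<bar> \<le> \<bar>sonic_gap (- 1) (V y) (C y)\<bar>")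
      case True
      then have "s 1 y \<le> s (- 1) y" by (simp add: s_def abs_le_square_iff)
      have "eventually (\<lambda>w. s 1 w < s 1 y) (at_right y)" by (rule dec[OF y]) (use True in auto)
      then show ?thesis by eventually_elim (use \<open>s 1 y \<le> s (- 1) y\<close> in \<open>auto simp: f_def min_def\<close>)
    next
      case False
      then have "s (- 1) y \<le> s 1 y" by (simp add: s_def abs_le_square_iff[symmetric])
      have "eventually (\<lambda>w. s (- 1) w < s (- 1) y) (at_right y)" by (rule dec[OF y]) (use False in auto)
      then show ?thesis by eventually_elim (use \<open>s (- 1) y \<le> s 1 y\<close> in \<open>auto simp: f_def min_def\<close>)
    qed
  qed (use z in auto)
  moreover have "f x = 0" by (simp add: f_def s_def sonic_gap_def VC)
  moreover have "s e z > 0" if "e = 1 \<or> e = - 1" for e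
    using ode_gap_nonzero[of V C z e] b(2)[of z] z that by (simp add: s_def)
  then have "f z < 0" by (simp add: f_def)
  ultimately show False by simp
qed

end

section \<open>Flows that stay supersonic\<close>

context similarity_params
begin

text \<open>
  With \<open>\<sigma>\<^sub>- > 0\<close> and \<open>R\<^sub>- < 0\<close> the speed \<open>V - C\<close> stays strictly below \<open>a\<close>: at a level slightly below \<open>a\<close>
  the lower bound on \<open>- R\<^sub>-\<close> makes \<open>C\<close> so large that \<open>V + C > a\<close>, and both invariants then push \<open>V - C\<close> down.
  Consequently \<open>- R\<^sub>-\<close> grows at least like \<open>ln \<xi>\<close>. On the other hand \<open>R\<^sub>+\<close> stays bounded, since it can
  grow only while \<open>V + C < a\<close>, and \<open>\<sigma>\<^sub>- > 0\<close> bounds \<open>- R\<^sub>-\<close> in terms of \<open>R\<^sub>+\<close>.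
\<close>

lemma no_global_supersonic_flow:
  assumes o: "\<And>x. x > 0 \<Longrightarrow> ode V C x"
    and C: "\<And>x. x > 0 \<Longrightarrow> C x \<ge> 0"
    and sup: "\<And>x. x > 0 \<Longrightarrow> sonic_gap (- 1) (V x) (C x) > 0"
    and lim: "(V \<longlongrightarrow> 0) (at_right 0)" "(C \<longlongrightarrow> 0) (at_right 0)"
    and neg: "eventually (\<lambda>x. riemann_inv ell (- 1) (V x) (C x) < 0) (at_right 0)"
  shows False
proof -
  define a where "a = - lam"
  define P where "P x = riemann_inv ell 1 (V x) (C x)" for x
  define Q where "Q x = riemann_inv ell (- 1) (V x) (C x)" for x
  define h where "h x = V x - C x" for x
  have a: "a > 0" using lam_neg by (simp add: a_def)
  have "((\<lambda>x. V x - C x) \<longlongrightarrow> 0) (at_right 0)" using tendsto_diff[OF lim] by simp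
  then have "eventually (\<lambda>x. V x - C x < a / 2) (at_right 0)" using a by (intro order_tendstoD) auto
  then have "eventually (\<lambda>x. Q x < 0 \<and> h x < a / 2 \<and> x > 0) (at_right 0)"
    using neg eventually_at_right_less[of 0] unfolding Q_def h_def by eventually_elim auto
  then obtain x0 where x0: "Q x0 < 0" "h x0 < a / 2" "x0 > 0"
    using eventually_happens' trivial_limit_at_right_real by blast
  define q where "q = - Q x0"
  \<comment> \<open>\<open>- Q\<close> only grows, so \<open>2 * C \<ge> q / ell\<close> where \<open>P > 0\<close>; \<open>eps\<close> is less than this.\<close>
  define eps where "eps = min (a / 2) (q / (2 * ell))"
  \<comment> \<open>If \<open>P = M\<close>, then \<open>2 * C > 1 + a\<close>, whence \<open>V + C > a\<close> and \<open>P\<close> decreases.\<close>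
  define M where "M = max (P x0 + 1) (ell * (1 + a))"
  have q: "q > 0" using x0 by (simp add: q_def)
  have eps: "eps > 0" "eps \<le> a / 2" "eps \<le> q / (2 * ell)"
    using q a ell_gt by (auto simp: eps_def)
  have M: "M \<ge> ell * (1 + a)" "M > P x0" "M > 0"
    using a ell_gt by (auto simp: M_def intro: less_le_trans[of 0 "ell * (1 + a)"])
  have Ceq: "C x = (P x - Q x) / (2 * ell)" for x
    using ell_gt by (simp add: P_def Q_def riemann_inv_def)
  have gap_h: "sonic_gap (- 1) (V x) (C x) = 1 + h x" for x
    by (simp add: sonic_gap_def h_def)
  have gap1: "sonic_gap 1 (V x) (C x) > 0" if "x > 0" for x
    using sup[OF that] C[OF that] by (simp add: sonic_gap_def)
  have rateQ: "riemann_rate (- 1) (V x) (C x) = Q x * (a - h x)" for x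
    by (simp add: riemann_rate_def Q_def h_def a_def algebra_simps)
  have rateP: "riemann_rate 1 (V x) (C x) = P x * (a - h x - 2 * C x)" for x
    by (simp add: riemann_rate_def P_def h_def a_def algebra_simps)
  have dQ: "(Q has_real_derivative Q x * (a - h x) / (1 + h x) / x) (at x)" if "x > 0" for x
    using deriv_riemann[OF o[OF that], of "- 1"] unfolding rateQ gap_h Q_def by simp
  have dP: "(P has_real_derivative P x * (a - h x - 2 * C x) / sonic_gap 1 (V x) (C x) / x) (at x)"
    if "x > 0" for x
    using deriv_riemann[OF o[OF that], of 1] unfolding rateP P_def by simp
  have dh: "((\<lambda>x. 1 + h x) has_real_derivative
      gap_rate (- 1) (V x) (C x) / (1 + h x) / (2 * ell * x)) (at x)" if "x > 0" for x
    using deriv_gap[OF o[OF that], of "- 1"] unfolding gap_h by simp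
  have contQ: "isCont Q x" and contP: "isCont P x" and conth: "isCont h x" if "x > 0" for x
    using DERIV_isCont[OF dQ[OF that]] DERIV_isCont[OF dP[OF that]] ode_isCont[OF o[OF that]]
    unfolding h_def by (auto intro!: continuous_intros)
  have invariant: "Q x \<le> - q \<and> h x < a - eps \<and> P x < M" if "x \<ge> x0" for x
  proof (rule real_induction[where a = x0 and b = x and x = x])
    show "Q x0 \<le> - q \<and> h x0 < a - eps \<and> P x0 < M"
      using x0 eps M by (simp add: q_def)
  next
    fix y assume y: "x0 \<le> y" "y < x"
      and IH: "\<And>z. x0 \<le> z \<Longrightarrow> z \<le> y \<Longrightarrow> Q z \<le> - q \<and> h z < a - eps \<and> P z < M"
    have y0: "y > 0" using x0 y by simp
    have IHy: "Q y \<le> - q" "h y < a - eps" "P y < M" using IH y by auto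
    have "Q y * (a - h y) / (1 + h y) / y < 0"
      using IHy q eps sup[OF y0] y0 unfolding gap_h
      by (intro divide_neg_pos mult_neg_pos) auto
    then have "eventually (\<lambda>z. Q z < Q y) (at_right y)"
      by (rule eventually_less_of_deriv_neg(1)[OF dQ[OF y0]])
    moreover have "eventually (\<lambda>z. h z < a - eps) (at_right y)"
      using conth[OF y0] IHy(2) unfolding isCont_def
      by (intro order_tendstoD(2)[OF filterlim_mono[OF _ order_refl at_le]]) auto
    moreover have "eventually (\<lambda>z. P z < M) (at_right y)"
      using contP[OF y0] IHy(3) unfolding isCont_def
      by (intro order_tendstoD(2)[OF filterlim_mono[OF _ order_refl at_le]]) auto
    ultimately show "eventually (\<lambda>z. Q z \<le> - q \<and> h z < a - eps \<and> P z < M) (at_right y)"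
      by eventually_elim (use IHy in auto)
  next
    fix y assume y: "x0 < y" "y \<le> x"
      and IH: "\<And>z. x0 \<le> z \<Longrightarrow> z < y \<Longrightarrow> Q z \<le> - q \<and> h z < a - eps \<and> P z < M"
    have y0: "y > 0" using x0 y by simp
    have ev: "eventually (\<lambda>z. Q z \<le> - q \<and> h z < a - eps \<and> P z < M) (at_left y)"
      using eventually_at_left_real[OF y(1)] by eventually_elim (use IH in auto)
    have lims: "(Q \<longlongrightarrow> Q y) (at_left y)" "(h \<longlongrightarrow> h y) (at_left y)" "(P \<longlongrightarrow> P y) (at_left y)"
      using contQ[OF y0] contP[OF y0] conth[OF y0] unfolding isCont_def
      by (auto intro: filterlim_mono[OF _ order_refl at_le])
    have 1: "Q y \<le> - q"
      by (rule tendsto_upperbound[OF lims(1)]) (use ev in \<open>auto elim: eventually_mono\<close>)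
    have 2: "h y \<le> a - eps"
      by (rule tendsto_upperbound[OF lims(2)]) (use ev in \<open>auto elim: eventually_mono\<close>)
    have 3: "P y \<le> M"
      by (rule tendsto_upperbound[OF lims(3)]) (use ev in \<open>auto elim: eventually_mono\<close>)
    have h1: "1 + h y > 0" using sup[OF y0] by (simp add: gap_h)
    have "h y \<noteq> a - eps"
    proof
      assume eq: "h y = a - eps"
      have "V y > 0" using eq eps a C[OF y0] by (simp add: h_def)
      then have Pp: "P y > 0" using C[OF y0] ell_gt by (simp add: P_def riemann_inv_def add_pos_nonneg)
      then have "2 * C y > q / ell" using 1 ell_gt by (simp add: Ceq field_simps)
      moreover have "q / ell = 2 * (q / (2 * ell))" by simp
      ultimately have "2 * C y > eps" using eps by linarith
      then have "riemann_rate 1 (V y) (C y) < 0"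
        unfolding rateP using Pp eq by (intro mult_pos_neg) auto
      moreover have "riemann_rate (- 1) (V y) (C y) < 0"
        unfolding rateQ using 1 q eq eps by (intro mult_neg_pos) auto
      moreover have "sonic_gap (- 1) (V y) (C y) / sonic_gap 1 (V y) (C y) > 0"
        using sup gap1 y0 by simp
      ultimately have "gap_rate (- 1) (V y) (C y) < 0"
        unfolding gap_rate_def minus_minus
        by (intro add_neg_neg mult_pos_neg mult_pos_pos) (use ell_gt in auto)
      then have "gap_rate (- 1) (V y) (C y) / (1 + h y) / (2 * ell * y) < 0"
        using h1 y0 ell_gt by (intro divide_neg_pos) auto
      from eventually_less_of_deriv_neg(2)[OF dh[OF y0] this] ev
      have "eventually (\<lambda>z. False) (at_left y)" by eventually_elim (use eq in auto)
      then show False by simp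
    qed
    moreover have "P y \<noteq> M"
    proof
      assume eq: "P y = M"
      have "2 * C y = (M - Q y) / ell" using eq ell_gt by (simp add: Ceq field_simps)
      also have "\<dots> > ell * (1 + a) / ell" using M 1 q ell_gt by (intro divide_strict_right_mono) auto
      finally have "2 * C y > 1 + a" using ell_gt by simp
      then have "P y * (a - h y - 2 * C y) / sonic_gap 1 (V y) (C y) / y < 0"
        using h1 gap1[OF y0] y0 eq M by (intro divide_neg_pos mult_pos_neg) auto
      from eventually_less_of_deriv_neg(2)[OF dP[OF y0] this] ev
      have "eventually (\<lambda>z. False) (at_left y)" by eventually_elim (use eq in auto)
      then show False by simp
    qed
    ultimately show "Q y \<le> - q \<and> h y < a - eps \<and> P y < M" using 1 2 3 by simp
  qed (use that in auto)
  \<comment> \<open>A lower bound for the logarithmic growth rate \<open>(a - h) / (1 + h)\<close> of \<open>- Q\<close>.\<close>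
  define k where "k = (1 + a) / (1 + a - eps) - 1"
  have k: "k > 0" using eps a by (simp add: k_def field_simps)
  define B where "B = (2 * ell + (ell - 1) * M) / (ell + 1)"
  have bound: "- Q x < B" if "x \<ge> x0" for x
  proof -
    have "x > 0" using that x0 by simp
    have "(ell - 1) * P x \<le> (ell - 1) * M" using invariant[OF that] ell_gt by (intro mult_left_mono) auto
    moreover have "0 < 2 * ell * sonic_gap (- 1) (V x) (C x)"
      using sup[OF \<open>x > 0\<close>] ell_gt by simp
    then have "0 < 2 * ell + (ell + 1) * Q x + (ell - 1) * P x"
      by (simp add: sonic_gap_def riemann_inv_def P_def Q_def algebra_simps)
    ultimately have "- Q x * (ell + 1) < 2 * ell + (ell - 1) * M" by (simp add: algebra_simps)
    then show ?thesis using ell_gt by (simp add: B_def pos_less_divide_eq)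
  qed
  define g where "g x = - Q x - k * q * ln x" for x
  have growth: "g x0 \<le> g x" if "x \<ge> x0" for x
  proof (rule continuous_on_le_of_deriv_nonneg[where f = g, OF that])
    have "isCont g y" if "y > 0" for y
      unfolding g_def using that contQ[OF that] by (intro continuous_intros) auto
    then show "continuous_on {x0..x} g" using x0 by (intro continuous_at_imp_continuous_on) auto
    fix y assume y: "x0 \<le> y" "y < x"
    have "\<exists>D\<ge>0. (g has_real_derivative D) (at z)" if "z > y" for z
    proof -
      have z: "z > 0" "z \<ge> x0" using that y x0 by auto
      have h1: "1 + h z > 0" using sup[OF z(1)] by (simp add: gap_h)
      note I = invariant[OF z(2)]
      have "(1 + a) / (1 + h z) \<ge> (1 + a) / (1 + a - eps)"
        using I h1 a by (intro divide_left_mono) auto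
      then have kz: "k \<le> (a - h z) / (1 + h z)" using h1 by (simp add: k_def field_simps)
      have "k * q \<le> (a - h z) / (1 + h z) * (- Q z)"
        using kz I k q by (intro mult_mono) auto
      also have "\<dots> = - (Q z * (a - h z) / (1 + h z))" by simp
      finally have "0 \<le> (- (Q z * (a - h z) / (1 + h z)) - k * q) / z"
        using z by (intro divide_nonneg_pos) auto
      moreover have "(g has_real_derivative (- (Q z * (a - h z) / (1 + h z)) - k * q) / z) (at z)"
        unfolding g_def
        by (rule DERIV_cong[OF DERIV_diff[OF DERIV_minus[OF dQ[OF z(1)]] DERIV_cmult[OF DERIV_ln_divide[OF z(1)]]]])
          (simp add: diff_divide_distrib)
      ultimately show ?thesis by blast
    qed
    then show "eventually (\<lambda>z. \<exists>D\<ge>0. (g has_real_derivative D) (at z)) (at_right y)"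
      using eventually_at_right_less[of y] by (auto elim: eventually_mono)
  qed
  have B: "B > 0" using bound[of x0] q by (simp add: q_def)
  \<comment> \<open>A point at which the logarithmic lower bound for \<open>- Q\<close> has passed \<open>B\<close>.\<close>
  define X where "X = x0 * exp (B / (k * q))"
  have "1 \<le> exp (B / (k * q))" using B k q by simp
  then have X: "X \<ge> x0" using x0 by (simp add: X_def)
  have "ln X = ln x0 + B / (k * q)" using x0 by (simp add: X_def ln_mult)
  then have "k * q * ln X = k * q * ln x0 + B" using k q by (simp add: field_simps)
  then show False using growth[OF X] bound[OF X] q by (simp add: g_def q_def)
qed

end

section \<open>Shocks and the mass flux\<close>

text \<open>
  With \<open>|C|\<^sup>\<ell>\<close> proportional to the density, this is the flux of mass through a line of constant \<open>\<xi>\<close>, the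
  first quantity preserved by the jump conditions.
\<close>

definition mass_flux :: "real \<Rightarrow> real \<Rightarrow> real \<Rightarrow> real" where
  "mass_flux ell V C = \<bar>C\<bar> powr ell * (1 + V)"

context similarity_params
begin

text \<open>
  Conservation of mass in the similarity variable. The weight \<open>x\<^sup>\<ell>\<^sup>+\<^sup>1\<close> is the integrating factor after
  which the right-hand side is a positive multiple of the density.
\<close>

lemma deriv_mass_flux:
  assumes o: "ode V C x" and x: "x > 0"
  shows "((\<lambda>y. y powr (ell + 1) * mass_flux ell (V y) (C y)) has_real_derivative
          x powr ell * \<bar>C x\<bar> powr ell * (ell * (1 - lam) + 1)) (at x)"
proof -
  let ?D = "sim_D (V x) (C x)" and ?G = "sim_G lam ell (V x) (C x)" and ?F = "sim_F lam ell (V x) (C x)"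
  let ?n = "\<bar>C x\<bar> powr ell"
  have D: "?D \<noteq> 0" and dV: "(V has_real_derivative 1 / x * (?G / ?D)) (at x)"
    and dC: "(C has_real_derivative 1 / x * (?F / ?D)) (at x)"
    using o by (auto simp: solves_similarity_ode_def)
  define H where "H = ell * ((C x)\<^sup>2 - (1 + V x)\<^sup>2) + (1 - ell) * (lam - 1) * (1 + V x) - (lam - 1)"
  have F: "ell * ?F = C x * H"
    using ell_gt by (simp add: sim_F_def Let_def H_def field_simps)
  have "\<bar>C x\<bar> powr (ell - 1) * \<bar>C x\<bar> = ?n"
    using ell_gt by (cases "C x = 0") (simp_all add: powr_diff)
  then have n: "sgn (C x) * \<bar>C x\<bar> powr (ell - 1) * C x = ?n"
    by (metis abs_sgn mult.assoc mult.commute)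
  have "sgn (C x) * \<bar>C x\<bar> powr (ell - 1) * (ell * ?F) = ?n * H"
    unfolding F using n by (simp add: mult.assoc[symmetric])
  then have dn: "((\<lambda>y. \<bar>C y\<bar> powr ell) has_real_derivative ?n * H / ?D / x) (at x)"
    using DERIV_chain2[OF has_real_derivative_abs_powr[OF ell_gt] dC]
    by (simp add: mult_ac)
  have alg: "H * (1 + V x) + ?G = (- lam * ell - (ell + 1) * V x) * ?D"
    unfolding H_def sim_G_def sim_D_def Let_def by algebra
  have "((\<lambda>y. \<bar>C y\<bar> powr ell * (1 + V y)) has_real_derivative
      (?n * H / ?D / x) * (1 + V x) + (0 + 1 / x * (?G / ?D)) * ?n) (at x)"
    by (intro DERIV_mult dn DERIV_add DERIV_const dV)
  also have "(?n * H / ?D / x) * (1 + V x) + (0 + 1 / x * (?G / ?D)) * ?n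
      = ?n * (H * (1 + V x) + ?G) / ?D / x" by (simp add: add_divide_distrib ring_distribs mult_ac)
  also have "\<dots> = ?n * (- lam * ell - (ell + 1) * V x) / x" unfolding alg using D by simp
  finally have dm: "((\<lambda>y. mass_flux ell (V y) (C y)) has_real_derivative
      ?n * (- lam * ell - (ell + 1) * V x) / x) (at x)" by (simp add: mass_flux_def)
  have dp: "((\<lambda>y. y powr (ell + 1)) has_real_derivative (ell + 1) * x powr ell) (at x)"
    using x by (auto intro!: derivative_eq_intros)
  have px: "x powr (ell + 1) = x powr ell * x" using x by (simp add: powr_add)
  have q: "?n * (- lam * ell - (ell + 1) * V x) / x * x powr (ell + 1)
      = ?n * (- lam * ell - (ell + 1) * V x) * x powr ell"
    unfolding px using x by simp
  show ?thesis
    by (rule DERIV_cong[OF DERIV_mult[OF dp dm]])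
      (unfold q mass_flux_def, simp add: algebra_simps)
qed

end

lemma tendsto_mass_flux:
  assumes "ell > 0" "(V \<longlongrightarrow> v) F" "(C \<longlongrightarrow> c) F"
  shows "((\<lambda>y. mass_flux ell (V y) (C y)) \<longlongrightarrow> mass_flux ell v c) F"
proof -
  have "((\<lambda>y. \<bar>C y\<bar> powr ell) \<longlongrightarrow> \<bar>c\<bar> powr ell) F"
    by (rule tendsto_powr'[OF tendsto_rabs[OF assms(3)] tendsto_const]) (auto simp: assms(1))
  then show ?thesis unfolding mass_flux_def
    by (intro tendsto_mult tendsto_add tendsto_const assms)
qed

lemma tendsto_sonic_gap:
  assumes "(V \<longlongrightarrow> v) F" "(C \<longlongrightarrow> c) F"
  shows "((\<lambda>y. sonic_gap e (V y) (C y)) \<longlongrightarrow> sonic_gap e v c) F"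
  unfolding sonic_gap_def by (intro tendsto_intros assms)

text \<open>
  What remains of a similarity profile defined for all \<open>\<xi>\<close> once its locally finite exceptional set has
  been replaced by the requirement that the equations hold in punctured neighbourhoods.
\<close>

locale global_profile = similarity_params +
  fixes gam :: real and V C :: "real \<Rightarrow> real"
  assumes C_nonneg: "x > 0 \<Longrightarrow> C x \<ge> 0"
    and ode_near: "x > 0 \<Longrightarrow> eventually (ode V C) (at x)"
    and exceptional: "x > 0 \<Longrightarrow> \<not> ode V C x \<Longrightarrow>
       (isCont V x \<and> isCont C x) \<or> admissible_jump lam ell gam V C x"
begin

text \<open>
  The only point with \<open>C \<ge> 0\<close> at which a continuous solution can pass through a sonic line.
\<close>

definition "sonic_node x \<longleftrightarrow>
  isCont V x \<and> isCont C x \<and> V x = - ell / (ell - 1) \<and> C x = 1 / (ell - 1)"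

definition "gap e x = sonic_gap e (V x) (C x)"

lemma continuous_cases:
  assumes x: "x > 0" and cont: "isCont V x" "isCont C x"
  shows "ode V C x \<or> sonic_node x"
proof (cases "sim_D (V x) (C x) = 0")
  case False
  then show ?thesis using ode_at_removable_point[OF cont ode_near[OF x]] x by simp
next
  case True
  then have g0: "sonic_gap 1 (V x) (C x) = 0 \<or> sonic_gap (- 1) (V x) (C x) = 0"
    by (simp add: sim_D_eq)
  have "eventually (\<lambda>y. y > 0) (at x)"
    using eventually_nhds_in_open[of "{0<..}" x] x by (auto simp: eventually_at_filter elim: eventually_mono)
  then have pos: "eventually (\<lambda>y. C y \<ge> 0) (at x)" by eventually_elim (rule C_nonneg)
  have "C x \<noteq> 0"
    using not_continuous_through_vacuum_point[OF cont ode_near[OF x] pos x] g0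
    by (auto simp: sonic_gap_def)
  then have Cx: "C x > 0" using C_nonneg[OF x] by simp
  show ?thesis
  proof (cases "sonic_gap 1 (V x) (C x) = 0")
    case True
    have "riemann_inv ell 1 (V x) (C x) = 0"
      using sonic_crossing_riemann_zero[OF cont ode_near[OF x] x, of 1] True Cx
      by (simp add: sonic_gap_def)
    then have "V x = - ell * C x" "(ell - 1) * C x = 1"
      using True by (auto simp: riemann_inv_def sonic_gap_def algebra_simps)
    moreover from this have "C x = 1 / (ell - 1)" using ell_gt by (simp add: field_simps)
    ultimately show ?thesis using cont by (simp add: sonic_node_def)
  next
    case False
    then have g: "sonic_gap (- 1) (V x) (C x) = 0" using g0 by simp
    have "riemann_inv ell (- 1) (V x) (C x) = 0"
      using sonic_crossing_riemann_zero[OF cont ode_near[OF x] x, of "- 1"] g False by simp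
    then have "V x = ell * C x" by (simp add: riemann_inv_def)
    then have "1 + (ell - 1) * C x = 0" using g by (simp add: sonic_gap_def algebra_simps)
    moreover have "(ell - 1) * C x > 0" using Cx ell_gt by simp
    ultimately show ?thesis by simp
  qed
qed

text \<open>
  For \<open>\<lambda> < 0\<close> both shock conditions have the same form: a 1-shock (\<open>e = - 1\<close>) or a 2-shock (\<open>e = 1\<close>)
  takes the corresponding sonic gap from positive to negative values.
\<close>

lemma jump_cases:
  assumes x: "x > 0" and nc: "\<not> (isCont V x \<and> isCont C x)"
  obtains Vm Cm Vp Cp e where
    "(V \<longlongrightarrow> Vm) (at_left x)" "(C \<longlongrightarrow> Cm) (at_left x)"
    "(V \<longlongrightarrow> Vp) (at_right x)" "(C \<longlongrightarrow> Cp) (at_right x)"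
    "mass_flux ell Vm Cm = mass_flux ell Vp Cp" "Cp \<ge> 0"
    "e = 1 \<or> e = - 1" "sonic_gap e Vm Cm > 0" "sonic_gap e Vp Cp < 0"
proof -
  have no: "\<not> ode V C x" using nc ode_isCont by blast
  then have "admissible_jump lam ell gam V C x" using exceptional[OF x] nc by blast
  then obtain Vm Cm Vp Cp where lims: "(V \<longlongrightarrow> Vm) (at_left x)" "(C \<longlongrightarrow> Cm) (at_left x)"
    "(V \<longlongrightarrow> Vp) (at_right x)" "(C \<longlongrightarrow> Cp) (at_right x)"
    and rh: "rankine_hugoniot ell gam Vm Cm Vp Cp"
    and adm: "one_shock lam x Vm Cm Vp Cp \<or> two_shock lam x Vm Cm Vp Cp"
    unfolding admissible_jump_def by blast
  have neg: "x / lam < 0" using x lam_neg by (simp add: divide_pos_neg)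
  have flux: "mass_flux ell Vm Cm = mass_flux ell Vp Cp"
    using rh by (simp add: rankine_hugoniot_def mass_flux_def)
  have "eventually (\<lambda>y. C y \<ge> 0) (at_right x)"
    using eventually_at_right_less[of x] by eventually_elim (use x C_nonneg in auto)
  then have Cp: "Cp \<ge> 0" by (intro tendsto_lowerbound[OF lims(4)]) auto
  have scale: "x / lam * p > x / lam * q \<longleftrightarrow> p < q" for p q
    using neg mult_less_cancel_left_neg by blast
  have "\<exists>e. (e = 1 \<or> e = - 1) \<and> sonic_gap e Vm Cm > 0 \<and> sonic_gap e Vp Cp < 0"
    using adm
  proof
    assume "one_shock lam x Vm Cm Vp Cp"
    then have "x / lam * 1 < x / lam * (Cm - Vm)" "x / lam * (Cp - Vp) < x / lam * 1"
      by (simp_all add: one_shock_def)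
    then have "Cm - Vm < 1" "1 < Cp - Vp" unfolding scale by simp_all
    then show ?thesis by (intro exI[of _ "- 1"]) (auto simp: sonic_gap_def)
  next
    assume "two_shock lam x Vm Cm Vp Cp"
    then have "x / lam * 1 < x / lam * - (Cm + Vm)" "x / lam * - (Cp + Vp) < x / lam * 1"
      unfolding two_shock_def mult_minus_right mult_minus_left by simp_all
    then have "- (Cm + Vm) < 1" "1 < - (Cp + Vp)" unfolding scale by simp_all
    then show ?thesis by (intro exI[of _ 1]) (auto simp: sonic_gap_def)
  qed
  then show ?thesis using that[OF lims flux Cp] by blast
qed

lemma ode_dense_right:
  assumes "x > 0" "x < b" shows "\<exists>y. x < y \<and> y < b \<and> ode V C y"
proof -
  have "eventually (\<lambda>y. ode V C y \<and> y \<in> {x<..<b}) (at_right x)"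
    using ode_near[OF assms(1)] eventually_at_right_real[OF assms(2)]
    by (auto simp: eventually_at_split elim: eventually_elim2)
  then show ?thesis using eventually_happens' trivial_limit_at_right_real by fastforce
qed

lemma left_limit_gap_nonpos:
  assumes "0 < a" "a < x" and neg: "\<And>y. a \<le> y \<Longrightarrow> y < x \<Longrightarrow> ode V C y \<Longrightarrow> gap e y < 0"
    and "(V \<longlongrightarrow> v) (at_left x)" "(C \<longlongrightarrow> c) (at_left x)"
  shows "sonic_gap e v c \<le> 0"
proof -
  have "eventually (ode V C) (at_left x)"
    using ode_near[of x] assms by (simp add: eventually_at_split)
  then have "eventually (\<lambda>y. gap e y \<le> 0) (at_left x)"
    using eventually_at_left_real[OF assms(2)]
  proof eventually_elim
    case (elim y)
    then show ?case using neg[of y] by simp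
  qed
  then show ?thesis
    using tendsto_sonic_gap[OF assms(4,5), of e] unfolding gap_def
    by (intro tendsto_upperbound[where F = "at_left x"]) auto
qed

text \<open>
  A sonic gap cannot vanish where the equations hold, so its sign can change only at the exceptional
  points, which \<open>step\<close> controls.
\<close>

lemma gap_stays_negative:
  assumes a: "0 < a" "ode V C a" "gap e a < 0" and e: "e = 1 \<or> e = - 1"
    and step: "\<And>x. a < x \<Longrightarrow> x < b \<Longrightarrow> \<not> ode V C x \<Longrightarrow>
        (\<And>y. a \<le> y \<Longrightarrow> y < x \<Longrightarrow> ode V C y \<Longrightarrow> gap e y < 0) \<Longrightarrow>
        eventually (\<lambda>y. gap e y < 0) (at_right x)"
    and y: "a \<le> y" "y \<le> b" "ode V C y"
  shows "gap e y < 0"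
proof -
  have "ode V C y \<longrightarrow> gap e y < 0"
  proof (rule real_induction[where a = a and b = b and x = y])
    fix x assume x: "a \<le> x" "x < b" and IH: "\<And>y. a \<le> y \<Longrightarrow> y \<le> x \<Longrightarrow> ode V C y \<longrightarrow> gap e y < 0"
    have "eventually (\<lambda>y. gap e y < 0) (at_right x)"
    proof (cases "ode V C x")
      case True
      have "((\<lambda>y. gap e y) \<longlongrightarrow> gap e x) (at x)"
        using isCont_gap[OF ode_isCont[OF True], of e] by (simp add: isCont_def gap_def)
      then have "eventually (\<lambda>y. gap e y < 0) (at x)"
        using IH[of x] x True by (intro order_tendstoD(2)) auto
      then show ?thesis by (simp add: eventually_at_split)
    next
      case False
      then have "a < x" using x a by (cases "a = x") auto
      then show ?thesis using step[OF _ x(2) False] IH by simp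
    qed
    then show "eventually (\<lambda>y. ode V C y \<longrightarrow> gap e y < 0) (at_right x)"
      by eventually_elim simp
  next
    fix x assume x: "a < x" "x \<le> b" and IH: "\<And>y. a \<le> y \<Longrightarrow> y < x \<Longrightarrow> ode V C y \<longrightarrow> gap e y < 0"
    show "ode V C x \<longrightarrow> gap e x < 0"
    proof
      assume o: "ode V C x"
      have "(V \<longlongrightarrow> V x) (at_left x)" "(C \<longlongrightarrow> C x) (at_left x)"
        using ode_isCont[OF o] by (auto simp: isCont_def intro: filterlim_mono[OF _ order_refl at_le])
      then have "gap e x \<le> 0"
        using left_limit_gap_nonpos[OF a(1) x(1), of e] IH by (simp add: gap_def)
      moreover have "gap e x \<noteq> 0" using ode_gap_nonzero[OF o e] by (simp add: gap_def)
      ultimately show "gap e x < 0" by simp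
    qed
  qed (use a y in auto)
  then show ?thesis using y by simp
qed

lemma sonic_node_gap:
  assumes "sonic_node x"
  shows "eventually (\<lambda>y. gap (- 1) y < 0) (at x)"
proof -
  have "gap (- 1) x = - 2 / (ell - 1)"
    using assms ell_gt by (simp add: gap_def sonic_node_def sonic_gap_def field_simps)
  then have "gap (- 1) x < 0" using ell_gt by (simp add: divide_neg_pos)
  moreover have "((\<lambda>y. gap (- 1) y) \<longlongrightarrow> gap (- 1) x) (at x)"
    using isCont_gap[of x V C "- 1"] assms unfolding isCont_def gap_def sonic_node_def by blast
  ultimately show ?thesis by (intro order_tendstoD(2))
qed

text \<open>
  A 2-shock makes \<open>\<sigma>\<^sub>+\<close> negative on its right side, and \<open>\<sigma>\<^sub>- \<le> \<sigma>\<^sub>+\<close> because \<open>C \<ge> 0\<close>.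
\<close>

lemma subsonic_right_of_jump:
  assumes "(V \<longlongrightarrow> v) (at_right x)" "(C \<longlongrightarrow> c) (at_right x)" "c \<ge> 0"
    and "e = 1 \<or> e = - 1" "sonic_gap e v c < 0"
  shows "eventually (\<lambda>y. gap (- 1) y < 0) (at_right x)"
proof -
  have "sonic_gap (- 1) v c < 0" using assms by (auto simp: sonic_gap_def)
  then show ?thesis unfolding gap_def
    by (intro order_tendstoD(2)[OF tendsto_sonic_gap[OF assms(1,2)]])
qed

text \<open>
  Both the node and the right side of every shock lie in \<open>\<sigma>\<^sub>- < 0\<close>, so no exceptional point leads back.
\<close>

lemma subsonic_persists:
  assumes a: "0 < a" "ode V C a" "gap (- 1) a < 0" and y: "a \<le> y" "ode V C y"
  shows "gap (- 1) y < 0"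
proof (rule gap_stays_negative[where a = a and b = y])
  fix x assume x: "a < x" "x < y" "\<not> ode V C x"
  then have x0: "x > 0" using a by simp
  show "eventually (\<lambda>y. gap (- 1) y < 0) (at_right x)"
  proof (cases "isCont V x \<and> isCont C x")
    case True
    then show ?thesis
      using continuous_cases[OF x0] x sonic_node_gap[of x] by (auto simp: eventually_at_split)
  next
    case False
    from jump_cases[OF x0 False] show ?thesis
      by (metis subsonic_right_of_jump)
  qed
qed (use assms in auto)

text \<open>
  The node and every shock produce points with \<open>\<sigma>\<^sub>- < 0\<close> immediately to the right.
\<close>

lemma supersonic_no_exception:
  assumes sup: "\<And>y. y > 0 \<Longrightarrow> ode V C y \<Longrightarrow> gap (- 1) y > 0" and x: "x > 0"
  shows "ode V C x"
proof (rule ccontr)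
  assume no: "\<not> ode V C x"
  have "eventually (\<lambda>y. gap (- 1) y < 0) (at_right x)"
  proof (cases "isCont V x \<and> isCont C x")
    case True
    then show ?thesis
      using continuous_cases[OF x] no sonic_node_gap[of x] by (auto simp: eventually_at_split)
  next
    case False
    from jump_cases[OF x False] show ?thesis
      by (metis subsonic_right_of_jump)
  qed
  moreover have "eventually (ode V C) (at_right x)"
    using ode_near[OF x] by (simp add: eventually_at_split)
  ultimately have "eventually (\<lambda>y. False) (at_right x)"
    using eventually_at_right_less[of x]
  proof eventually_elim
    case (elim y)
    then show ?case using sup[of y] x by simp
  qed
  then show False by simp
qed

text \<open>
  A 1-shock requires \<open>\<sigma>\<^sub>- > 0\<close> on its left side, so only 2-shocks remain.
\<close>

lemma jump_in_subsonic_flow: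
  assumes a: "0 < a" "ode V C a" "gap (- 1) a < 0" and x: "a < x"
    and nc: "\<not> (isCont V x \<and> isCont C x)"
  shows "eventually (\<lambda>y. gap 1 y > 0) (at_left x)" and "eventually (\<lambda>y. gap 1 y < 0) (at_right x)"
proof -
  have x0: "x > 0" using a x by simp
  obtain Vm Cm Vp Cp e where j: "(V \<longlongrightarrow> Vm) (at_left x)" "(C \<longlongrightarrow> Cm) (at_left x)"
    "(V \<longlongrightarrow> Vp) (at_right x)" "(C \<longlongrightarrow> Cp) (at_right x)"
    "e = 1 \<or> e = - 1" "sonic_gap e Vm Cm > 0" "sonic_gap e Vp Cp < 0"
    using jump_cases[OF x0 nc] by metis
  have "sonic_gap (- 1) Vm Cm \<le> 0"
    using left_limit_gap_nonpos[OF a(1) x _ j(1,2)] subsonic_persists[OF a] by blast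
  then have "e = 1" using j by auto
  then show "eventually (\<lambda>y. gap 1 y > 0) (at_left x)" "eventually (\<lambda>y. gap 1 y < 0) (at_right x)"
    unfolding gap_def using j
    by (auto intro: order_tendstoD(1)[OF tendsto_sonic_gap[OF j(1,2)]]
        order_tendstoD(2)[OF tendsto_sonic_gap[OF j(3,4)]])
qed

text \<open>
  In subsonic flow \<open>R\<^sub>- < - 1\<close>, since \<open>1 + V < C \<le> \<ell> C\<close>. Without a shock \<open>x R\<^sub>-\<close> would be nondecreasing,
  that is \<open>|R\<^sub>-|\<close> would decay like \<open>1 / x\<close>.
\<close>

lemma subsonic_flow_has_late_jump:
  assumes a: "0 < a" "ode V C a" "gap (- 1) a < 0"
  shows "\<exists>x>a. \<not> (isCont V x \<and> isCont C x)"
proof (rule ccontr)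
  assume "\<not> ?thesis"
  then have cont: "isCont V x" "isCont C x" if "x \<ge> a" for x
    using that ode_isCont[OF a(2)] by (cases "x = a"; auto)+
  define Q where "Q x = riemann_inv ell (- 1) (V x) (C x)" for x
  have Q: "Q x < - 1" if "x \<ge> a" "ode V C x" for x
  proof -
    have "1 + V x < C x" using subsonic_persists[OF a that] by (simp add: gap_def sonic_gap_def)
    moreover have "C x \<le> ell * C x" using C_nonneg[of x] that a ell_gt by (simp add: mult_le_cancel_right1)
    ultimately show ?thesis by (simp add: Q_def riemann_inv_def)
  qed
  have mono: "a * Q a \<le> x * Q x" if "x \<ge> a" for x
  proof (rule continuous_on_le_of_deriv_nonneg[where f = "\<lambda>x. x * Q x", OF that])
    have "isCont (\<lambda>x. x * Q x) y" if "y \<ge> a" for y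
      unfolding Q_def by (intro continuous_intros isCont_riemann cont that)
    then show "continuous_on {a..x} (\<lambda>x. x * Q x)" by (intro continuous_at_imp_continuous_on) auto
    fix y assume y: "a \<le> y" "y < x"
    have "eventually (ode V C) (at_right y)"
      using ode_near[of y] y a by (simp add: eventually_at_split)
    then show "eventually (\<lambda>z. \<exists>D\<ge>0. ((\<lambda>x. x * Q x) has_real_derivative D) (at z)) (at_right y)"
      using eventually_at_right_less[of y]
    proof eventually_elim
      case (elim z)
      then have z: "z \<ge> a" "z > 0" "ode V C z" using y a by auto
      have g: "gap (- 1) z < 0" by (rule subsonic_persists[OF a z(1,3)])
      have "riemann_rate (- 1) (V z) (C z) = Q z * (1 - lam - gap (- 1) z)"
        by (simp add: riemann_rate_def Q_def gap_def sonic_gap_def algebra_simps)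
      then have dQ: "(Q has_real_derivative Q z * (1 - lam - gap (- 1) z) / gap (- 1) z / z) (at z)"
        using deriv_riemann[OF z(3), of "- 1"] by (simp add: Q_def[abs_def] gap_def)
      have "((\<lambda>x. x * Q x) has_real_derivative Q z * (1 - lam) / gap (- 1) z) (at z)"
      proof (rule DERIV_cong[OF DERIV_mult[OF DERIV_ident dQ]])
        have "Q z * (1 - lam - r) / r / z * z = Q z * (1 - lam) / r - Q z" if "r < 0" for r
          using z that by (simp add: right_diff_distrib left_diff_distrib diff_divide_distrib)
        from this[OF g] show "1 * Q z + Q z * (1 - lam - gap (- 1) z) / gap (- 1) z / z * z
            = Q z * (1 - lam) / gap (- 1) z" by simp
      qed
      moreover have "Q z * (1 - lam) / gap (- 1) z \<ge> 0"
        using Q[OF z(1,3)] g lam_neg by (intro divide_nonpos_neg mult_nonpos_nonneg) auto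
      ultimately show ?case by blast
    qed
  qed
  \<comment> \<open>Beyond \<open>K\<close> the bound \<open>Q y < - 1\<close> contradicts \<open>a * Q a \<le> y * Q y\<close>.\<close>
  define K where "K = max a (- (a * Q a))"
  have "K > 0" using a by (simp add: K_def)
  then obtain y where y: "y > K" "ode V C y" using ode_dense_right[of K "K + 1"] by auto
  then have "a \<le> y" "y > 0" using a by (auto simp: K_def)
  then have "y * Q y < - y" using Q[of y] y mult_strict_left_mono[of "Q y" "- 1" y] by simp
  then show False using mono[OF \<open>a \<le> y\<close>] y by (simp add: K_def)
qed

text \<open>
  On the way back to \<open>\<sigma>\<^sub>+ > 0\<close> a shock is of no help, because it makes \<open>\<sigma>\<^sub>+\<close> negative.
\<close>

lemma sonic_node_between:
  assumes a: "0 < a" "ode V C a" "gap (- 1) a < 0" "gap 1 a < 0"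
    and b: "a < b" "ode V C b" "gap 1 b > 0"
  shows "\<exists>x. a < x \<and> x < b \<and> sonic_node x"
proof (rule ccontr)
  assume n: "\<not> ?thesis"
  have "gap 1 b < 0"
  proof (rule gap_stays_negative[where a = a and b = b])
    fix x assume x: "a < x" "x < b" "\<not> ode V C x"
    then have "\<not> (isCont V x \<and> isCont C x)" using continuous_cases[of x] n a by auto
    from jump_in_subsonic_flow(2)[OF a(1-3) x(1) this]
    show "eventually (\<lambda>y. gap 1 y < 0) (at_right x)" .
  qed (use a b in auto)
  then show False using b by simp
qed

lemma subsonic_flow_has_late_node:
  assumes a: "0 < a" "ode V C a" "gap (- 1) a < 0"
  shows "\<exists>x>a. sonic_node x"
proof -
  obtain x1 where x1: "x1 > a" "\<not> (isCont V x1 \<and> isCont C x1)"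
    using subsonic_flow_has_late_jump[OF a] by blast
  have "eventually (\<lambda>y. gap 1 y < 0 \<and> ode V C y \<and> y > x1) (at_right x1)"
    using jump_in_subsonic_flow(2)[OF a x1] ode_near[of x1] x1 a eventually_at_right_less[of x1]
    by (auto simp: eventually_at_split intro: eventually_conj)
  then obtain y1 where y1: "gap 1 y1 < 0" "ode V C y1" "y1 > x1"
    using eventually_happens' trivial_limit_at_right_real by blast
  have a1: "0 < y1" "gap (- 1) y1 < 0" using y1 x1 a subsonic_persists[OF a, of y1] by auto
  obtain x2 where x2: "x2 > y1" "\<not> (isCont V x2 \<and> isCont C x2)"
    using subsonic_flow_has_late_jump[of y1] a1 y1 by blast
  have "eventually (\<lambda>y. gap 1 y > 0 \<and> ode V C y \<and> y \<in> {y1<..<x2}) (at_left x2)"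
    using jump_in_subsonic_flow(1)[OF a1(1) y1(2) a1(2) x2] ode_near[of x2] x2 a1 eventually_at_left_real[OF x2(1)]
    by (auto simp: eventually_at_split intro: eventually_conj)
  then obtain y2 where "gap 1 y2 > 0" "ode V C y2" "y1 < y2"
    using eventually_happens'[OF trivial_limit_at_left_real] by fastforce
  from sonic_node_between[OF a1(1) y1(2) a1(2) y1(1) this(3,2,1)] show ?thesis
    using y1 x1 by (meson less_trans)
qed

text \<open>
  In smooth flow this is \<open>deriv_mass_flux\<close>; across a shock the mass flux has equal limits from both
  sides, so the value at the shock itself, which is arbitrary, is skipped.
\<close>

lemma mass_flux_mono:
  assumes a: "0 < a" "a \<le> b" and ca: "isCont V a" "isCont C a" and cb: "isCont V b" "isCont C b"
  shows "a powr (ell + 1) * mass_flux ell (V a) (C a) \<le> b powr (ell + 1) * mass_flux ell (V b) (C b)"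
proof -
  define f where "f x = x powr (ell + 1) * mass_flux ell (V x) (C x)" for x
  have lim: "(f \<longlongrightarrow> x powr (ell + 1) * mass_flux ell v c) F"
    if "x > 0" "F \<le> at x" "(V \<longlongrightarrow> v) F" "(C \<longlongrightarrow> c) F" for x v c F
  proof -
    have "((\<lambda>y. y powr (ell + 1)) \<longlongrightarrow> x powr (ell + 1)) (at x)" using that by (intro tendsto_intros) auto
    then have "((\<lambda>y. y powr (ell + 1)) \<longlongrightarrow> x powr (ell + 1)) F" using that(2) tendsto_mono by blast
    then show ?thesis unfolding f_def
      by (intro tendsto_mult tendsto_mass_flux that) (use ell_gt in auto)
  qed
  have lim_cont: "(f \<longlongrightarrow> f x) F" if "x > 0" "F \<le> at x" "isCont V x" "isCont C x" for x F
    using lim[OF that(1,2), of "V x" "C x"] that tendsto_mono[OF that(2)] unfolding f_def isCont_def by blast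
  have deriv: "\<exists>D\<ge>0. (f has_real_derivative D) (at x)" if "ode V C x" "x > 0" for x
    using deriv_mass_flux[OF that] ell_gt lam_neg unfolding f_def
    by (intro exI[of _ "x powr ell * \<bar>C x\<bar> powr ell * (ell * (1 - lam) + 1)"]) auto
  have "isCont V b \<and> isCont C b \<longrightarrow> f a \<le> f b"
  proof (rule real_induction[where a = a and b = b and x = b])
    fix x assume x: "a \<le> x" "x < b"
      and IH: "\<And>y. a \<le> y \<Longrightarrow> y \<le> x \<Longrightarrow> isCont V y \<and> isCont C y \<longrightarrow> f a \<le> f y"
    have x0: "x > 0" using a x by simp
    \<comment> \<open>The right limit is compared with \<open>f a\<close> instead of the value at \<open>x\<close>, which a jump leaves free.\<close>
    have "\<exists>l. (f \<longlongrightarrow> l) (at_right x) \<and> f a \<le> l"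
    proof (cases "isCont V x \<and> isCont C x")
      case True
      then show ?thesis using lim_cont[OF x0 at_le] IH[of x] x by blast
    next
      case False
      then have ax: "a < x" using x ca by (cases "a = x") auto
      obtain Vm Cm Vp Cp where j: "(V \<longlongrightarrow> Vm) (at_left x)" "(C \<longlongrightarrow> Cm) (at_left x)"
        "(V \<longlongrightarrow> Vp) (at_right x)" "(C \<longlongrightarrow> Cp) (at_right x)"
        "mass_flux ell Vm Cm = mass_flux ell Vp Cp"
        using jump_cases[OF x0 False] by metis
      have "eventually (ode V C) (at_left x)" using ode_near[OF x0] by (simp add: eventually_at_split)
      then have "eventually (\<lambda>y. f a \<le> f y) (at_left x)"
        using eventually_at_left_real[OF ax]
        by eventually_elim (use IH ode_isCont in force)
      then have "f a \<le> x powr (ell + 1) * mass_flux ell Vm Cm"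
        by (intro tendsto_lowerbound[OF lim[OF x0 at_le j(1,2)]]) auto
      then show ?thesis using lim[OF x0 at_le j(3,4)] j(5) by auto
    qed
    then obtain l where l: "(f \<longlongrightarrow> l) (at_right x)" "f a \<le> l" by blast
    have "eventually (ode V C) (at_right x)" using ode_near[OF x0] by (simp add: eventually_at_split)
    then obtain d where d: "d > x" "\<And>y. x < y \<Longrightarrow> y < d \<Longrightarrow> ode V C y"
      unfolding eventually_at_right_field by blast
    have "l \<le> f y" if y: "x < y" "y < d" for y
    proof (rule tendsto_upperbound[OF l(1)])
      have "f z \<le> f y" if z: "x < z" "z < y" for z
      proof (rule DERIV_nonneg_imp_nondecreasing[of z y f])
        show "\<exists>D. (f has_real_derivative D) (at w) \<and> D \<ge> 0" if "z \<le> w" "w \<le> y" for w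
          using deriv[of w] d(2)[of w] that y z x0 by auto
      qed (use z in auto)
      then show "eventually (\<lambda>z. f z \<le> f y) (at_right x)"
        using y by (auto simp: eventually_at_right_field)
    qed auto
    then show "eventually (\<lambda>y. isCont V y \<and> isCont C y \<longrightarrow> f a \<le> f y) (at_right x)"
      using d(1) l(2) unfolding eventually_at_right_field by (intro exI[of _ d]) force
  next
    fix x assume x: "a < x" "x \<le> b"
      and IH: "\<And>y. a \<le> y \<Longrightarrow> y < x \<Longrightarrow> isCont V y \<and> isCont C y \<longrightarrow> f a \<le> f y"
    have x0: "x > 0" using a x by simp
    show "isCont V x \<and> isCont C x \<longrightarrow> f a \<le> f x"
    proof
      assume c: "isCont V x \<and> isCont C x"
      have "eventually (ode V C) (at_left x)" using ode_near[OF x0] by (simp add: eventually_at_split)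
      then have "eventually (\<lambda>y. f a \<le> f y) (at_left x)"
        using eventually_at_left_real[OF x(1)]
        by eventually_elim (use IH ode_isCont in force)
      then show "f a \<le> f x" using c by (intro tendsto_lowerbound[OF lim_cont[OF x0 at_le]]) auto
    qed
  qed (use a in auto)
  then show ?thesis using cb by (simp add: f_def)
qed

text \<open>
  At the node \<open>1 + V < 0\<close>, so the weighted mass flux there is a negative multiple of \<open>x\<^sup>\<ell>\<^sup>+\<^sup>1\<close> and would
  decrease from one visit to the next.
\<close>

lemma sonic_node_unique:
  assumes "0 < x" "x < y" "sonic_node x" "sonic_node y"
  shows False
proof -
  define m where "m = mass_flux ell (- ell / (ell - 1)) (1 / (ell - 1))"
  have "1 + - ell / (ell - 1) < 0" using ell_gt by (simp add: field_simps)
  then have m: "m < 0" unfolding m_def mass_flux_def using ell_gt by (intro mult_pos_neg) auto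
  have "x powr (ell + 1) * m \<le> y powr (ell + 1) * m"
    using mass_flux_mono[of x y] assms by (simp add: sonic_node_def m_def)
  then have "y powr (ell + 1) \<le> x powr (ell + 1)" using m by simp
  moreover have "x powr (ell + 1) < y powr (ell + 1)"
    using assms ell_gt by (intro powr_less_mono2) auto
  ultimately show False by simp
qed

lemma incoming_wave_excludes_global_profile:
  assumes lim: "(V \<longlongrightarrow> 0) (at_right 0)" "(C \<longlongrightarrow> 0) (at_right 0)"
    and neg: "eventually (\<lambda>x. riemann_inv ell (- 1) (V x) (C x) < 0) (at_right 0)"
  shows False
proof (cases "\<exists>a>0. ode V C a \<and> gap (- 1) a < 0")
  case True
  then obtain a where a: "0 < a" "ode V C a" "gap (- 1) a < 0" by blast
  obtain x where x: "x > a" "sonic_node x" using subsonic_flow_has_late_node[OF a] by blast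
  obtain b where b: "b > x" "ode V C b" using ode_dense_right[of x "x + 1"] x a by auto
  obtain y where y: "y > b" "sonic_node y"
    using subsonic_flow_has_late_node[of b] subsonic_persists[OF a, of b] a b x by auto
  show False using sonic_node_unique[of x y] a x b y by simp
next
  case False
  then have sup: "gap (- 1) y > 0" if "y > 0" "ode V C y" for y
    using ode_gap_nonzero[OF that(2), of "- 1"] that by (force simp: gap_def)
  note o = supersonic_no_exception[OF sup]
  show False
    using no_global_supersonic_flow[OF o C_nonneg _ lim neg] sup[OF _ o] by (simp add: gap_def)
qed

end

context similarity_params
begin

text \<open>
  The data give \<open>\<xi>\<^sup>\<lambda> R\<^sub>- \<rightarrow> - \<lambda> (u\<^sub>+ - \<ell> c\<^sub>+) < 0\<close>, which is the sign condition of
  \<open>incoming_wave_excludes_global_profile\<close>.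
\<close>

lemma no_global_self_similar_solution:
  assumes Ma: "u_plus < ell * c_plus"
    and sol: "similarity_profile lam ell gam u_plus c_plus \<infinity> E V C"
  shows False
proof -
  note S = sol[unfolded similarity_profile_def, simplified]
  interpret global_profile lam ell gam V C
  proof
    fix x :: real assume x: "x > 0"
    show "C x \<ge> 0" using S x by blast
    show "isCont V x \<and> isCont C x \<or> admissible_jump lam ell gam V C x" if "\<not> ode V C x"
      using S x that by blast
    have fin: "finite (E \<inter> {0<..x + 1} - {x})" using S x by auto
    have "eventually (\<lambda>y. y \<in> {0<..<x + 1} - (E \<inter> {0<..x + 1} - {x})) (nhds x)"
      using x fin by (intro eventually_nhds_in_open open_Diff finite_imp_closed) auto
    then have "eventually (\<lambda>y. y \<in> {0<..<x + 1} - (E \<inter> {0<..x + 1} - {x}) \<and> y \<noteq> x) (at x)"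
      by (auto simp: eventually_at_filter elim: eventually_mono)
    then show "eventually (ode V C) (at x)"
      by eventually_elim (use S in auto)
  qed
  have lim: "(V \<longlongrightarrow> 0) (at_right 0)" "(C \<longlongrightarrow> 0) (at_right 0)" using S by auto
  have "((\<lambda>x. x powr lam * V x - ell * (x powr lam * C x)) \<longlongrightarrow> - lam * u_plus - ell * (- lam * c_plus)) (at_right 0)"
    using S by (intro tendsto_diff tendsto_mult[OF tendsto_const]) auto
  moreover have "- lam * u_plus - ell * (- lam * c_plus) = - lam * (u_plus - ell * c_plus)"
    by (simp add: algebra_simps)
  moreover have "- lam * (u_plus - ell * c_plus) < 0" using Ma lam_neg by (intro mult_pos_neg) auto
  ultimately have "eventually (\<lambda>x. x powr lam * V x - ell * (x powr lam * C x) < 0) (at_right 0)"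
    by (intro order_tendstoD(2)[where y = "- lam * u_plus - ell * (- lam * c_plus)"]) auto
  then have "eventually (\<lambda>x. riemann_inv ell (- 1) (V x) (C x) < 0) (at_right 0)"
    using eventually_at_right_less[of "0::real"]
  proof eventually_elim
    case (elim x)
    then have "x powr lam * riemann_inv ell (- 1) (V x) (C x) < 0"
      by (simp add: riemann_inv_def algebra_simps)
    then show ?case using elim(2) by (simp add: mult_less_0_iff)
  qed
  from incoming_wave_excludes_global_profile[OF lim this] show False .
qed

end

section \<open>The Picard-Lindeloef theorem\<close>

text \<open>
  A globally Lipschitz and bounded field has global solutions. The fixed point is found in one step
  on the whole half-line: for \<open>g(t) = exp (- L t) y(t)\<close> the integral operator contracts the space of bounded
  continuous functions with factor \<open>K / L\<close>.
\<close>

lemma picard_lindeloef_global: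
  fixes f :: "real \<Rightarrow> 'a::banach \<Rightarrow> 'a" and y0 :: 'a
  assumes cont: "continuous_on UNIV (\<lambda>(t, y). f t y)"
    and lip: "\<And>t y z. norm (f t y - f t z) \<le> K * norm (y - z)"
    and bnd: "\<And>t y. norm (f t y) \<le> B"
  shows "\<exists>y. y 0 = y0 \<and> continuous_on {0..} y \<and>
    (\<forall>t>0. (y has_vector_derivative f t (y t)) (at t))"
proof -
  \<comment> \<open>The weight \<open>L\<close> dominates \<open>2 K\<close> and is positive even if \<open>K\<close> is not.\<close>
  define L where "L = 2 * max K 1"
  have L: "L > 0" "K \<le> L / 2" by (auto simp: L_def)
  have B0: "B \<ge> 0" using bnd[of 0 0] norm_ge_zero order_trans by blast
  define I where "I g t = integral {0..t} (\<lambda>s. f s (exp (L * s) *\<^sub>R g s))" for g :: "real \<Rightarrow> 'a" and t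
  define T where "T g t = exp (- L * max 0 t) *\<^sub>R (y0 + I g (max 0 t))" for g :: "real \<Rightarrow> 'a" and t
  have cf: "continuous_on S (\<lambda>s. f s (exp (L * s) *\<^sub>R g s))" if "continuous_on UNIV g" for g S
  proof -
    have "continuous_on S (\<lambda>s. (s, exp (L * s) *\<^sub>R g s))"
      by (intro continuous_intros continuous_on_subset[OF that]) auto
    from continuous_on_compose2[OF cont this] show ?thesis by simp
  qed
  have contI: "continuous_on {0..} (I g)" if "continuous_on UNIV g" for g
  proof -
    have "continuous_on {0..b} (I g)" for b
      unfolding I_def by (intro indefinite_integral_continuous_1 integrable_continuous_interval cf that)
    then have "continuous (at t within {0..}) (I g)" if "t \<ge> 0" for t
    proof -
      have "continuous (at t within {0..t+1}) (I g)"
        using \<open>\<And>b. continuous_on {0..b} (I g)\<close>[of "t+1"] that by (simp add: continuous_on_eq_continuous_within)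
      moreover have "at t within {0..} = at t within {0..t+1}"
        by (rule at_within_nhd[where S = "{..<t+1}"]) auto
      ultimately show ?thesis by simp
    qed
    then show ?thesis by (simp add: continuous_on_eq_continuous_within)
  qed
  have contT: "continuous_on UNIV (T g)" if "continuous_on UNIV g" for g
  proof -
    have "continuous_on UNIV (\<lambda>t. I g (max 0 t))"
      by (rule continuous_on_compose2[OF contI[OF that]]) (auto intro!: continuous_intros simp: le_max_iff_disj)
    then show ?thesis unfolding T_def[abs_def] by (intro continuous_intros)
  qed
  have bdT: "norm (T g t) \<le> norm y0 + B / L" if "continuous_on UNIV g" for g t
  proof -
    define m where "m = max 0 t"
    have m: "m \<ge> 0" by (simp add: m_def)
    have "norm (I g m) \<le> integral {0..m} (\<lambda>s. B)"
      unfolding I_def by (intro integral_norm_bound_integral integrable_continuous_interval cf that bnd) auto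
    then have "norm (I g m) \<le> B * m" using m by (simp add: mult.commute)
    then have n: "norm (y0 + I g m) \<le> norm y0 + B * m" using norm_triangle_ineq[of y0 "I g m"] by linarith
    have "L * m \<le> exp (L * m)" using exp_ge_add_one_self[of "L * m"] by linarith
    then have "exp (- L * m) * m \<le> 1 / L" using L by (simp add: exp_minus field_simps)
    then have e2: "B * (exp (- L * m) * m) \<le> B * (1 / L)" using B0 by (intro mult_left_mono)
    have "exp (- L * m) \<le> 1" using L m by simp
    then have e1: "exp (- L * m) * norm y0 \<le> norm y0" by (intro mult_left_le_one_le) auto
    have "norm (T g t) = exp (- L * m) * norm (y0 + I g m)" by (simp add: T_def m_def)
    also have "\<dots> \<le> exp (- L * m) * (norm y0 + B * m)" using n by (intro mult_left_mono) auto
    also have "\<dots> = exp (- L * m) * norm y0 + B * (exp (- L * m) * m)" by (simp add: algebra_simps)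
    also have "\<dots> \<le> norm y0 + B / L" using e1 e2 by simp
    finally show ?thesis .
  qed
  have Tin: "T (apply_bcontfun g) \<in> bcontfun" for g :: "real \<Rightarrow>\<^sub>C 'a"
    unfolding bcontfun_def using contT[of g] bdT[of g]
    by (auto intro!: boundedI)
  define F where "F g = Bcontfun (T (apply_bcontfun g))" for g :: "real \<Rightarrow>\<^sub>C 'a"
  have F: "apply_bcontfun (F g) = T (apply_bcontfun g)" for g
    unfolding F_def by (rule Bcontfun_inverse[OF Tin])
  have contr: "dist (F g) (F h) \<le> 1 / 2 * dist g h" for g h
  proof (rule dist_bound)
    fix t :: real
    define m where "m = max 0 t"
    define d where "d = dist g h"
    have m: "m \<ge> 0" and d: "d \<ge> 0" by (auto simp: m_def d_def)
    have "norm (f s (exp (L * s) *\<^sub>R g s) - f s (exp (L * s) *\<^sub>R h s)) \<le> L / 2 * d * exp (L * s)" for s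
    proof -
      have "norm (f s (exp (L * s) *\<^sub>R g s) - f s (exp (L * s) *\<^sub>R h s))
        \<le> K * norm (exp (L * s) *\<^sub>R g s - exp (L * s) *\<^sub>R h s)" by (rule lip)
      also have "\<dots> \<le> L / 2 * norm (exp (L * s) *\<^sub>R g s - exp (L * s) *\<^sub>R h s)"
        using L by (intro mult_right_mono) auto
      also have "norm (exp (L * s) *\<^sub>R g s - exp (L * s) *\<^sub>R h s) = exp (L * s) * dist (g s) (h s)"
        by (simp add: scaleR_diff_right[symmetric] dist_norm)
      also have "L / 2 * (exp (L * s) * dist (g s) (h s)) \<le> L / 2 * (exp (L * s) * d)"
        using L dist_bounded[of g s h] unfolding d_def by (intro mult_left_mono) auto
      finally show ?thesis by (simp add: mult_ac)
    qed
    then have "norm (integral {0..m} (\<lambda>s. f s (exp (L * s) *\<^sub>R g s) - f s (exp (L * s) *\<^sub>R h s)))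
      \<le> integral {0..m} (\<lambda>s. L / 2 * d * exp (L * s))"
      by (intro integral_norm_bound_integral integrable_continuous_interval continuous_intros cf) auto
    also have "integral {0..m} (\<lambda>s. L / 2 * d * exp (L * s)) = d / 2 * exp (L * m) - d / 2 * exp (L * 0)"
    proof (rule integral_unique, rule fundamental_theorem_of_calculus[OF m])
      fix s
      have "((\<lambda>s. d / 2 * exp (L * s)) has_real_derivative L / 2 * d * exp (L * s)) (at s within {0..m})"
        by (auto intro!: derivative_eq_intros)
      then show "((\<lambda>s. d / 2 * exp (L * s)) has_vector_derivative L / 2 * d * exp (L * s)) (at s within {0..m})"
        by (simp add: has_real_derivative_iff_has_vector_derivative)
    qed
    also have "integral {0..m} (\<lambda>s. f s (exp (L * s) *\<^sub>R g s) - f s (exp (L * s) *\<^sub>R h s)) = I g m - I h m"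
      unfolding I_def by (intro integral_diff integrable_continuous_interval cf) auto
    finally have *: "norm (I g m - I h m) \<le> d / 2 * exp (L * m)" using d by simp
    have "dist (F g t) (F h t) = exp (- L * m) * norm (I g m - I h m)"
      by (simp add: F T_def m_def dist_norm scaleR_diff_right[symmetric])
    also have "\<dots> \<le> exp (- L * m) * (d / 2 * exp (L * m))" using * by (intro mult_left_mono) auto
    also have "\<dots> = 1 / 2 * d" by (simp add: exp_minus)
    finally show "dist (F g t) (F h t) \<le> 1 / 2 * dist g h" by (simp add: d_def)
  qed
  obtain g where g: "F g = g"
    using banach_fix_type[of "1 / 2" F] contr by auto
  define y where "y t = exp (L * t) *\<^sub>R apply_bcontfun g t" for t
  have y: "y t = y0 + integral {0..t} (\<lambda>s. f s (y s))" if "t \<ge> 0" for t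
  proof -
    have "apply_bcontfun g t = T g t" using F[of g] g by simp
    then show ?thesis using that by (simp add: y_def T_def I_def exp_minus)
  qed
  have cy: "continuous_on UNIV y" unfolding y_def by (intro continuous_intros) auto
  have "(y has_vector_derivative f t (y t)) (at t)" if t: "t > 0" for t
  proof -
    have "continuous_on UNIV (\<lambda>s. f s (y s))"
      using cf[of g UNIV] by (simp add: y_def)
    then have "continuous_on {0..t+1} (\<lambda>s. f s (y s))" by (rule continuous_on_subset) simp
    from integral_has_vector_derivative[OF this, of t] t
    have "((\<lambda>u. integral {0..u} (\<lambda>s. f s (y s))) has_vector_derivative f t (y t)) (at t within {0..t+1})"
      by simp
    then have "((\<lambda>u. y0 + integral {0..u} (\<lambda>s. f s (y s))) has_vector_derivative 0 + f t (y t)) (at t within {0..t+1})"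
      by (intro has_vector_derivative_add has_vector_derivative_const)
    then have "((\<lambda>u. y0 + integral {0..u} (\<lambda>s. f s (y s))) has_vector_derivative f t (y t)) (at t)"
      using at_within_Icc_at[of 0 t "t+1"] t by simp
    then show ?thesis
      by (rule has_vector_derivative_transform_within_open[where S = "{0<..}"]) (use t y in auto)
  qed
  moreover have "y 0 = y0" using y[of 0] by simp
  ultimately show ?thesis using continuous_on_subset[OF cy, of "{0..}"] by blast
qed

section \<open>The Riemann invariants as functions of elapsed time\<close>

definition clamp_to :: "real \<Rightarrow> real \<Rightarrow> real \<Rightarrow> real" where
  "clamp_to lo hi x = max lo (min hi x)"

lemma clamp_to_bounds: "lo \<le> hi \<Longrightarrow> lo \<le> clamp_to lo hi x" "lo \<le> hi \<Longrightarrow> clamp_to lo hi x \<le> hi"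
  by (auto simp: clamp_to_def)

lemma clamp_to_id: "lo \<le> x \<Longrightarrow> x \<le> hi \<Longrightarrow> clamp_to lo hi x = x"
  by (auto simp: clamp_to_def)

lemma clamp_to_nonexpansive: "\<bar>clamp_to lo hi x - clamp_to lo hi y\<bar> \<le> \<bar>x - y\<bar>"
  by (auto simp: clamp_to_def max_def min_def)

lemma mult_clamp_to_symmetric_nonneg: "R \<ge> 0 \<Longrightarrow> x * clamp_to (- R) R x \<ge> 0"
  unfolding clamp_to_def zero_le_mult_iff by linarith

lemma continuous_on_clamp_to [continuous_intros]:
  "continuous_on S f \<Longrightarrow> continuous_on S (\<lambda>x. clamp_to lo hi (f x))"
  unfolding clamp_to_def by (intro continuous_intros)

text \<open>
  With \<open>p\<close> the characteristic speed of the flow divided by \<open>x\<^sup>1\<^sup>+\<^sup>a\<close> and \<open>z = t x\<^sup>a\<close>, the denominator is the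
  sonic gap.
\<close>

definition char_speed :: "real \<Rightarrow> real \<Rightarrow> real \<Rightarrow> real" where
  "char_speed a z p = p / (1 + a * z * p)"

lemma char_speed_lipschitz:
  assumes "1 + a * z * p \<ge> 1 / 2" "1 + a * z * q \<ge> 1 / 2"
  shows "\<bar>char_speed a z p - char_speed a z q\<bar> \<le> 4 * \<bar>p - q\<bar>"
proof -
  let ?u = "1 + a * z * p" and ?w = "1 + a * z * q"
  have pos: "?u > 0" "?w > 0" using assms by auto
  have "char_speed a z p - char_speed a z q = (p - q) / (?u * ?w)"
    using pos by (simp add: char_speed_def diff_frac_eq) (simp add: algebra_simps)
  then have "\<bar>char_speed a z p - char_speed a z q\<bar> = \<bar>p - q\<bar> / (?u * ?w)"
    using pos by (simp add: abs_mult)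
  also have "1 / 2 * (1 / 2) \<le> ?u * ?w" using assms by (intro mult_mono) auto
  then have "\<bar>p - q\<bar> / (?u * ?w) \<le> \<bar>p - q\<bar> / (1 / 4)"
    by (intro divide_left_mono mult_pos_pos) (use pos in auto)
  finally show ?thesis by simp
qed

text \<open>
  If \<open>r = v + \<ell> k\<close> and \<open>s = v - \<ell> k\<close>, then this is \<open>v + k\<close>, and exchanging the arguments gives \<open>v - k\<close>.
\<close>

definition char_vel :: "real \<Rightarrow> real \<Rightarrow> real \<Rightarrow> real" where
  "char_vel ell r s = ((ell + 1) * r + (ell - 1) * s) / (2 * ell)"

lemma char_vel_abs_le:
  assumes "ell > 1" shows "\<bar>char_vel ell r s\<bar> \<le> \<bar>r\<bar> + \<bar>s\<bar>"
proof -
  have "\<bar>(ell + 1) * r + (ell - 1) * s\<bar> \<le> (ell + 1) * \<bar>r\<bar> + (ell - 1) * \<bar>s\<bar>"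
    using abs_triangle_ineq[of "(ell + 1) * r" "(ell - 1) * s"] assms by (simp add: abs_mult)
  also have "\<dots> \<le> (2 * ell) * \<bar>r\<bar> + (2 * ell) * \<bar>s\<bar>"
    using assms by (intro add_mono mult_right_mono) auto
  finally have "\<bar>(ell + 1) * r + (ell - 1) * s\<bar> / (2 * ell) \<le> \<bar>r\<bar> + \<bar>s\<bar>"
    using assms by (simp add: pos_divide_le_eq ring_distribs mult_ac)
  then show ?thesis using assms by (simp add: char_vel_def)
qed

lemma char_vel_diff: "char_vel ell r s - char_vel ell r' s' = char_vel ell (r - r') (s - s')"
  by (simp add: char_vel_def diff_divide_distrib[symmetric] algebra_simps)

text \<open>
  Truncating the invariants, the characteristic speeds and, through \<open>\<zeta>\<close>, the time in the denominators
  turns the system into a bounded and globally Lipschitz one. Solutions that respect the bounds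
  solve the original system.
\<close>

lemma clamped_riemann_system:
  fixes a ell lo P R r0 s0 :: real and \<zeta> :: "real \<Rightarrow> real"
  assumes a: "a > 0" and ell: "ell > 1"
    and lo: "- P \<le> lo" "lo \<le> P" and R: "R \<ge> 0"
    and \<zeta>: "continuous_on UNIV \<zeta>"
    and half: "\<And>z p. lo \<le> p \<Longrightarrow> p \<le> P \<Longrightarrow> 1 + a * \<zeta> z * p \<ge> 1 / 2"
  shows "\<exists>r s. r 0 = r0 \<and> s 0 = s0 \<and> continuous_on {0..} r \<and> continuous_on {0..} s \<and>
    (\<forall>z>0. (r has_real_derivative - (1 + a) *
              char_speed a (\<zeta> z) (clamp_to lo P (char_vel ell (r z) (s z))) * clamp_to (- R) R (r z)) (at z) \<and>
           (s has_real_derivative - (1 + a) *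
              char_speed a (\<zeta> z) (clamp_to lo P (char_vel ell (s z) (r z))) * clamp_to (- R) R (s z)) (at z))"
proof -
  define h where "h z r s = char_speed a (\<zeta> z) (clamp_to lo P (char_vel ell r s))" for z r s
  define k where "k z r s = - (1 + a) * h z r s * clamp_to (- R) R r" for z r s
  define f where "f z y = (k z (fst y) (snd y), k z (snd y) (fst y))" for z and y :: "real \<times> real"
  have cl: "lo \<le> clamp_to lo P x" "clamp_to lo P x \<le> P" for x using clamp_to_bounds[OF lo(2)] by auto
  have P: "P \<ge> 0" using lo by simp
  have clR: "\<bar>clamp_to (- R) R x\<bar> \<le> R" for x
    using clamp_to_bounds[of "- R" R x] R by auto
  have hb: "\<bar>h z r s\<bar> \<le> 2 * P" for z r s
  proof -
    let ?p = "clamp_to lo P (char_vel ell r s)"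
    have "\<bar>?p\<bar> \<le> P" using cl[of "char_vel ell r s"] lo by linarith
    then have "\<bar>?p\<bar> / \<bar>1 + a * \<zeta> z * ?p\<bar> \<le> P / (1 / 2)"
      using half[OF cl, of z "char_vel ell r s"] by (intro frac_le) (auto intro: order_trans[OF _ abs_ge_self])
    then show ?thesis by (simp add: h_def char_speed_def)
  qed
  have hl: "\<bar>h z r s - h z r' s'\<bar> \<le> 4 * (\<bar>r - r'\<bar> + \<bar>s - s'\<bar>)" for z r s r' s'
  proof -
    have "\<bar>h z r s - h z r' s'\<bar> \<le> 4 * \<bar>clamp_to lo P (char_vel ell r s) - clamp_to lo P (char_vel ell r' s')\<bar>"
      unfolding h_def by (intro char_speed_lipschitz half cl)
    also have "\<dots> \<le> 4 * \<bar>char_vel ell r s - char_vel ell r' s'\<bar>"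
      using clamp_to_nonexpansive by (intro mult_left_mono) auto
    also have "\<dots> \<le> 4 * (\<bar>r - r'\<bar> + \<bar>s - s'\<bar>)"
      unfolding char_vel_diff using char_vel_abs_le[OF ell] by (intro mult_left_mono) auto
    finally show ?thesis .
  qed
  have kb: "\<bar>k z r s\<bar> \<le> (1 + a) * (2 * P) * R" for z r s
  proof -
    have "\<bar>k z r s\<bar> = (1 + a) * \<bar>h z r s\<bar> * \<bar>clamp_to (- R) R r\<bar>" using a by (simp add: k_def abs_mult)
    also have "\<dots> \<le> (1 + a) * (2 * P) * R" using a P hb clR by (intro mult_mono) auto
    finally show ?thesis .
  qed
  have kl: "\<bar>k z r s - k z r' s'\<bar> \<le> (1 + a) * ((2 * P + 4 * R) * (\<bar>r - r'\<bar> + \<bar>s - s'\<bar>))" for z r s r' s'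
  proof -
    let ?c = "clamp_to (- R) R"
    have "k z r s - k z r' s' = - (1 + a) * (h z r s * (?c r - ?c r') + (h z r s - h z r' s') * ?c r')"
      by (simp add: k_def algebra_simps)
    then have "\<bar>k z r s - k z r' s'\<bar> = (1 + a) * \<bar>h z r s * (?c r - ?c r') + (h z r s - h z r' s') * ?c r'\<bar>"
      using a by (simp add: abs_mult)
    also have "\<dots> \<le> (1 + a) * (\<bar>h z r s\<bar> * \<bar>?c r - ?c r'\<bar> + \<bar>h z r s - h z r' s'\<bar> * \<bar>?c r'\<bar>)"
      using a abs_triangle_ineq[of "h z r s * (?c r - ?c r')" "(h z r s - h z r' s') * ?c r'"]
      by (intro mult_left_mono) (auto simp: abs_mult)
    also have "\<dots> \<le> (1 + a) * (2 * P * (\<bar>r - r'\<bar> + \<bar>s - s'\<bar>) + 4 * (\<bar>r - r'\<bar> + \<bar>s - s'\<bar>) * R)"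
      using a P R hb hl clR clamp_to_nonexpansive[of "- R" R r r']
      by (intro mult_left_mono add_mono mult_mono) (auto intro: order_trans)
    finally show ?thesis by (simp add: algebra_simps)
  qed
  have pair: "norm (u, w) \<le> \<bar>u\<bar> + \<bar>w\<bar>" for u w :: real
    using norm_Pair_le[of u w] by simp
  have "\<exists>y. y 0 = (r0, s0) \<and> continuous_on {0..} y \<and>
    (\<forall>t>0. (y has_vector_derivative f t (y t)) (at t))"
  proof (rule picard_lindeloef_global)
    have pos: "1 + a * \<zeta> z * clamp_to lo P x \<noteq> 0" for z x
      using half[OF cl, of z x] by auto
    have [continuous_intros]: "continuous_on UNIV (\<lambda>x. \<zeta> (fst x))"
      by (rule continuous_on_compose2[OF \<zeta>]) (auto intro!: continuous_intros)
    show "continuous_on UNIV (\<lambda>(t, y). f t y)"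
      unfolding f_def k_def h_def char_speed_def char_vel_def case_prod_beta
      by (intro continuous_intros) (use ell pos in \<open>auto simp: char_vel_def\<close>)
    show "norm (f t y) \<le> 2 * ((1 + a) * (2 * P) * R)" for t y
      unfolding f_def using pair[of "k t (fst y) (snd y)" "k t (snd y) (fst y)"] kb[of t "fst y" "snd y"] kb[of t "snd y" "fst y"]
      by linarith
    show "norm (f t y - f t z) \<le> 4 * ((1 + a) * (2 * P + 4 * R)) * norm (y - z)" for t y z
    proof -
      define c where "c = (1 + a) * (2 * P + 4 * R)"
      have c: "c \<ge> 0" using a P R by (simp add: c_def)
      define d where "d = \<bar>fst y - fst z\<bar> + \<bar>snd y - snd z\<bar>"
      have d: "d \<le> 2 * norm (y - z)"
        using norm_fst_le[of "fst (y - z)" "snd (y - z)"] norm_snd_le[of "snd (y - z)" "fst (y - z)"]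
        unfolding prod.collapse by (simp add: d_def)
      have "norm (f t y - f t z) \<le> c * d + c * d"
        using pair[of "k t (fst y) (snd y) - k t (fst z) (snd z)" "k t (snd y) (fst y) - k t (snd z) (fst z)"]
          kl[of t "fst y" "snd y" "fst z" "snd z"] kl[of t "snd y" "fst y" "snd z" "fst z"]
        by (simp add: f_def c_def d_def add.commute mult.assoc)
      also have "\<dots> \<le> c * (2 * norm (y - z)) + c * (2 * norm (y - z))"
        using c d by (intro add_mono mult_left_mono) auto
      finally show ?thesis by (simp add: c_def algebra_simps)
    qed
  qed
  then obtain y where y: "y 0 = (r0, s0)" "continuous_on {0..} y"
    "\<And>t. t > 0 \<Longrightarrow> (y has_vector_derivative f t (y t)) (at t)" by blast
  have "((\<lambda>t. fst (y t)) has_real_derivative k t (fst (y t)) (snd (y t))) (at t)"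
    "((\<lambda>t. snd (y t)) has_real_derivative k t (snd (y t)) (fst (y t))) (at t)" if "t > 0" for t
    using bounded_linear.has_vector_derivative[OF bounded_linear_fst y(3)[OF that]]
      bounded_linear.has_vector_derivative[OF bounded_linear_snd y(3)[OF that]]
    by (simp_all add: has_real_derivative_iff_has_vector_derivative f_def)
  then show ?thesis
    using y(1,2) unfolding k_def h_def
    by (intro exI[of _ "\<lambda>t. fst (y t)"] exI[of _ "\<lambda>t. snd (y t)"]) (auto intro!: continuous_intros)
qed

text \<open>
  A Gronwall argument: \<open>y\<^sup>2 exp (2 G z)\<close> is nondecreasing, so \<open>y\<close> has no zero.
\<close>

lemma positive_of_deriv_bound:
  fixes y :: "real \<Rightarrow> real"
  assumes b: "0 \<le> b" and cont: "continuous_on {0..b} y"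
    and der: "\<And>z. 0 < z \<Longrightarrow> z < b \<Longrightarrow> \<exists>D. (y has_real_derivative D) (at z) \<and> \<bar>D\<bar> \<le> G * \<bar>y z\<bar>"
    and pos: "y 0 > 0"
  shows "y b > 0"
proof -
  define f where "f z = (y z)\<^sup>2 * exp (2 * G * z)" for z
  have nz: "y c \<noteq> 0" if c: "0 \<le> c" "c \<le> b" for c
  proof -
    have "f 0 \<le> f c"
    proof (rule DERIV_nonneg_imp_increasing_open[OF c(1)])
      show "continuous_on {0..c} f" unfolding f_def
        by (intro continuous_intros continuous_on_subset[OF cont]) (use c in auto)
      fix z assume z: "0 < z" "z < c"
      obtain D where D: "(y has_real_derivative D) (at z)" "\<bar>D\<bar> \<le> G * \<bar>y z\<bar>"
        using der[of z] z c by auto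
      have "(f has_real_derivative (2 * (y z * D) + 2 * G * (y z)\<^sup>2) * exp (2 * G * z)) (at z)"
        unfolding f_def by (auto intro!: derivative_eq_intros D(1) simp: algebra_simps power2_eq_square)
      moreover have "\<bar>y z * D\<bar> \<le> \<bar>y z\<bar> * (G * \<bar>y z\<bar>)"
        unfolding abs_mult using D(2) by (intro mult_left_mono) auto
      then have "\<bar>y z * D\<bar> \<le> G * (y z)\<^sup>2" by (simp add: power2_eq_square mult_ac)
      then have "0 \<le> 2 * (y z * D) + 2 * G * (y z)\<^sup>2" by (simp add: abs_le_iff)
      ultimately show "\<exists>D. (f has_real_derivative D) (at z) \<and> 0 \<le> D" by (meson mult_nonneg_nonneg exp_ge_zero)
    qed
    moreover have "f 0 > 0" using pos by (simp add: f_def)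
    ultimately show ?thesis by (auto simp: f_def)
  qed
  show ?thesis
  proof (rule ccontr)
    assume "\<not> ?thesis"
    then obtain c where "0 \<le> c" "c \<le> b" "y c = 0"
      using IVT2'[of y b 0 0] cont pos b by auto
    then show False using nz by blast
  qed
qed

text \<open>
  The similarity equations in the variable \<open>z\<close> on \<open>0 < z < Z\<close>, with both sonic gaps positive; \<open>s < r\<close>
  means that the sound speed is positive.
\<close>

definition riemann_flow :: "real \<Rightarrow> real \<Rightarrow> ereal \<Rightarrow> (real \<Rightarrow> real) \<Rightarrow> (real \<Rightarrow> real) \<Rightarrow> bool" where
  "riemann_flow a ell Z r s \<longleftrightarrow> continuous_on {0..} r \<and> continuous_on {0..} s \<and>
     (\<forall>z>0. ereal z < Z \<longrightarrow>
        (r has_real_derivative - (1 + a) * char_speed a z (char_vel ell (r z) (s z)) * r z) (at z) \<and>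
        (s has_real_derivative - (1 + a) * char_speed a z (char_vel ell (s z) (r z)) * s z) (at z) \<and>
        1 + a * z * char_vel ell (r z) (s z) > 0 \<and> 1 + a * z * char_vel ell (s z) (r z) > 0 \<and>
        s z < r z)"

lemma abs_le_initial_of_damping:
  fixes y :: "real \<Rightarrow> real"
  assumes cont: "continuous_on {0..} y" and z: "z \<ge> 0"
    and der: "\<And>z. z > 0 \<Longrightarrow> (y has_real_derivative D z) (at z)"
    and sgn: "\<And>z. z > 0 \<Longrightarrow> y z * D z \<le> 0"
  shows "\<bar>y z\<bar> \<le> \<bar>y 0\<bar>"
proof -
  have "(y z)\<^sup>2 \<le> (y 0)\<^sup>2"
  proof (rule DERIV_nonpos_imp_decreasing_open[OF z])
    show "continuous_on {0..z} (\<lambda>z. (y z)\<^sup>2)"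
      by (intro continuous_intros continuous_on_subset[OF cont]) auto
    fix x assume x: "0 < x" "x < z"
    have "((\<lambda>z. (y z)\<^sup>2) has_real_derivative 2 * (y x * D x)) (at x)"
      using x by (auto intro!: derivative_eq_intros der)
    then show "\<exists>d. ((\<lambda>z. (y z)\<^sup>2) has_real_derivative d) (at x) \<and> d \<le> 0"
      using sgn[OF x(1)] by (intro exI[of _ "2 * (y x * D x)"] conjI) linarith+
  qed
  then show ?thesis by (simp add: abs_le_square_iff)
qed

text \<open>
  Nonnegative characteristic speeds damp both invariants, so they never leave the box
  \<open>0 \<le> s \<le> r \<le> r0\<close>, in which the truncation of \<open>clamped_riemann_system\<close> is inactive. That \<open>r\<close> stays
  above \<open>s\<close> follows from the symmetry of the system under exchange of \<open>r\<close> and \<open>s\<close>.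
\<close>

lemma rarefying_flow_exists:
  assumes a: "a > 0" and ell: "ell > 1" and r0: "r0 > s0" and s0: "s0 \<ge> 0"
  shows "\<exists>r s. r 0 = r0 \<and> s 0 = s0 \<and> riemann_flow a ell \<infinity> r s"
proof -
  have R: "r0 \<ge> 0" using r0 s0 by simp
  define h where "h z x y = char_speed a (max 0 z) (clamp_to 0 (2 * r0) (char_vel ell x y))" for z x y
  have cl: "0 \<le> clamp_to 0 (2 * r0) x" "clamp_to 0 (2 * r0) x \<le> 2 * r0" for x
    using clamp_to_bounds[of 0 "2 * r0" x] R by auto
  have "\<exists>r s. r 0 = r0 \<and> s 0 = s0 \<and> continuous_on {0..} r \<and> continuous_on {0..} s \<and>
    (\<forall>z>0. (r has_real_derivative - (1 + a) * h z (r z) (s z) * clamp_to (- r0) r0 (r z)) (at z) \<and>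
           (s has_real_derivative - (1 + a) * h z (s z) (r z) * clamp_to (- r0) r0 (s z)) (at z))"
    unfolding h_def
  proof (rule clamped_riemann_system[OF a ell])
    show "continuous_on UNIV (max (0::real))" by (intro continuous_intros)
    show "1 / 2 \<le> 1 + a * max 0 z * p" if "0 \<le> p" for z p
    proof -
      have "a * max 0 z * p \<ge> 0" using a that by (intro mult_nonneg_nonneg) auto
      then show ?thesis by simp
    qed
  qed (use R in auto)
  then obtain r s where rs: "r 0 = r0" "s 0 = s0" "continuous_on {0..} r" "continuous_on {0..} s"
    and dr: "\<And>z. z > 0 \<Longrightarrow> (r has_real_derivative - (1 + a) * h z (r z) (s z) * clamp_to (- r0) r0 (r z)) (at z)"
    and ds: "\<And>z. z > 0 \<Longrightarrow> (s has_real_derivative - (1 + a) * h z (s z) (r z) * clamp_to (- r0) r0 (s z)) (at z)"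
    by blast
  have h0: "0 \<le> h z x y \<and> h z x y \<le> 2 * r0" for z x y
  proof -
    let ?p = "clamp_to 0 (2 * r0) (char_vel ell x y)"
    have "1 + a * max 0 z * ?p \<ge> 1" using a cl[of "char_vel ell x y"] by simp
    then have "?p / (1 + a * max 0 z * ?p) \<le> ?p / 1"
      using cl(1)[of "char_vel ell x y"] by (intro divide_left_mono) auto
    moreover have "0 \<le> ?p / (1 + a * max 0 z * ?p)"
      using cl(1)[of "char_vel ell x y"] \<open>1 + a * max 0 z * ?p \<ge> 1\<close> by (intro divide_nonneg_pos) linarith+
    ultimately show ?thesis using cl(2)[of "char_vel ell x y"] by (simp add: h_def char_speed_def)
  qed
  have sg: "y * (- (1 + a) * h z x x' * clamp_to (- r0) r0 y) \<le> 0" for y z x x'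
  proof -
    have "y * clamp_to (- r0) r0 y \<ge> 0" by (rule mult_clamp_to_symmetric_nonneg[OF R])
    moreover have "(1 + a) * h z x x' \<ge> 0" using a h0[of z x x'] by simp
    ultimately have "(1 + a) * h z x x' * (y * clamp_to (- r0) r0 y) \<ge> 0" by (rule mult_nonneg_nonneg[rotated])
    moreover have "y * (- (1 + a) * h z x x' * clamp_to (- r0) r0 y)
        = - ((1 + a) * h z x x' * (y * clamp_to (- r0) r0 y))" by (simp add: algebra_simps)
    ultimately show ?thesis by linarith
  qed
  have rb: "\<bar>r z\<bar> \<le> r0" if "z \<ge> 0" for z
    using abs_le_initial_of_damping[OF rs(3) that dr sg] rs(1) R by simp
  have sb: "\<bar>s z\<bar> \<le> s0" if "z \<ge> 0" for z
    using abs_le_initial_of_damping[OF rs(4) that ds sg] rs(2) s0 by simp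
  have cr: "clamp_to (- r0) r0 (r z) = r z" "clamp_to (- r0) r0 (s z) = s z" if "z \<ge> 0" for z
    using rb[OF that] sb[OF that] r0 by (auto intro!: clamp_to_id)
  note dr' = dr[unfolded cr(1)[OF less_imp_le]] and ds' = ds[unfolded cr(2)[OF less_imp_le]]
  have rs_pos: "s z < r z" if z: "z \<ge> 0" for z
  proof -
    have "r z - s z > 0"
    proof (rule positive_of_deriv_bound[OF z, where G = "(1 + a) * (10 * r0)"])
      show "continuous_on {0..z} (\<lambda>z. r z - s z)"
        by (intro continuous_intros continuous_on_subset[OF rs(3)] continuous_on_subset[OF rs(4)]) auto
      show "r 0 - s 0 > 0" using rs r0 by simp
      fix w assume w: "0 < w" "w < z"
      \<comment> \<open>Both summands of \<open>?D\<close> are Lipschitz multiples of \<open>r - s\<close>: the difference of the two speeds vanishes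
        when \<open>r = s\<close>.\<close>
      let ?D = "- (1 + a) * (h w (r w) (s w) * (r w - s w) + (h w (r w) (s w) - h w (s w) (r w)) * s w)"
      have "((\<lambda>z. r z - s z) has_real_derivative ?D) (at w)"
        by (rule DERIV_cong[OF DERIV_diff[OF dr ds]])
          (use w cr[of w] in \<open>auto simp: algebra_simps\<close>)
      moreover have "\<bar>?D\<bar> \<le> (1 + a) * (10 * r0) * \<bar>r w - s w\<bar>"
      proof -
        have "\<bar>h w (r w) (s w) - h w (s w) (r w)\<bar> \<le> 4 * \<bar>clamp_to 0 (2 * r0) (char_vel ell (r w) (s w)) - clamp_to 0 (2 * r0) (char_vel ell (s w) (r w))\<bar>"
          unfolding h_def using a cl(1) by (intro char_speed_lipschitz) (auto intro: order_trans[of _ 1])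
        also have "\<dots> \<le> 4 * \<bar>char_vel ell (r w) (s w) - char_vel ell (s w) (r w)\<bar>"
          using clamp_to_nonexpansive by (intro mult_left_mono) auto
        also have "\<dots> \<le> 4 * (\<bar>r w - s w\<bar> + \<bar>s w - r w\<bar>)"
          unfolding char_vel_diff using char_vel_abs_le[OF ell] by (intro mult_left_mono) auto
        finally have hd: "\<bar>h w (r w) (s w) - h w (s w) (r w)\<bar> \<le> 8 * \<bar>r w - s w\<bar>"
          by (simp add: abs_minus_commute)
        have "\<bar>h w (r w) (s w) * (r w - s w) + (h w (r w) (s w) - h w (s w) (r w)) * s w\<bar>
          \<le> \<bar>h w (r w) (s w)\<bar> * \<bar>r w - s w\<bar> + \<bar>h w (r w) (s w) - h w (s w) (r w)\<bar> * \<bar>s w\<bar>"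
          by (metis abs_mult abs_triangle_ineq)
        also have "\<dots> \<le> 2 * r0 * \<bar>r w - s w\<bar> + 8 * \<bar>r w - s w\<bar> * r0"
          using h0[of w "r w" "s w"] hd sb[of w] w r0 by (intro add_mono mult_mono) auto
        finally have "\<bar>h w (r w) (s w) * (r w - s w) + (h w (r w) (s w) - h w (s w) (r w)) * s w\<bar> \<le> 10 * r0 * \<bar>r w - s w\<bar>"
          by simp
        then have "(1 + a) * \<bar>h w (r w) (s w) * (r w - s w) + (h w (r w) (s w) - h w (s w) (r w)) * s w\<bar> \<le> (1 + a) * (10 * r0 * \<bar>r w - s w\<bar>)"
          using a by (intro mult_left_mono) auto
        moreover have "\<bar>?D\<bar> = (1 + a) * \<bar>h w (r w) (s w) * (r w - s w) + (h w (r w) (s w) - h w (s w) (r w)) * s w\<bar>"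
          using a by (simp add: abs_mult)
        ultimately show ?thesis by (simp add: mult.assoc)
      qed
      ultimately show "\<exists>D. ((\<lambda>z. r z - s z) has_real_derivative D) (at w) \<and> \<bar>D\<bar> \<le> (1 + a) * (10 * r0) * \<bar>r w - s w\<bar>"
        by blast
    qed
    then show ?thesis by simp
  qed
  have s_nonneg: "s z \<ge> 0" if z: "z \<ge> 0" for z
  proof (cases "s0 = 0")
    case True then show ?thesis using sb[OF z] by simp
  next
    case False
    have "s z > 0"
    proof (rule positive_of_deriv_bound[OF z, where G = "(1 + a) * (2 * r0)"])
      show "continuous_on {0..z} s" by (intro continuous_on_subset[OF rs(4)]) auto
      show "s 0 > 0" using rs s0 False by simp
      fix w assume w: "0 < w" "w < z"
      have "\<bar>- (1 + a) * h w (s w) (r w) * s w\<bar> = (1 + a) * h w (s w) (r w) * \<bar>s w\<bar>"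
        using a h0 by (simp add: abs_mult)
      also have "\<dots> \<le> (1 + a) * (2 * r0) * \<bar>s w\<bar>"
        using a h0 by (intro mult_right_mono mult_left_mono) auto
      finally show "\<exists>D. (s has_real_derivative D) (at w) \<and> \<bar>D\<bar> \<le> (1 + a) * (2 * r0) * \<bar>s w\<bar>"
        using ds[OF w(1)] cr(2)[of w] w by auto
    qed
    then show ?thesis by simp
  qed
  have p: "0 \<le> char_vel ell x y \<and> char_vel ell x y \<le> 2 * r0"
    if "0 \<le> x" "0 \<le> y" "x \<le> r0" "y \<le> r0" for x y
    using char_vel_abs_le[OF ell, of x y] that ell by (auto simp: char_vel_def)
  have "riemann_flow a ell \<infinity> r s"
    unfolding riemann_flow_def
  proof (intro conjI allI impI rs)
    fix z :: real assume z: "z > 0"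
    have b: "0 \<le> r z" "0 \<le> s z" "r z \<le> r0" "s z \<le> r0"
      using rb[of z] sb[of z] s_nonneg[of z] rs_pos[of z] z r0 by auto
    note p1 = p[OF b] and p2 = p[OF b(2,1,4,3)]
    have "h z (r z) (s z) = char_speed a z (char_vel ell (r z) (s z))"
      "h z (s z) (r z) = char_speed a z (char_vel ell (s z) (r z))"
      using p1 p2 z by (auto simp: h_def clamp_to_id)
    then show "(r has_real_derivative - (1 + a) * char_speed a z (char_vel ell (r z) (s z)) * r z) (at z)"
      "(s has_real_derivative - (1 + a) * char_speed a z (char_vel ell (s z) (r z)) * s z) (at z)"
      using dr[OF z] ds[OF z] cr[of z] z by auto
    show "1 + a * z * char_vel ell (r z) (s z) > 0" "1 + a * z * char_vel ell (s z) (r z) > 0"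
      using a z p1 p2 by (auto intro!: add_pos_nonneg)
    show "s z < r z" using rs_pos z by simp
  qed
  then show ?thesis using rs by blast
qed

text \<open>
  The truncation is placed strictly outside the initial values, so by continuity it is inactive for a
  short time.
\<close>

lemma local_flow_exists:
  assumes a: "a > 0" and ell: "ell > 1" and r0: "r0 > s0"
  shows "\<exists>r s Z. Z > 0 \<and> r 0 = r0 \<and> s 0 = s0 \<and> riemann_flow a ell (ereal Z) r s"
proof -
  define R where "R = \<bar>r0\<bar> + \<bar>s0\<bar> + 1"
  have R: "R > 0" "\<bar>r0\<bar> < R" "\<bar>s0\<bar> < R" by (auto simp: R_def)
  \<comment> \<open>Speeds are bounded by \<open>2 * R\<close>, so up to time \<open>\<delta>\<close> the denominators are at least \<open>1 - a \<delta> 2 R = 1 / 2\<close>.\<close>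
  define \<delta> where "\<delta> = 1 / (4 * a * R)"
  have \<delta>: "\<delta> > 0" using a R by (simp add: \<delta>_def)
  have half: "1 / 2 \<le> 1 + a * min \<delta> (max 0 z) * p" if "- (2 * R) \<le> p" for z p
  proof -
    have m: "0 \<le> min \<delta> (max 0 z)" "min \<delta> (max 0 z) \<le> \<delta>" using \<delta> by auto
    have "a * \<delta> * (- (2 * R)) \<le> a * min \<delta> (max 0 z) * (- (2 * R))"
      using a m R by (intro mult_right_mono_neg mult_left_mono) auto
    also have "\<dots> \<le> a * min \<delta> (max 0 z) * p" using a m that by (intro mult_left_mono) auto
    finally have "a * \<delta> * (- (2 * R)) \<le> a * min \<delta> (max 0 z) * p" .
    moreover have "a * \<delta> * (- (2 * R)) = - 1 / 2" using a R by (simp add: \<delta>_def field_simps)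
    ultimately show ?thesis by linarith
  qed
  have "\<exists>r s. r 0 = r0 \<and> s 0 = s0 \<and> continuous_on {0..} r \<and> continuous_on {0..} s \<and>
    (\<forall>z>0. (r has_real_derivative - (1 + a) *
              char_speed a (min \<delta> (max 0 z)) (clamp_to (- (2 * R)) (2 * R) (char_vel ell (r z) (s z))) * clamp_to (- R) R (r z)) (at z) \<and>
           (s has_real_derivative - (1 + a) *
              char_speed a (min \<delta> (max 0 z)) (clamp_to (- (2 * R)) (2 * R) (char_vel ell (s z) (r z))) * clamp_to (- R) R (s z)) (at z))"
    by (rule clamped_riemann_system[OF a ell]) (use half R in \<open>auto intro!: continuous_intros\<close>)
  then obtain r s where rs: "r 0 = r0" "s 0 = s0" "continuous_on {0..} r" "continuous_on {0..} s"
    and dr: "\<And>z. z > 0 \<Longrightarrow> (r has_real_derivative - (1 + a) *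
              char_speed a (min \<delta> (max 0 z)) (clamp_to (- (2 * R)) (2 * R) (char_vel ell (r z) (s z))) * clamp_to (- R) R (r z)) (at z)"
    and ds: "\<And>z. z > 0 \<Longrightarrow> (s has_real_derivative - (1 + a) *
              char_speed a (min \<delta> (max 0 z)) (clamp_to (- (2 * R)) (2 * R) (char_vel ell (s z) (r z))) * clamp_to (- R) R (s z)) (at z)"
    by blast
  have lims: "(r \<longlongrightarrow> r0) (at_right 0)" "(s \<longlongrightarrow> s0) (at_right 0)"
    using rs by (auto simp: continuous_on_def at_within_Ici_at_right dest!: bspec[of _ _ 0])
  have "eventually (\<lambda>z. \<bar>r z\<bar> < R) (at_right 0)" "eventually (\<lambda>z. \<bar>s z\<bar> < R) (at_right 0)"
    using R by (auto intro!: order_tendstoD(2)[OF tendsto_rabs] lims)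
  moreover have "eventually (\<lambda>z. r z - s z > 0) (at_right 0)"
    using r0 by (intro order_tendstoD(1)[OF tendsto_diff[OF lims]]) auto
  moreover have "eventually (\<lambda>z. z < \<delta>) (at_right 0)"
    using eventually_at_right_real[OF \<delta>] by eventually_elim auto
  ultimately have "eventually (\<lambda>z. \<bar>r z\<bar> < R \<and> \<bar>s z\<bar> < R \<and> s z < r z \<and> z < \<delta>) (at_right 0)"
    by eventually_elim auto
  then obtain Z where Z: "Z > 0" "\<And>z. 0 < z \<Longrightarrow> z < Z \<Longrightarrow> \<bar>r z\<bar> < R \<and> \<bar>s z\<bar> < R \<and> s z < r z \<and> z < \<delta>"
    unfolding eventually_at_right_field by auto
  have "riemann_flow a ell (ereal Z) r s"
    unfolding riemann_flow_def
  proof (intro conjI allI impI rs)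
    fix z :: real assume z: "z > 0" "ereal z < ereal Z"
    then have b: "\<bar>r z\<bar> < R" "\<bar>s z\<bar> < R" "s z < r z" "z < \<delta>" using Z(2)[of z] by auto
    have m: "min \<delta> (max 0 z) = z" using b z by simp
    have p: "- (2 * R) \<le> char_vel ell (r z) (s z)" "char_vel ell (r z) (s z) \<le> 2 * R"
      "- (2 * R) \<le> char_vel ell (s z) (r z)" "char_vel ell (s z) (r z) \<le> 2 * R"
      using char_vel_abs_le[OF ell, of "r z" "s z"] char_vel_abs_le[OF ell, of "s z" "r z"] b by linarith+
    show "(r has_real_derivative - (1 + a) * char_speed a z (char_vel ell (r z) (s z)) * r z) (at z)"
      "(s has_real_derivative - (1 + a) * char_speed a z (char_vel ell (s z) (r z)) * s z) (at z)"
      using dr[OF z(1)] ds[OF z(1)] b p by (simp_all add: m clamp_to_id)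
    show "1 + a * z * char_vel ell (r z) (s z) > 0" "1 + a * z * char_vel ell (s z) (r z) > 0"
      using half[OF p(1), of z] half[OF p(3), of z] unfolding m by auto
    show "s z < r z" by (rule b)
  qed
  then show ?thesis using rs Z(1) by blast
qed

section \<open>From Riemann invariants to similarity profiles\<close>

lemma DERIV_powr_quotient:
  fixes x a :: real
  assumes "x > 0"
  shows "((\<lambda>x. x powr a) has_real_derivative a * x powr a / x) (at x)"
proof -
  have "a * x powr (a - 1) = a * x powr a / x" using assms by (simp add: powr_diff)
  then show ?thesis using has_real_derivative_powr[OF assms, of a] by simp
qed

context similarity_params
begin

text \<open>
  The converse of \<open>deriv_riemann\<close>.
\<close>

lemma ode_of_riemann_derivs:
  assumes dP: "((\<lambda>x. riemann_inv ell 1 (V x) (C x)) has_real_derivative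
           riemann_rate 1 (V x) (C x) / sonic_gap 1 (V x) (C x) / x) (at x)"
    and dQ: "((\<lambda>x. riemann_inv ell (- 1) (V x) (C x)) has_real_derivative
           riemann_rate (- 1) (V x) (C x) / sonic_gap (- 1) (V x) (C x) / x) (at x)"
    and nz: "sonic_gap 1 (V x) (C x) \<noteq> 0" "sonic_gap (- 1) (V x) (C x) \<noteq> 0"
  shows "ode V C x"
proof -
  let ?G = "sim_G lam ell (V x) (C x)" and ?F = "sim_F lam ell (V x) (C x)" and ?D = "sim_D (V x) (C x)"
  have D: "?D = sonic_gap 1 (V x) (C x) * sonic_gap (- 1) (V x) (C x)" by (rule sim_D_eq)
  then have D0: "?D \<noteq> 0" using nz by simp
  have 1: "riemann_rate 1 (V x) (C x) / sonic_gap 1 (V x) (C x) = (?G + ell * ?F) / ?D"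
    using numerators_riemann[of 1 "V x" "C x"] nz unfolding D by simp
  have 2: "riemann_rate (- 1) (V x) (C x) / sonic_gap (- 1) (V x) (C x) = (?G - ell * ?F) / ?D"
    using numerators_riemann[of "- 1" "V x" "C x"] nz unfolding D by simp
  note d = dP[unfolded 1] dQ[unfolded 2]
  have V: "V = (\<lambda>x. (riemann_inv ell 1 (V x) (C x) + riemann_inv ell (- 1) (V x) (C x)) / 2)"
    by (simp add: riemann_inv_def)
  have C: "C = (\<lambda>x. (riemann_inv ell 1 (V x) (C x) - riemann_inv ell (- 1) (V x) (C x)) / (2 * ell))"
    using ell_gt by (simp add: riemann_inv_def)
  have "(V has_real_derivative ((?G + ell * ?F) / ?D / x + (?G - ell * ?F) / ?D / x) / 2) (at x)"
    by (subst V) (intro DERIV_cdivide DERIV_add d)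
  moreover have "((?G + ell * ?F) / ?D / x + (?G - ell * ?F) / ?D / x) / 2 = 1 / x * (?G / ?D)"
    by (simp add: add_divide_distrib diff_divide_distrib)
  moreover have "(C has_real_derivative ((?G + ell * ?F) / ?D / x - (?G - ell * ?F) / ?D / x) / (2 * ell)) (at x)"
    by (subst C) (intro DERIV_cdivide DERIV_diff d)
  moreover have "((?G + ell * ?F) / ?D / x - (?G - ell * ?F) / ?D / x) / (2 * ell) = 1 / x * (?F / ?D)"
    using ell_gt by (simp add: add_divide_distrib diff_divide_distrib)
  ultimately show ?thesis using D0 by (simp add: solves_similarity_ode_def)
qed

text \<open>
  The chain rule for \<open>R = a z r(z)\<close> with \<open>z = x\<^sup>a\<close>.
\<close>

lemma similarity_variable_deriv:
  assumes x: "x > 0" and a: "a = - lam"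
    and z: "z = x powr a"
    and dr: "(r has_real_derivative - (1 + a) * char_speed a z p * r z) (at z)"
    and p: "1 + a * z * p > 0"
  shows "((\<lambda>x. a * x powr a * r (x powr a)) has_real_derivative
     (a * z * r z) * (- lam - a * z * p) / (1 + a * z * p) / x) (at x)"
proof -
  note dz = DERIV_powr_quotient[OF x, of a]
  have "((\<lambda>x. r (x powr a)) has_real_derivative (- (1 + a) * char_speed a z p * r z) * (a * x powr a / x)) (at x)"
    by (rule DERIV_chain2[OF _ dz]) (use dr z in simp)
  from DERIV_mult[OF DERIV_cmult[OF dz, of a] this]
  show ?thesis
  proof (rule DERIV_cong)
    have "a * (a * z / x) * r z + (- (1 + a) * char_speed a z p * r z) * (a * z / x) * (a * z)
      = a * z * r z * (a - a * z * p) / (1 + a * z * p) / x"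
      using p x by (simp add: char_speed_def divide_simps) (simp add: algebra_simps)
    then show "a * (a * x powr a / x) * r (x powr a) + (- (1 + a) * char_speed a z p * r z) * (a * x powr a / x) * (a * x powr a)
      = a * z * r z * (- lam - a * z * p) / (1 + a * z * p) / x"
      unfolding z a by simp
  qed
qed

text \<open>
  \<open>V = a z v(z)\<close> and \<open>C = a z k(z)\<close> with \<open>z = \<xi>\<^sup>a\<close>; as \<open>\<xi>\<^sup>\<lambda> z = 1\<close>, the limits at 0 are those of \<open>v\<close> and
  \<open>k\<close>.
\<close>

lemma profile_of_flow:
  assumes flow: "riemann_flow (- lam) ell Z r s"
    and init: "r 0 = u_plus + ell * c_plus" "s 0 = u_plus - ell * c_plus"
    and X: "X > 0" and XZ: "\<And>\<xi>. \<xi> > 0 \<Longrightarrow> ereal \<xi> < X \<Longrightarrow> ereal (\<xi> powr (- lam)) < Z"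
  shows "similarity_profile lam ell gam u_plus c_plus X {}
     (\<lambda>\<xi>. - lam * \<xi> powr (- lam) * ((r (\<xi> powr (- lam)) + s (\<xi> powr (- lam))) / 2))
     (\<lambda>\<xi>. - lam * \<xi> powr (- lam) * ((r (\<xi> powr (- lam)) - s (\<xi> powr (- lam))) / (2 * ell)))"
    (is "similarity_profile _ _ _ _ _ _ _ ?V ?C")
proof -
  define a where "a = - lam"
  have a: "a > 0" using lam_neg by (simp add: a_def)
  define V C where "V = ?V" and "C = ?C"
  have inv1: "riemann_inv ell 1 (V x) (C x) = a * x powr a * r (x powr a)" for x
    using ell_gt by (simp add: riemann_inv_def V_def C_def a_def field_simps)
  have inv2: "riemann_inv ell (- 1) (V x) (C x) = a * x powr a * s (x powr a)" for x
    using ell_gt by (simp add: riemann_inv_def V_def C_def a_def field_simps)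
  have vel1: "V x + C x = a * x powr a * char_vel ell (r (x powr a)) (s (x powr a))" for x
    using ell_gt by (simp add: V_def C_def a_def char_vel_def field_simps)
  have vel2: "V x - C x = a * x powr a * char_vel ell (s (x powr a)) (r (x powr a))" for x
    using ell_gt by (simp add: V_def C_def a_def char_vel_def field_simps)
  have sol: "ode V C x \<and> C x \<ge> 0" if x: "x > 0" "ereal x < X" for x
  proof
    define z where "z = x powr a"
    have z: "z > 0" "ereal z < Z" using x XZ[OF x] by (auto simp: z_def a_def)
    note f = flow[unfolded riemann_flow_def, folded a_def]
    have dr: "(r has_real_derivative - (1 + a) * char_speed a z (char_vel ell (r z) (s z)) * r z) (at z)"
      and ds: "(s has_real_derivative - (1 + a) * char_speed a z (char_vel ell (s z) (r z)) * s z) (at z)"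
      and p: "1 + a * z * char_vel ell (r z) (s z) > 0" "1 + a * z * char_vel ell (s z) (r z) > 0"
      and rs: "s z < r z"
      using f z by auto
    have g: "sonic_gap 1 (V x) (C x) = 1 + a * z * char_vel ell (r z) (s z)"
      "sonic_gap (- 1) (V x) (C x) = 1 + a * z * char_vel ell (s z) (r z)"
      using vel1[of x] vel2[of x] by (simp_all add: sonic_gap_def z_def)
    show "ode V C x"
    proof (rule ode_of_riemann_derivs)
      have "- lam - V x - 1 * C x = - lam - a * z * char_vel ell (r z) (s z)"
        using vel1[of x] unfolding z_def by linarith
      then have "riemann_rate 1 (V x) (C x) = (a * z * r z) * (- lam - a * z * char_vel ell (r z) (s z))"
        unfolding riemann_rate_def inv1 by (simp add: z_def)
      then show "((\<lambda>x. riemann_inv ell 1 (V x) (C x)) has_real_derivative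
           riemann_rate 1 (V x) (C x) / sonic_gap 1 (V x) (C x) / x) (at x)"
        unfolding inv1 g using similarity_variable_deriv[OF x(1) a_def z_def dr p(1)] by simp
      have "- lam - V x - (- 1) * C x = - lam - a * z * char_vel ell (s z) (r z)"
        using vel2[of x] unfolding z_def by linarith
      then have "riemann_rate (- 1) (V x) (C x) = (a * z * s z) * (- lam - a * z * char_vel ell (s z) (r z))"
        unfolding riemann_rate_def inv2 by (simp add: z_def)
      then show "((\<lambda>x. riemann_inv ell (- 1) (V x) (C x)) has_real_derivative
           riemann_rate (- 1) (V x) (C x) / sonic_gap (- 1) (V x) (C x) / x) (at x)"
        unfolding inv2 g using similarity_variable_deriv[OF x(1) a_def z_def ds p(2)] by simp
    qed (use p g in auto)
    show "C x \<ge> 0" using rs a ell_gt unfolding C_def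
      by (intro mult_nonneg_nonneg divide_nonneg_nonneg) (auto simp: a_def z_def)
  qed
  have pz: "((\<lambda>x. x powr a) \<longlongrightarrow> 0) (at_right 0)"
    using a by (auto intro!: tendsto_eq_intros simp: eventually_at_right_less eventually_at_filter)
  have pos: "eventually (\<lambda>x. x powr a \<in> {0..}) (at_right (0::real))" by simp
  have lr: "((\<lambda>x. r (x powr a)) \<longlongrightarrow> r 0) (at_right 0)" "((\<lambda>x. s (x powr a)) \<longlongrightarrow> s 0) (at_right 0)"
    using flow unfolding riemann_flow_def
    by (auto intro!: continuous_on_tendsto_compose[OF _ pz _ pos])
  have lv: "((\<lambda>x. (r (x powr a) + s (x powr a)) / 2) \<longlongrightarrow> u_plus) (at_right 0)"
    by (rule tendsto_eq_rhs[OF tendsto_divide[OF tendsto_add[OF lr] tendsto_const]]) (auto simp: init)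
  have lc: "((\<lambda>x. (r (x powr a) - s (x powr a)) / (2 * ell)) \<longlongrightarrow> c_plus) (at_right 0)"
    by (rule tendsto_eq_rhs[OF tendsto_divide[OF tendsto_diff[OF lr] tendsto_const]])
      (use ell_gt in \<open>auto simp: init\<close>)
  have scaled: "((\<lambda>x. x powr lam * (a * x powr a * g x)) \<longlongrightarrow> a * l) (at_right 0)"
    if "(g \<longlongrightarrow> l) (at_right 0)" for g l
  proof (rule Lim_transform_eventually[OF tendsto_mult[OF tendsto_const that, of a]])
    show "eventually (\<lambda>x. a * g x = x powr lam * (a * x powr a * g x)) (at_right 0)"
      using eventually_at_right_less[of "0::real"]
    proof eventually_elim
      case (elim x)
      have "x powr lam * x powr a = 1" using elim by (simp add: a_def powr_add[symmetric])
      then show ?case by (simp add: mult_ac)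
    qed
  qed
  have zero: "((\<lambda>x. a * x powr a * g x) \<longlongrightarrow> 0) (at_right 0)" if "(g \<longlongrightarrow> l) (at_right 0)" for g l
    by (rule tendsto_eq_rhs[OF tendsto_mult[OF tendsto_mult[OF tendsto_const pz] that]]) simp
  show ?thesis
    unfolding V_def[symmetric] C_def[symmetric] similarity_profile_def
    using X sol zero[OF lv] zero[OF lc] scaled[OF lv] scaled[OF lc]
    by (auto simp: V_def C_def a_def)
qed

text \<open>
  The derivatives in \<open>t\<close> and \<open>x\<close> of \<open>x\<^sup>1\<^sup>+\<^sup>a r(t x\<^sup>a)\<close>, the form of both Riemann invariants of the flow.
\<close>

lemma transported_wave:
  fixes r :: "real \<Rightarrow> real"
  assumes a: "a = - lam" and x: "x > 0" and z: "z = t * x powr a"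
    and dr: "(r has_real_derivative D) (at z)"
  shows "((\<lambda>\<tau>. x powr (1 + a) * r (\<tau> * x powr a)) has_real_derivative x powr (1 + a) * (D * x powr a)) (at t)"
    and "((\<lambda>y. y powr (1 + a) * r (t * y powr a)) has_real_derivative x powr a * ((1 + a) * r z + a * z * D)) (at x)"
proof -
  have "((\<lambda>\<tau>. r (\<tau> * x powr a)) has_real_derivative D * (1 * x powr a)) (at t)"
    by (rule DERIV_chain2[where g = "\<lambda>\<tau>. \<tau> * x powr a"], use dr z in simp)
      (intro DERIV_cmult_right DERIV_ident)
  from DERIV_cmult[OF this, of "x powr (1 + a)"]
  show "((\<lambda>\<tau>. x powr (1 + a) * r (\<tau> * x powr a)) has_real_derivative x powr (1 + a) * (D * x powr a)) (at t)"
    by simp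
  have dp: "((\<lambda>y. r (t * y powr a)) has_real_derivative D * (t * (a * x powr a / x))) (at x)"
    by (rule DERIV_chain2[where g = "\<lambda>y. t * y powr a"], use dr z in simp)
      (intro DERIV_cmult DERIV_powr_quotient x)
  have px: "x powr (1 + a) = x * x powr a" using x by (simp add: powr_add)
  show "((\<lambda>y. y powr (1 + a) * r (t * y powr a)) has_real_derivative x powr a * ((1 + a) * r z + a * z * D)) (at x)"
    by (rule DERIV_cong[OF DERIV_mult[OF DERIV_powr_quotient[OF x] dp]])
      (use x in \<open>simp add: px z field_simps\<close>)
qed

end

context similarity_params
begin

lemma local_profile_exists:
  assumes c: "c_plus > 0"
  shows "\<exists>X V C. similarity_profile lam ell gam u_plus c_plus X {} V C"
proof -
  have "u_plus - ell * c_plus < u_plus + ell * c_plus" using c ell_gt by simp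
  then obtain r s Z where Z: "Z > 0" and init: "r 0 = u_plus + ell * c_plus" "s 0 = u_plus - ell * c_plus"
    and flow: "riemann_flow (- lam) ell (ereal Z) r s"
    using local_flow_exists[of "- lam" ell] lam_neg ell_gt by (metis neg_0_less_iff_less)
  have XZ: "ereal (\<xi> powr (- lam)) < ereal Z" if "\<xi> > 0" "ereal \<xi> < ereal (Z powr (- 1 / lam))" for \<xi>
  proof -
    have "\<xi> powr (- lam) < (Z powr (- 1 / lam)) powr (- lam)"
      using that lam_neg by (intro powr_less_mono2) auto
    also have "\<dots> = Z" using Z lam_neg by (simp add: powr_powr)
    finally show ?thesis by simp
  qed
  have "ereal (Z powr (- 1 / lam)) > 0" using Z by simp
  from profile_of_flow[OF flow init this XZ] show ?thesis by blast
qed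

end

section \<open>The rarefying Euler flow\<close>

context similarity_params
begin

text \<open>
  The flow is \<open>u = x\<^sup>1\<^sup>+\<^sup>a v(t x\<^sup>a)\<close>, \<open>c = x\<^sup>1\<^sup>+\<^sup>a k(t x\<^sup>a)\<close>. The values \<open>v(0) = u\<^sub>+\<close> and \<open>k(0) = c\<^sub>+\<close> govern both
  \<open>t \<down> 0\<close> at fixed \<open>x\<close>, which is the initial condition, and \<open>x \<down> 0\<close> at fixed \<open>t\<close>, which is the
  behaviour at the vacuum interface.
\<close>

lemma global_rarefaction:
  assumes c: "c_plus > 0" and Ma: "u_plus \<ge> ell * c_plus"
  shows "\<exists>u c. self_similar_solution lam ell gam u_plus c_plus \<infinity> u c \<and>
                   classical_euler_solution ell (fluid_region c) u c \<and>
                   attains_power_data lam u_plus c_plus u c \<and>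
                   shock_free u c \<and>
                   stationary_vacuum_interface u c \<and>
                   (\<forall>t\<ge>0. c t \<sim>[at_right 0] (\<lambda>x. c_plus * x powr (1 - lam)))"
proof -
  define a where "a = - lam"
  have a: "a > 0" and lam: "lam = - a" using lam_neg by (simp_all add: a_def)
  have "u_plus - ell * c_plus < u_plus + ell * c_plus" "0 \<le> u_plus - ell * c_plus"
    using c Ma ell_gt by auto
  from rarefying_flow_exists[OF a ell_gt this]
  obtain r s where init: "r 0 = u_plus + ell * c_plus" "s 0 = u_plus - ell * c_plus"
    and flow: "riemann_flow a ell \<infinity> r s" by blast
  define v k where "v z = (r z + s z) / 2" and "k z = (r z - s z) / (2 * ell)" for z
  define u where "u t x = (if x > 0 then x powr (1 + a) * v (t * x powr a) else 0)" for t x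
  define cc where "cc t x = (if x > 0 then x powr (1 + a) * k (t * x powr a) else 0)" for t x
  have cont_rs: "continuous_on {0..} r" "continuous_on {0..} s" using flow by (auto simp: riemann_flow_def)
  have v0: "v 0 = u_plus" and k0: "k 0 = c_plus" using ell_gt by (simp_all add: v_def k_def init)
  have cv: "continuous_on {0..} v" and ck: "continuous_on {0..} k"
    unfolding v_def k_def using ell_gt by (auto intro!: continuous_intros cont_rs)
  define p where "p z = char_vel ell (r z) (s z)" for z
  define q where "q z = char_vel ell (s z) (r z)" for z
  define r' where "r' z = - (1 + a) * char_speed a z (p z) * r z" for z
  define s' where "s' z = - (1 + a) * char_speed a z (q z) * s z" for z
  have dr: "(r has_real_derivative r' z) (at z)" and ds: "(s has_real_derivative s' z) (at z)"
    and pz: "1 + a * z * p z > 0" "1 + a * z * q z > 0" and sr: "s z < r z" if "z > 0" for z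
    using flow that unfolding riemann_flow_def p_def q_def r'_def s'_def by auto
  have pv: "p z = v z + k z" "q z = v z - k z" for z
    using ell_gt by (simp_all add: p_def q_def v_def k_def char_vel_def field_simps)
  have k_pos: "k z > 0" if "z \<ge> 0" for z
    using sr[of z] k0 c ell_gt that by (cases "z = 0") (auto simp: k_def)
  have c0: "continuous_on {0<..} r" "continuous_on {0<..} s"
    using cont_rs by (auto intro: continuous_on_subset)
  have cpq: "continuous_on {0<..} p" "continuous_on {0<..} q"
    unfolding p_def[abs_def] q_def[abs_def] char_vel_def
    by (intro continuous_intros c0; use ell_gt in simp)+
  have pq_nz: "1 + a * z * p z \<noteq> 0" "1 + a * z * q z \<noteq> 0" if "z \<in> {0<..}" for z
    using pz[of z] that by auto
  have cont': "continuous_on {0<..} r'" "continuous_on {0<..} s'"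
    unfolding r'_def[abs_def] s'_def[abs_def] char_speed_def
    by (intro continuous_intros c0 cpq ballI pq_nz; assumption)+
  have region: "fluid_region cc = {0<..} \<times> {0<..}"
    using k_pos by (auto simp: fluid_region_def cc_def split: if_splits)

  have prof: "similarity_profile lam ell gam u_plus c_plus \<infinity> {}
     (\<lambda>\<xi>. - lam * \<xi> powr (- lam) * ((r (\<xi> powr (- lam)) + s (\<xi> powr (- lam))) / 2))
     (\<lambda>\<xi>. - lam * \<xi> powr (- lam) * ((r (\<xi> powr (- lam)) - s (\<xi> powr (- lam))) / (2 * ell)))"
    by (rule profile_of_flow[where Z = \<infinity>]) (use flow init in \<open>auto simp: a_def\<close>)
  have lift: "(\<forall>(t, x) \<in> sim_region lam \<infinity>.
       u t x = - (1 / lam) * (x / t) * (- lam * sim_var lam t x powr (- lam) * ((r (sim_var lam t x powr (- lam)) + s (sim_var lam t x powr (- lam))) / 2)) \<and>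
       cc t x = - (1 / lam) * (x / t) * (- lam * sim_var lam t x powr (- lam) * ((r (sim_var lam t x powr (- lam)) - s (sim_var lam t x powr (- lam))) / (2 * ell))))"
  proof (clarify, goal_cases)
    case (1 t x)
    then have tx: "t > 0" "x > 0" by (auto simp: sim_region_def)
    have z: "sim_var lam t x powr (- lam) = t * x powr a"
      using tx a by (simp add: sim_var_def lam powr_mult powr_powr)
    have px: "x powr (1 + a) = x * x powr a" using tx by (simp add: powr_add)
    show ?case unfolding z using tx a ell_gt
      by (simp add: u_def cc_def v_def k_def lam px field_simps)
  qed
  have sss: "self_similar_solution lam ell gam u_plus c_plus \<infinity> u cc"
    unfolding self_similar_solution_def by (rule exI, rule exI, rule exI, rule conjI[OF prof lift])

  have euler: "classical_euler_solution ell (fluid_region cc) u cc"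
  proof -
    let ?R = "\<lambda>w t x. x powr (1 + a) * w (t * x powr a)"
    define Rt where "Rt w' t x = x powr (1 + a) * (w' (t * x powr a) * x powr a)" for w' :: "real \<Rightarrow> real" and t x
    define Rx where "Rx w w' t x = x powr a * ((1 + a) * w (t * x powr a) + a * (t * x powr a) * w' (t * x powr a))"
      for w w' :: "real \<Rightarrow> real" and t x
    have cz: "continuous_on ({0<..} \<times> {0<..}) (\<lambda>(t, x). w (t * x powr a))"
      if "continuous_on {0<..} w" for w :: "real \<Rightarrow> real"
      unfolding case_prod_beta
      by (rule continuous_on_compose2[OF that]) (auto intro!: continuous_intros)
    have cRt: "continuous_on ({0<..} \<times> {0<..}) (\<lambda>(t, x). Rt w t x)"
      if "continuous_on {0<..} w" for w :: "real \<Rightarrow> real"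
      using cz[OF that] unfolding Rt_def case_prod_beta by (intro continuous_intros) auto
    have cRx: "continuous_on ({0<..} \<times> {0<..}) (\<lambda>(t, x). Rx w w' t x)"
      if "continuous_on {0<..} w" "continuous_on {0<..} w'" for w w' :: "real \<Rightarrow> real"
      using cz[OF that(1)] cz[OF that(2)] unfolding Rx_def case_prod_beta by (intro continuous_intros) auto
    note cs = cRt[OF cont'(1)] cRt[OF cont'(2)] cRx[OF c0(1) cont'(1)] cRx[OF c0(2) cont'(2)]
    have main: "((\<lambda>\<tau>. u \<tau> x) has_real_derivative (Rt r' t x + Rt s' t x) / 2) (at t) \<and>
           ((\<lambda>y. u t y) has_real_derivative (Rx r r' t x + Rx s s' t x) / 2) (at x) \<and>
           ((\<lambda>\<tau>. cc \<tau> x) has_real_derivative (Rt r' t x - Rt s' t x) / (2 * ell)) (at t) \<and>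
           ((\<lambda>y. cc t y) has_real_derivative (Rx r r' t x - Rx s s' t x) / (2 * ell)) (at x) \<and>
           (Rt r' t x + Rt s' t x) / 2 + u t x * ((Rx r r' t x + Rx s s' t x) / 2)
             + ell * cc t x * ((Rx r r' t x - Rx s s' t x) / (2 * ell)) = 0 \<and>
           (Rt r' t x - Rt s' t x) / (2 * ell) + u t x * ((Rx r r' t x - Rx s s' t x) / (2 * ell))
             + inverse ell * cc t x * ((Rx r r' t x + Rx s s' t x) / 2) = 0"
      if t: "t > 0" and x: "x > 0" for t x
    proof -
      define z where "z = t * x powr a"
      have z: "z > 0" using t x by (simp add: z_def)
      note wr = transported_wave[OF a_def x z_def dr[OF z], folded Rt_def] and
        ws = transported_wave[OF a_def x z_def ds[OF z], folded Rt_def]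
      have dRt: "((\<lambda>\<tau>. ?R r \<tau> x) has_real_derivative Rt r' t x) (at t)" "((\<lambda>\<tau>. ?R s \<tau> x) has_real_derivative Rt s' t x) (at t)"
        using wr(1) ws(1) by (simp_all add: Rt_def z_def)
      have dRx: "((\<lambda>y. ?R r t y) has_real_derivative Rx r r' t x) (at x)" "((\<lambda>y. ?R s t y) has_real_derivative Rx s s' t x) (at x)"
        using wr(2) ws(2) by (simp_all add: Rx_def z_def)
      have u1: "(\<lambda>\<tau>. u \<tau> x) = (\<lambda>\<tau>. (?R r \<tau> x + ?R s \<tau> x) / 2)" and c1: "(\<lambda>\<tau>. cc \<tau> x) = (\<lambda>\<tau>. (?R r \<tau> x - ?R s \<tau> x) / (2 * ell))"
        using x by (auto simp: fun_eq_iff u_def cc_def v_def k_def algebra_simps diff_divide_distrib)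
      have ev: "eventually (\<lambda>y. y > 0) (nhds x)"
        using eventually_nhds_in_open[of "{0<..}" x] x by simp
      have u2: "((\<lambda>y. u t y) has_real_derivative D) (at x) \<longleftrightarrow> ((\<lambda>y. (?R r t y + ?R s t y) / 2) has_real_derivative D) (at x)" for D
        by (rule DERIV_cong_ev[OF refl _ refl], rule eventually_mono[OF ev])
          (auto simp: u_def v_def algebra_simps)
      have c2: "((\<lambda>y. cc t y) has_real_derivative D) (at x) \<longleftrightarrow> ((\<lambda>y. (?R r t y - ?R s t y) / (2 * ell)) has_real_derivative D) (at x)" for D
        by (rule DERIV_cong_ev[OF refl _ refl], rule eventually_mono[OF ev])
          (auto simp: cc_def k_def algebra_simps diff_divide_distrib)
      define m where "m = x powr a"
      have px: "x powr (1 + a) = x * m" using x by (simp add: powr_add m_def)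
      have vals: "Rt w t x = x * m * (w z * m)" "Rx w w' t x = m * ((1 + a) * w z + a * z * w' z)"
        "u t x = x * m * v z" "cc t x = x * m * k z" for w w'
        using x by (simp_all only: Rt_def Rx_def u_def cc_def px z_def m_def if_True)
      have r'eq: "r' z * (1 + a * z * p z) = - (1 + a) * p z * r z"
        using pz(1)[OF z] by (simp add: r'_def char_speed_def)
      have s'eq: "s' z * (1 + a * z * q z) = - (1 + a) * q z * s z"
        using pz(2)[OF z] by (simp add: s'_def char_speed_def)
      \<comment> \<open>The Riemann invariants are transported with the speeds \<open>u + c\<close> and \<open>u - c\<close>; the Euler equations are
        half the sum and \<open>1 / (2 * ell)\<close> times the difference of the two transport equations.\<close>
      have Rr: "Rt r' t x + (u t x + cc t x) * Rx r r' t x = 0"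
      proof -
        have "Rt r' t x + (u t x + cc t x) * Rx r r' t x
          = x * m * m * (r' z * (1 + a * z * p z) + (1 + a) * p z * r z)"
          unfolding vals pv by (simp add: algebra_simps)
        then show ?thesis unfolding r'eq by (simp add: algebra_simps)
      qed
      have Rs: "Rt s' t x + (u t x - cc t x) * Rx s s' t x = 0"
      proof -
        have "Rt s' t x + (u t x - cc t x) * Rx s s' t x
          = x * m * m * (s' z * (1 + a * z * q z) + (1 + a) * q z * s z)"
          unfolding vals pv by (simp add: algebra_simps)
        then show ?thesis unfolding s'eq by (simp add: algebra_simps)
      qed
      have "(Rt r' t x + Rt s' t x) / 2 + u t x * ((Rx r r' t x + Rx s s' t x) / 2)
             + ell * cc t x * ((Rx r r' t x - Rx s s' t x) / (2 * ell))
          = ((Rt r' t x + (u t x + cc t x) * Rx r r' t x) + (Rt s' t x + (u t x - cc t x) * Rx s s' t x)) / 2"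
        using ell_gt by (simp add: field_simps)
      moreover have "(Rt r' t x - Rt s' t x) / (2 * ell) + u t x * ((Rx r r' t x - Rx s s' t x) / (2 * ell))
             + inverse ell * cc t x * ((Rx r r' t x + Rx s s' t x) / 2)
          = ((Rt r' t x + (u t x + cc t x) * Rx r r' t x) - (Rt s' t x + (u t x - cc t x) * Rx s s' t x)) / (2 * ell)"
        using ell_gt by (simp add: field_simps)
      ultimately show ?thesis
        unfolding u1 c1 u2 c2 Rr Rs
        by (intro conjI DERIV_cdivide DERIV_add DERIV_diff dRt dRx) simp_all
    qed
    have ct: "continuous_on ({0<..} \<times> {0<..}) (\<lambda>(t, x). (Rt r' t x + Rt s' t x) / 2)"
      "continuous_on ({0<..} \<times> {0<..}) (\<lambda>(t, x). (Rx r r' t x + Rx s s' t x) / 2)"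
      "continuous_on ({0<..} \<times> {0<..}) (\<lambda>(t, x). (Rt r' t x - Rt s' t x) / (2 * ell))"
      "continuous_on ({0<..} \<times> {0<..}) (\<lambda>(t, x). (Rx r r' t x - Rx s s' t x) / (2 * ell))"
      unfolding case_prod_beta
      by (intro continuous_on_divide continuous_on_add continuous_on_diff continuous_on_const
          cs[unfolded case_prod_beta]; use ell_gt in simp)+
    show ?thesis unfolding classical_euler_solution_def region
    proof (rule exI[of _ "\<lambda>t x. (Rt r' t x + Rt s' t x) / 2"], rule exI[of _ "\<lambda>t x. (Rx r r' t x + Rx s s' t x) / 2"],
          rule exI[of _ "\<lambda>t x. (Rt r' t x - Rt s' t x) / (2 * ell)"], rule exI[of _ "\<lambda>t x. (Rx r r' t x - Rx s s' t x) / (2 * ell)"],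
          intro conjI ct ballI, goal_cases)
      case (1 tx)
      then obtain t x where tx: "tx = (t, x)" "t > 0" "x > 0" by (cases tx) simp
      show ?case unfolding tx(1) prod.case by (rule main[OF tx(2,3)])
    qed
  qed

  have k_lim: "((\<lambda>y. k (g y)) \<longlongrightarrow> c_plus) F" and v_lim: "((\<lambda>y. v (g y)) \<longlongrightarrow> u_plus) F"
    if "(g \<longlongrightarrow> 0) F" "eventually (\<lambda>y. g y \<ge> 0) F" for g :: "real \<Rightarrow> real" and F
    using continuous_on_tendsto_compose[OF ck that(1)] continuous_on_tendsto_compose[OF cv that(1)] that(2)
    by (auto simp: k0 v0)
  have in_t: "((\<lambda>t. t * x powr a) \<longlongrightarrow> 0) (at_right 0)" "eventually (\<lambda>t. t * x powr a \<ge> 0) (at_right 0)" for x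
    by (auto intro!: tendsto_eq_intros eventually_mono[OF eventually_at_right_less])
  have pa: "((\<lambda>x::real. x powr b) \<longlongrightarrow> 0) (at_right 0)" if "b > 0" for b
    using that by (auto intro!: tendsto_eq_intros simp: eventually_at_filter)
  have in_x: "((\<lambda>x. t * x powr a) \<longlongrightarrow> 0) (at_right 0)" "eventually (\<lambda>x. t * x powr a \<ge> 0) (at_right 0)" if "t \<ge> 0" for t
    using that tendsto_mult_right_zero[OF pa[OF a], of t] by auto
  have data: "attains_power_data lam u_plus c_plus u cc"
    unfolding attains_power_data_def
  proof (intro conjI allI impI)
    fix x :: real assume x: "x > 0"
    show u0: "u 0 x = u_plus * x powr (1 - lam)" and c0: "cc 0 x = c_plus * x powr (1 - lam)"
      using x by (simp_all add: u_def cc_def v0 k0 lam)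
    have "((\<lambda>t. x powr (1 + a) * v (t * x powr a)) \<longlongrightarrow> x powr (1 + a) * u_plus) (at_right 0)"
      "((\<lambda>t. x powr (1 + a) * k (t * x powr a)) \<longlongrightarrow> x powr (1 + a) * c_plus) (at_right 0)"
      by (rule tendsto_mult[OF tendsto_const v_lim[OF in_t]], rule tendsto_mult[OF tendsto_const k_lim[OF in_t]])
    then show "((\<lambda>t. u t x) \<longlongrightarrow> u 0 x) (at_right 0)" "((\<lambda>t. cc t x) \<longlongrightarrow> cc 0 x) (at_right 0)"
      unfolding u0 c0 using x by (simp_all add: u_def cc_def lam mult.commute)
  qed (simp add: cc_def)
  have sf: "shock_free u cc"
  proof -
    have wave: "continuous_on ({0<..} \<times> {0<..}) (\<lambda>tx. snd tx powr (1 + a) * w (fst tx * snd tx powr a))"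
      if "continuous_on {0..} w" for w :: "real \<Rightarrow> real"
    proof -
      have "continuous_on ({0<..} \<times> {0<..}) (\<lambda>tx::real \<times> real. fst tx * snd tx powr a)"
        by (intro continuous_intros) auto
      then have "continuous_on ({0<..} \<times> {0<..}) (\<lambda>tx. w (fst tx * snd tx powr a))"
        by (rule continuous_on_compose2[OF that]) auto
      then show ?thesis by (intro continuous_intros) auto
    qed
    have "continuous_on ({0<..} \<times> {0<..}) (\<lambda>(t, x). u t x)"
      by (rule continuous_on_eq[OF wave[OF cv]]) (auto simp: u_def)
    moreover have "continuous_on ({0<..} \<times> {0<..}) (\<lambda>(t, x). cc t x)"
      by (rule continuous_on_eq[OF wave[OF ck]]) (auto simp: cc_def)
    ultimately show ?thesis by (simp add: shock_free_def region)
  qed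
  have at0: "eventually (\<lambda>x::real. x > 0) (at_right 0)" by (rule eventually_at_right_less)
  have vac: "stationary_vacuum_interface u cc"
    unfolding stationary_vacuum_interface_def
  proof (intro allI impI conjI)
    fix t :: real assume t: "t \<ge> 0"
    show "cc t x = 0" if "x \<le> 0" for x using that by (simp add: cc_def)
    show "cc t x > 0" if "x > 0" for x using that k_pos t by (simp add: cc_def)
    have "((\<lambda>x. x powr (1 + a) * v (t * x powr a)) \<longlongrightarrow> 0 * u_plus) (at_right 0)"
      using a by (intro tendsto_mult pa v_lim in_x t) auto
    then have "((\<lambda>x. x powr (1 + a) * v (t * x powr a)) \<longlongrightarrow> 0) (at_right 0)" by simp
    then show "(u t \<longlongrightarrow> 0) (at_right 0)"
      by (rule Lim_transform_eventually) (use at0 in \<open>eventually_elim, simp add: u_def\<close>)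
  qed
  have asy: "cc t \<sim>[at_right 0] (\<lambda>x. c_plus * x powr (1 - lam))" if t: "t \<ge> 0" for t
  proof (rule asymp_equivI')
    have "((\<lambda>x. k (t * x powr a) / c_plus) \<longlongrightarrow> c_plus / c_plus) (at_right 0)"
      using c by (intro tendsto_divide k_lim in_x t tendsto_const) auto
    then have "((\<lambda>x. k (t * x powr a) / c_plus) \<longlongrightarrow> 1) (at_right 0)" using c by simp
    then show "((\<lambda>x. cc t x / (c_plus * x powr (1 - lam))) \<longlongrightarrow> 1) (at_right 0)"
      by (rule Lim_transform_eventually) (use at0 in \<open>eventually_elim, simp add: cc_def lam\<close>)
  qed
  show ?thesis using sss euler data sf vac asy by blast
qed

end

section \<open>Maximal profiles\<close>

text \<open>
  All pointwise requirements on a profile depend on its germ only.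
\<close>

lemma local_conditions_cong:
  assumes eq: "eventually (\<lambda>y. V y = V' y \<and> C y = C' y) (nhds x)"
  shows "solves_similarity_ode lam ell V C x \<longleftrightarrow> solves_similarity_ode lam ell V' C' x"
    and "isCont V x \<longleftrightarrow> isCont V' x" and "isCont C x \<longleftrightarrow> isCont C' x"
    and "admissible_jump lam ell gam V C x \<longleftrightarrow> admissible_jump lam ell gam V' C' x"
proof -
  have V: "eventually (\<lambda>y. V y = V' y) (nhds x)" and C: "eventually (\<lambda>y. C y = C' y) (nhds x)"
    using eq by (auto elim: eventually_mono)
  have x: "V x = V' x" "C x = C' x" using eventually_nhds_x_imp_x[OF eq] by auto
  show "solves_similarity_ode lam ell V C x \<longleftrightarrow> solves_similarity_ode lam ell V' C' x"
    unfolding solves_similarity_ode_def x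
    by (simp add: DERIV_cong_ev[OF refl V refl] DERIV_cong_ev[OF refl C refl])
  show "isCont V x \<longleftrightarrow> isCont V' x" "isCont C x \<longleftrightarrow> isCont C' x"
    by (rule isCont_cong[OF V], rule isCont_cong[OF C])
  have side: "eventually (\<lambda>y. V y = V' y) (at x within S)" "eventually (\<lambda>y. C y = C' y) (at x within S)" for S
    using V C by (auto simp: eventually_at_filter elim: eventually_mono)
  show "admissible_jump lam ell gam V C x \<longleftrightarrow> admissible_jump lam ell gam V' C' x"
    unfolding admissible_jump_def tendsto_cong[OF side(1)] tendsto_cong[OF side(2)] ..
qed

text \<open>
  Profiles form a sheaf on initial segments. With the exceptional set chosen as the set of points where
  the equations fail, it is determined by \<open>(V, C)\<close>, so the pieces need not agree on it.
\<close>

lemma profile_glue: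
  assumes X: "X > 0"
    and loc: "\<And>b. b > 0 \<Longrightarrow> ereal b < X \<Longrightarrow> \<exists>X' E' V' C'. ereal b < X' \<and>
       similarity_profile lam ell gam u_plus c_plus X' E' V' C' \<and>
       (\<forall>\<xi>>0. ereal \<xi> < X' \<longrightarrow> V \<xi> = V' \<xi> \<and> C \<xi> = C' \<xi>)"
  shows "similarity_profile lam ell gam u_plus c_plus X
     {\<xi>. \<not> solves_similarity_ode lam ell V C \<xi>} V C"
proof -
  define E where "E = {\<xi>. \<not> solves_similarity_ode lam ell V C \<xi>}"
  have near: "eventually (\<lambda>y. V y = V' y \<and> C y = C' y) (nhds x)"
    if x: "x > 0" "ereal x < X'" and agree: "\<forall>\<xi>>0. ereal \<xi> < X' \<longrightarrow> V \<xi> = V' \<xi> \<and> C \<xi> = C' \<xi>" for x X' V' C'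
  proof -
    obtain b where "ereal x < ereal b" "ereal b < X'"
      using ereal_dense2[OF x(2)] by blast
    then have b: "x < b" "ereal b \<le> X'" by simp_all
    have "eventually (\<lambda>y. y \<in> {0<..<b}) (nhds x)" by (rule eventually_nhds_in_open) (use x b in auto)
    then show ?thesis
    proof eventually_elim
      case (elim y)
      then have "ereal y < ereal b" by simp
      then have "ereal y < X'" using b(2) by (rule less_le_trans)
      then show ?case using agree elim by auto
    qed
  qed
  have fin: "finite (E \<inter> {0<..b})" if b: "b > 0" "ereal b < X" for b
  proof -
    obtain X' E' V' C' where P: "ereal b < X'" "similarity_profile lam ell gam u_plus c_plus X' E' V' C'"
      "\<forall>\<xi>>0. ereal \<xi> < X' \<longrightarrow> V \<xi> = V' \<xi> \<and> C \<xi> = C' \<xi>" using loc[OF b] by blast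
    have "E \<inter> {0<..b} \<subseteq> E' \<inter> {0<..b}"
    proof
      fix x assume x: "x \<in> E \<inter> {0<..b}"
      then have "ereal x \<le> ereal b" by simp
      then have xX: "ereal x < X'" using P(1) by (rule le_less_trans)
      have "\<not> solves_similarity_ode lam ell V' C' x"
        using local_conditions_cong(1)[OF near[OF _ xX P(3)]] x by (auto simp: E_def)
      then show "x \<in> E' \<inter> {0<..b}" using P(2) x xX by (auto simp: similarity_profile_def)
    qed
    moreover have "finite (E' \<inter> {0<..b})" using P(1,2) b by (simp add: similarity_profile_def)
    ultimately show ?thesis by (rule finite_subset)
  qed
  have pt: "C x \<ge> 0 \<and> (x \<notin> E \<longrightarrow> solves_similarity_ode lam ell V C x) \<and>
        (x \<in> E \<longrightarrow> (isCont V x \<and> isCont C x) \<or> admissible_jump lam ell gam V C x)"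
    if x: "x > 0" "ereal x < X" for x
  proof -
    obtain X' E' V' C' where P: "ereal x < X'" "similarity_profile lam ell gam u_plus c_plus X' E' V' C'"
      "\<forall>\<xi>>0. ereal \<xi> < X' \<longrightarrow> V \<xi> = V' \<xi> \<and> C \<xi> = C' \<xi>" using loc[OF x] by blast
    note cong = local_conditions_cong[OF near[OF x(1) P(1,3)]]
    have "C x = C' x" using P x by auto
    then show ?thesis using P(1,2) x unfolding E_def mem_Collect_eq cong similarity_profile_def by auto
  qed
  obtain b where b: "b > 0" "ereal b < X" using X by (metis ereal_dense2 ereal_less(2) zero_ereal_def)
  obtain X' E' V' C' where P: "ereal b < X'" "similarity_profile lam ell gam u_plus c_plus X' E' V' C'"
    "\<forall>\<xi>>0. ereal \<xi> < X' \<longrightarrow> V \<xi> = V' \<xi> \<and> C \<xi> = C' \<xi>" using loc[OF b] by blast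
  have "eventually (\<lambda>y. V' y = V y \<and> C' y = C y) (at_right 0)"
    using eventually_at_right_real[OF b(1)]
  proof eventually_elim
    case (elim y)
    then have "ereal y < ereal b" by simp
    then have "ereal y < X'" using P(1) by (rule less_trans)
    then show ?case using P(3) elim by auto
  qed
  note at0 = this
  have trans: "((\<lambda>x. f x (V x) (C x)) \<longlongrightarrow> l) (at_right 0)" if "((\<lambda>x. f x (V' x) (C' x)) \<longlongrightarrow> l) (at_right 0)"
    for f :: "real \<Rightarrow> real \<Rightarrow> real \<Rightarrow> real" and l
    by (rule Lim_transform_eventually[OF that]) (use at0 in \<open>eventually_elim, simp\<close>)
  have lims: "(V' \<longlongrightarrow> 0) (at_right 0)" "(C' \<longlongrightarrow> 0) (at_right 0)"
     "((\<lambda>\<xi>. \<xi> powr lam * V' \<xi>) \<longlongrightarrow> - lam * u_plus) (at_right 0)"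
     "((\<lambda>\<xi>. \<xi> powr lam * C' \<xi>) \<longlongrightarrow> - lam * c_plus) (at_right 0)"
    using P(2) by (auto simp: similarity_profile_def)
  show ?thesis
    unfolding similarity_profile_def E_def[symmetric]
    using X fin pt trans[of "\<lambda>x v c. v", OF lims(1)] trans[of "\<lambda>x v c. c", OF lims(2)]
      trans[of "\<lambda>x v c. x powr lam * v", OF lims(3)] trans[of "\<lambda>x v c. x powr lam * c", OF lims(4)]
    by blast
qed

text \<open>
  Zorn's lemma for the graphs of profiles, ordered by inclusion; \<open>profile_glue\<close> shows that the union
  of a chain is again the graph of a profile.
\<close>

lemma maximal_profile_exists:
  assumes "similarity_profile lam ell gam u_plus c_plus X0 E0 V0 C0"
  shows "\<exists>X E V C. similarity_profile lam ell gam u_plus c_plus X E V C \<and>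
    (\<forall>X' E' V' C'. X < X' \<longrightarrow> similarity_profile lam ell gam u_plus c_plus X' E' V' C' \<longrightarrow>
       \<not> (\<forall>\<xi>>0. ereal \<xi> < X \<longrightarrow> V' \<xi> = V \<xi> \<and> C' \<xi> = C \<xi>))"
proof -
  define prof where "prof X V C \<longleftrightarrow> (\<exists>E. similarity_profile lam ell gam u_plus c_plus X E V C)" for X V C
  define G where "G X V C = {(\<xi>, V \<xi>, C \<xi>) | \<xi>. 0 < \<xi> \<and> ereal \<xi> < X}" for X :: ereal and V C :: "real \<Rightarrow> real"
  define \<A> where "\<A> = {G X V C | X V C. prof X V C}"
  have "\<exists>M\<in>\<A>. \<forall>N\<in>\<A>. M \<subseteq> N \<longrightarrow> N = M"
  proof (rule subset_Zorn_nonempty)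
    show "\<A> \<noteq> {}" using assms by (auto simp: \<A>_def prof_def)
    fix \<C> assume ne: "\<C> \<noteq> {}" and ch: "subset.chain \<A> \<C>"
    have "\<forall>g\<in>\<C>. g \<in> \<A>" using ch by (auto simp: subset_chain_def)
    then have "\<forall>g\<in>\<C>. \<exists>X V C. prof X V C \<and> g = G X V C" unfolding \<A>_def by blast
    from bchoice[OF this] obtain X where "\<forall>g\<in>\<C>. \<exists>V C. prof (X g) V C \<and> g = G (X g) V C" by (elim exE)
    from bchoice[OF this] obtain V where "\<forall>g\<in>\<C>. \<exists>C. prof (X g) (V g) C \<and> g = G (X g) (V g) C" by (elim exE)
    from bchoice[OF this] obtain C where "\<forall>g\<in>\<C>. prof (X g) (V g) (C g) \<and> g = G (X g) (V g) (C g)" by (elim exE)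
    then have XVC: "\<And>g. g \<in> \<C> \<Longrightarrow> prof (X g) (V g) (C g) \<and> g = G (X g) (V g) (C g)" by (rule bspec)
    have agree: "V g \<xi> = V h \<xi> \<and> C g \<xi> = C h \<xi>"
      if gh: "g \<in> \<C>" "h \<in> \<C>" "\<xi> > 0" "ereal \<xi> < X g" "ereal \<xi> < X h" for g h \<xi>
    proof -
      have m: "(\<xi>, V g \<xi>, C g \<xi>) \<in> g" "(\<xi>, V h \<xi>, C h \<xi>) \<in> h"
        using XVC[of g] XVC[of h] gh unfolding G_def by blast+
      have "g \<subseteq> h \<or> h \<subseteq> g" using ch gh by (auto simp: subset_chain_def)
      then have "(\<xi>, V g \<xi>, C g \<xi>) \<in> h \<or> (\<xi>, V h \<xi>, C h \<xi>) \<in> g" using m by blast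
      then have "(\<xi>, V g \<xi>, C g \<xi>) \<in> G (X h) (V h) (C h) \<or> (\<xi>, V h \<xi>, C h \<xi>) \<in> G (X g) (V g) (C g)"
        using XVC gh by metis
      then show ?thesis by (auto simp: G_def)
    qed
    define XX where "XX = (SUP g\<in>\<C>. X g)"
    define pick where "pick \<xi> = (SOME g. g \<in> \<C> \<and> ereal \<xi> < X g)" for \<xi>
    have pick: "pick \<xi> \<in> \<C> \<and> ereal \<xi> < X (pick \<xi>)" if "ereal \<xi> < XX" for \<xi>
      unfolding pick_def by (rule someI_ex) (use that in \<open>auto simp: XX_def less_SUP_iff\<close>)
    define VV where "VV \<xi> = V (pick \<xi>) \<xi>" for \<xi>
    define CC where "CC \<xi> = C (pick \<xi>) \<xi>" for \<xi>
    have XXg: "X g \<le> XX" if "g \<in> \<C>" for g unfolding XX_def using that by (rule SUP_upper)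
    have VV: "VV \<xi> = V g \<xi> \<and> CC \<xi> = C g \<xi>" if "g \<in> \<C>" "\<xi> > 0" "ereal \<xi> < X g" for g \<xi>
    proof -
      have "ereal \<xi> < XX" using XXg[OF that(1)] that(3) by simp
      then show ?thesis unfolding VV_def CC_def using agree[of "pick \<xi>" g \<xi>] pick that by blast
    qed
    have U: "\<Union>\<C> = G XX VV CC"
    proof (intro set_eqI iffI)
      fix p assume "p \<in> \<Union>\<C>"
      then obtain g where g: "g \<in> \<C>" "p \<in> g" by blast
      then have "p \<in> G (X g) (V g) (C g)" using XVC by metis
      then obtain \<xi> where "p = (\<xi>, V g \<xi>, C g \<xi>)" "\<xi> > 0" "ereal \<xi> < X g" by (auto simp: G_def)
      then show "p \<in> G XX VV CC" using VV[OF g(1)] XXg[OF g(1)] by (auto simp: G_def)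
    next
      fix p assume "p \<in> G XX VV CC"
      then obtain \<xi> where xi: "p = (\<xi>, VV \<xi>, CC \<xi>)" "\<xi> > 0" "ereal \<xi> < XX" by (auto simp: G_def)
      then have "p \<in> G (X (pick \<xi>)) (V (pick \<xi>)) (C (pick \<xi>))"
        using pick[OF xi(3)] by (auto simp: G_def VV_def CC_def)
      then have "p \<in> pick \<xi>" using XVC pick[OF xi(3)] by metis
      then show "p \<in> \<Union>\<C>" using pick[OF xi(3)] by blast
    qed
    obtain g where g: "g \<in> \<C>" using ne by blast
    have "0 < X g" using XVC[OF g] by (auto simp: prof_def similarity_profile_def)
    then have XX0: "0 < XX" using XXg[OF g] by simp
    have "prof XX VV CC"
      unfolding prof_def
    proof (rule exI, rule profile_glue[OF XX0])
      fix b :: real assume b: "b > 0" "ereal b < XX"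
      then obtain h where h: "h \<in> \<C>" "ereal b < X h" by (auto simp: XX_def less_SUP_iff)
      then show "\<exists>X' E' V' C'. ereal b < X' \<and>
         similarity_profile lam ell gam u_plus c_plus X' E' V' C' \<and>
         (\<forall>\<xi>>0. ereal \<xi> < X' \<longrightarrow> VV \<xi> = V' \<xi> \<and> CC \<xi> = C' \<xi>)"
        using XVC[OF h(1)] VV[OF h(1)] unfolding prof_def by blast
    qed
    then show "\<Union>\<C> \<in> \<A>" unfolding U \<A>_def by blast
  qed
  then obtain M where "M \<in> \<A>" and max: "\<And>N. N \<in> \<A> \<Longrightarrow> M \<subseteq> N \<Longrightarrow> N = M" by blast
  then obtain X V C where "M = G X V C" "prof X V C" unfolding \<A>_def by blast
  with max have M: "prof X V C" "\<And>N. N \<in> \<A> \<Longrightarrow> G X V C \<subseteq> N \<Longrightarrow> N = G X V C" by auto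
  obtain E where E: "similarity_profile lam ell gam u_plus c_plus X E V C" using M(1) by (auto simp: prof_def)
  have "False" if X': "X < X'" and P: "similarity_profile lam ell gam u_plus c_plus X' E' V' C'"
    and ext: "\<forall>\<xi>>0. ereal \<xi> < X \<longrightarrow> V' \<xi> = V \<xi> \<and> C' \<xi> = C \<xi>" for X' E' V' C'
  proof -
    have "G X V C \<subseteq> G X' V' C'"
    proof
      fix p assume "p \<in> G X V C"
      then obtain \<xi> where "p = (\<xi>, V \<xi>, C \<xi>)" "\<xi> > 0" "ereal \<xi> < X" by (auto simp: G_def)
      then show "p \<in> G X' V' C'" using ext X' by (force simp: G_def)
    qed
    moreover have "G X' V' C' \<in> \<A>" using P by (auto simp: \<A>_def prof_def)
    ultimately have eq: "G X' V' C' = G X V C" by (rule M(2)[rotated])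
    \<comment> \<open>The larger graph contains a point over \<open>b\<close>, which the smaller one does not.\<close>
    obtain b where b: "X < ereal b" "ereal b < X'" using ereal_dense2[OF X'] by blast
    have "X > 0" using E by (simp add: similarity_profile_def)
    then have "b > 0" using b(1) by (metis ereal_less(2) less_trans)
    then have "(b, V' b, C' b) \<in> G X' V' C'" using b by (auto simp: G_def)
    then have "ereal b < X" unfolding eq by (auto simp: G_def)
    then show False using b by simp
  qed
  then show ?thesis using E by blast
qed

text \<open>
  At \<open>t = 1\<close> one has \<open>\<xi> = x\<close>, so a flow determines its profile and extensions of flows are extensions of
  profiles.
\<close>

lemma maximal_solution_of_maximal_profile:
  assumes lam: "lam \<noteq> 0" and P: "similarity_profile lam ell gam u_plus c_plus X E V C"
    and max: "\<And>X' E' V' C'. X < X' \<Longrightarrow> similarity_profile lam ell gam u_plus c_plus X' E' V' C' \<Longrightarrow>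
       \<not> (\<forall>\<xi>>0. ereal \<xi> < X \<longrightarrow> V' \<xi> = V \<xi> \<and> C' \<xi> = C \<xi>)"
  shows "\<exists>u c. maximal_self_similar_solution lam ell gam u_plus c_plus X u c"
proof -
  define u where "u t x = - (1 / lam) * (x / t) * V (sim_var lam t x)" for t x
  define c where "c t x = - (1 / lam) * (x / t) * C (sim_var lam t x)" for t x
  have "self_similar_solution lam ell gam u_plus c_plus X u c"
    unfolding self_similar_solution_def using P by (auto simp: u_def c_def)
  moreover have False if X': "X < X'" and s: "self_similar_solution lam ell gam u_plus c_plus X' u' c'"
    and ext: "\<forall>(t, x) \<in> sim_region lam X. u' t x = u t x \<and> c' t x = c t x" for X' u' c'
  proof -
    obtain E' V' C' where P': "similarity_profile lam ell gam u_plus c_plus X' E' V' C'"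
      and uc: "\<forall>(t, x) \<in> sim_region lam X'. u' t x = - (1 / lam) * (x / t) * V' (sim_var lam t x) \<and>
           c' t x = - (1 / lam) * (x / t) * C' (sim_var lam t x)"
      using s unfolding self_similar_solution_def by blast
    have one: "sim_var lam 1 \<xi> = \<xi>" for \<xi> by (simp add: sim_var_def)
    have "V' \<xi> = V \<xi> \<and> C' \<xi> = C \<xi>" if xi: "\<xi> > 0" "ereal \<xi> < X" for \<xi>
    proof -
      have "(1, \<xi>) \<in> sim_region lam X" "(1, \<xi>) \<in> sim_region lam X'"
        using xi X' by (auto simp: sim_region_def one)
      then have "u' 1 \<xi> = u 1 \<xi>" "c' 1 \<xi> = c 1 \<xi>" "u' 1 \<xi> = - (1 / lam) * (\<xi> / 1) * V' \<xi>"
        "c' 1 \<xi> = - (1 / lam) * (\<xi> / 1) * C' \<xi>"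
        using ext uc by (auto simp: one)
      then show ?thesis using xi lam by (simp add: u_def c_def one)
    qed
    then show False using max[OF X' P'] by blast
  qed
  ultimately show ?thesis unfolding maximal_self_similar_solution_def by blast
qed

section \<open>Global existence and breakdown\<close>

theorem theorem11:
  fixes lam gam ell u_plus c_plus Ma :: real
  assumes "lam < 0" and "1 < gam" and "gam < 3"
    and "ell = 2 / (gam - 1)"
    and "c_plus > 0"
    and "Ma = u_plus / c_plus"
  shows "(Ma \<ge> ell \<longrightarrow>
            (\<exists>u c. self_similar_solution lam ell gam u_plus c_plus \<infinity> u c \<and>
                   classical_euler_solution ell (fluid_region c) u c \<and>
                   attains_power_data lam u_plus c_plus u c \<and>
                   shock_free u c \<and>
                   stationary_vacuum_interface u c \<and>
                   (\<forall>t\<ge>0. c t \<sim>[at_right 0] (\<lambda>x. c_plus * x powr (1 - lam)))))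
       \<and> (Ma < ell \<longrightarrow>
            (\<exists>\<xi>s u c. 0 < \<xi>s \<and>
                   maximal_self_similar_solution lam ell gam u_plus c_plus (ereal \<xi>s) u c) \<and>
            (\<forall>X u c. self_similar_solution lam ell gam u_plus c_plus X u c \<longrightarrow> X < \<infinity>))"
proof -
  have "ell > 1" unfolding assms(4) using assms(2,3) by simp
  then interpret similarity_params lam ell using assms(1) by unfold_locales
  show ?thesis
  proof (intro conjI impI)
    assume "Ma \<ge> ell"
    then have "u_plus \<ge> ell * c_plus" unfolding assms(6) using assms(5) by (simp add: pos_le_divide_eq)
    then show "\<exists>u c. self_similar_solution lam ell gam u_plus c_plus \<infinity> u c \<and>
                   classical_euler_solution ell (fluid_region c) u c \<and>
                   attains_power_data lam u_plus c_plus u c \<and>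
                   shock_free u c \<and>
                   stationary_vacuum_interface u c \<and>
                   (\<forall>t\<ge>0. c t \<sim>[at_right 0] (\<lambda>x. c_plus * x powr (1 - lam)))"
      by (rule global_rarefaction[OF assms(5)])
  next
    assume "Ma < ell"
    then have Ma: "u_plus < ell * c_plus" unfolding assms(6) using assms(5) by (simp add: pos_divide_less_eq)
    note none = no_global_self_similar_solution[OF Ma, of gam]
    obtain X0 V0 C0 where "similarity_profile lam ell gam u_plus c_plus X0 {} V0 C0"
      using local_profile_exists[OF assms(5), of gam u_plus] by (elim exE)
    from maximal_profile_exists[OF this]
    obtain X E V C where P: "similarity_profile lam ell gam u_plus c_plus X E V C"
      and max: "\<And>X' E' V' C'. X < X' \<Longrightarrow> similarity_profile lam ell gam u_plus c_plus X' E' V' C' \<Longrightarrow>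
       \<not> (\<forall>\<xi>>0. ereal \<xi> < X \<longrightarrow> V' \<xi> = V \<xi> \<and> C' \<xi> = C \<xi>)"
      by blast
    have "X \<noteq> \<infinity>" using none P by auto
    moreover have "X > 0" using P by (simp add: similarity_profile_def)
    ultimately obtain xs where xs: "X = ereal xs" "xs > 0" by (cases X) auto
    show "\<exists>\<xi>s u c. 0 < \<xi>s \<and>
                   maximal_self_similar_solution lam ell gam u_plus c_plus (ereal \<xi>s) u c"
      using maximal_solution_of_maximal_profile[OF _ P max] lam_neg xs by auto
    show "\<forall>X u c. self_similar_solution lam ell gam u_plus c_plus X u c \<longrightarrow> X < \<infinity>"
      using none by (auto simp: self_similar_solution_def less_top[symmetric])
  qed
qed

end
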